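(* Let $\Omega\subset\mathbb{R}^N$ be a bounded open set, $0<s<1$, $1<p<\frac Ns$, and let $V$ be a positive weight in $L^r(\Omega)$ with $r>\frac{N}{sp}$. Let $I(u)=[u]_{s,p}^p+\|u\|_p^p$, $S_V=\{u\in W^{s,p}_0(\Omega):\int_\Omega V|u|^p\,dx=1\}$, and $$\lambda_2(\Omega)=\inf_{f\in\mathcal{C}_1(\Omega)}\ \max_{u\in\operatorname{Im}(f)}I(u),\qquad \mathcal{C}_1(\Omega)=\{f:\mathbb{S}^1\to S_V:\ f\text{ odd and continuous}\}.$$ Then $\lambda_2(\Omega)$ is an eigenvalue of $$(-\Delta_p)^su+|u|^{p-2}u=\lambda V(x)|u|^{p-2}u\ \text{ in }\Omega,\qquad u=0\ \text{ in }\mathbb{R}^N\setminus\Omega .$$ Moreover $\lambda_1(p,V)<\lambda_2(\Omega)$, and every eigenfunction $u\in S_V$ associated to $\lambda_2(\Omega)$ has to change sign.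
   Context: Let $K(N,s,p)=(1-s)\mathcal{K}(N,p)$ with $\mathcal{K}(N,p)^{-1}=\frac1p\int_{\mathbb{S}^{N-1}}|\omega_N|^p\,dS_\omega$, and $[u]_{s,p}^p=K(N,s,p)\iint_{\mathbb{R}^N\times\mathbb{R}^N}\frac{|u(x)-u(y)|^p}{|x-y|^{N+sp}}\,dx\,dy$. $W^{s,p}_0(\Omega)$ is the space of $u\in L^p(\mathbb{R}^N)$ with $[u]_{s,p}<\infty$ and $u=0$ a.e. in $\mathbb{R}^N\setminus\Omega$, with norm $(\|u\|_p^p+[u]_{s,p}^p)^{1/p}$; $S_V$ carries the induced topology. The operator $(-\Delta_p)^s$ is the Fréchet derivative of $u\mapsto\frac1p[u]_{s,p}^p$, i.e. $\langle(-\Delta_p)^su,v\rangle=K(N,s,p)\iint_{\mathbb{R}^{2N}}\frac{|u(x)-u(y)|^{p-2}(u(x)-u(y))(v(x)-v(y))}{|x-y|^{N+sp}}\,dx\,dy$. A real number $\lambda$ is an eigenvalue, with eigenfunction $u$, if $u\in W^{s,p}_0(\Omega)\setminus\{0\}$ and $\langle(-\Delta_p)^su,v\rangle+\int_\Omega|u|^{p-2}uv\,dx=\lambda\int_\Omega V|u|^{p-2}uv\,dx$ for all $v\in W^{s,p}_0(\Omega)$. The first eigenvalue is $$\lambda_1(p,V)=\inf\left\{\frac{[u]_{s,p}^p+\|u\|_p^p}{\int_\Omega V|u|^p\,dx}:\ u\in W^{s,p}_0(\Omega)\setminus\{0\},\ \int_\Omega V|u|^p\,dx>0\right\}.$$ 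*)

theory Defs
  imports "HOL-Analysis.Analysis"
begin

text \<open>
  \<open>\<real>\<^sup>N\<close> is a Euclidean space \<open>'a\<close> with \<open>N = DIM('a)\<close>.  Elements of Lebesgue and Sobolev spaces are
  represented by Lebesgue measurable functions; equality in these spaces is equality almost
  everywhere.
\<close>

definition in_Lp :: "real \<Rightarrow> 'b measure \<Rightarrow> ('b \<Rightarrow> real) \<Rightarrow> bool" where
  "in_Lp q M u \<longleftrightarrow> u \<in> borel_measurable M \<and> integrable M (\<lambda>x. \<bar>u x\<bar> powr q)"

text \<open>
  Surface measure on the unit sphere, via polar coordinates (\<open>|\<cdot>|\<close> is the Lebesgue measure of a set):
  \<open>\<sigma>(E) = N \<cdot> |{x. norm x < 1 \<and> x / norm x \<in> E}|\<close>.  For \<open>N = 1\<close> this is the counting measure on \<open>{-1, 1}\<close>.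
\<close>

definition surface_measure :: "'a::euclidean_space measure" where
  "surface_measure =
     scale_measure (of_nat DIM('a)) (distr (restrict_space lborel (ball 0 1)) borel sgn)"

text \<open>
  The integral of \<open>|\<omega>\<^sub>N|\<^sup>p\<close> over the sphere does not depend on the coordinate by rotation invariance;
  the elements of \<open>Basis\<close> are not ordered, so an arbitrary one is used.
\<close>

definition K_sphere :: "'a::euclidean_space itself \<Rightarrow> real \<Rightarrow> real" where
  "K_sphere _ p =
     inverse (1 / p * (LINT \<omega>:sphere (0::'a) 1|surface_measure. \<bar>\<omega> \<bullet> (SOME b. b \<in> Basis)\<bar> powr p))"

definition K_const :: "'a::euclidean_space itself \<Rightarrow> real \<Rightarrow> real \<Rightarrow> real" where
  "K_const T s p = (1 - s) * K_sphere T p"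

definition gagliardo_density ::
    "real \<Rightarrow> real \<Rightarrow> ('a::euclidean_space \<Rightarrow> real) \<Rightarrow> 'a \<times> 'a \<Rightarrow> real" where
  "gagliardo_density s p u =
     (\<lambda>(x, y). \<bar>u x - u y\<bar> powr p / norm (x - y) powr (real DIM('a) + s * p))"

text \<open>
  The \<open>p\<close>-th power of the seminorm.  The density is nonnegative and measurable for measurable \<open>u\<close>, so
  the seminorm is finite iff the density is integrable.
\<close>

definition gagliardo_pow :: "real \<Rightarrow> real \<Rightarrow> ('a::euclidean_space \<Rightarrow> real) \<Rightarrow> real" where
  "gagliardo_pow s p u = K_const TYPE('a) s p * (LINT z|lebesgue. gagliardo_density s p u z)"

definition energy :: "real \<Rightarrow> real \<Rightarrow> ('a::euclidean_space \<Rightarrow> real) \<Rightarrow> real" where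
  "energy s p u = gagliardo_pow s p u + (LINT x|lebesgue. \<bar>u x\<bar> powr p)"

definition W0 :: "real \<Rightarrow> real \<Rightarrow> 'a::euclidean_space set \<Rightarrow> ('a \<Rightarrow> real) set" where
  "W0 s p \<Omega> = {u. in_Lp p lebesgue u \<and> integrable lebesgue (gagliardo_density s p u)
                 \<and> (AE x in lebesgue. x \<notin> \<Omega> \<longrightarrow> u x = 0)}"

definition W0_norm :: "real \<Rightarrow> real \<Rightarrow> ('a::euclidean_space \<Rightarrow> real) \<Rightarrow> real" where
  "W0_norm s p u = ((LINT x|lebesgue. \<bar>u x\<bar> powr p) + gagliardo_pow s p u) powr (1 / p)"

definition weighted_pow ::
    "real \<Rightarrow> 'a::euclidean_space set \<Rightarrow> ('a \<Rightarrow> real) \<Rightarrow> ('a \<Rightarrow> real) \<Rightarrow> real" where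
  "weighted_pow p \<Omega> V u = (LINT x|lebesgue_on \<Omega>. V x * \<bar>u x\<bar> powr p)"

definition frac_p_laplacian ::
    "real \<Rightarrow> real \<Rightarrow> ('a::euclidean_space \<Rightarrow> real) \<Rightarrow> ('a \<Rightarrow> real) \<Rightarrow> real" where
  "frac_p_laplacian s p u v = K_const TYPE('a) s p *
     (LINT (x, y)|lebesgue. \<bar>u x - u y\<bar> powr (p - 2) * (u x - u y) * (v x - v y)
        / norm (x - y) powr (real DIM('a) + s * p))"

definition eigenfunction ::
    "real \<Rightarrow> real \<Rightarrow> 'a::euclidean_space set \<Rightarrow> ('a \<Rightarrow> real) \<Rightarrow> real \<Rightarrow> ('a \<Rightarrow> real) \<Rightarrow> bool" where
  "eigenfunction s p \<Omega> V \<mu> u \<longleftrightarrow>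
     u \<in> W0 s p \<Omega> \<and> \<not> (AE x in lebesgue. u x = 0) \<and>
     (\<forall>v \<in> W0 s p \<Omega>.
        frac_p_laplacian s p u v + (LINT x|lebesgue_on \<Omega>. \<bar>u x\<bar> powr (p - 2) * u x * v x)
        = \<mu> * (LINT x|lebesgue_on \<Omega>. V x * \<bar>u x\<bar> powr (p - 2) * u x * v x))"

definition eigenvalue ::
    "real \<Rightarrow> real \<Rightarrow> 'a::euclidean_space set \<Rightarrow> ('a \<Rightarrow> real) \<Rightarrow> real \<Rightarrow> bool" where
  "eigenvalue s p \<Omega> V \<mu> \<longleftrightarrow> (\<exists>u. eigenfunction s p \<Omega> V \<mu> u)"

definition first_eigenvalue ::
    "real \<Rightarrow> real \<Rightarrow> 'a::euclidean_space set \<Rightarrow> ('a \<Rightarrow> real) \<Rightarrow> real" where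
  "first_eigenvalue s p \<Omega> V =
     Inf {energy s p u / weighted_pow p \<Omega> V u | u.
            u \<in> W0 s p \<Omega> \<and> \<not> (AE x in lebesgue. u x = 0) \<and> weighted_pow p \<Omega> V u > 0}"

definition S_V ::
    "real \<Rightarrow> real \<Rightarrow> 'a::euclidean_space set \<Rightarrow> ('a \<Rightarrow> real) \<Rightarrow> ('a \<Rightarrow> real) set" where
  "S_V s p \<Omega> V = {u \<in> W0 s p \<Omega>. weighted_pow p \<Omega> V u = 1}"

text \<open>
  Odd continuous maps from the circle to \<open>S_V\<close>, continuity being with respect to the norm of \<open>W0\<close>.
  Values of the maps outside the circle are irrelevant.
\<close>

definition C1_maps ::
    "real \<Rightarrow> real \<Rightarrow> 'a::euclidean_space set \<Rightarrow> ('a \<Rightarrow> real) \<Rightarrow> (complex \<Rightarrow> 'a \<Rightarrow> real) set" where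
  "C1_maps s p \<Omega> V = {f. f \<in> sphere 0 1 \<rightarrow> S_V s p \<Omega> V
     \<and> (\<forall>\<omega> \<in> sphere 0 1. AE x in lebesgue. f (- \<omega>) x = - f \<omega> x)
     \<and> (\<forall>\<omega> \<in> sphere 0 1.
          ((\<lambda>\<omega>'. W0_norm s p (\<lambda>x. f \<omega>' x - f \<omega> x)) \<longlongrightarrow> 0) (at \<omega> within sphere 0 1))}"

text \<open>
  The supremum is a maximum: the energy is continuous and the image of the circle is compact.
\<close>

definition second_eigenvalue ::
    "real \<Rightarrow> real \<Rightarrow> 'a::euclidean_space set \<Rightarrow> ('a \<Rightarrow> real) \<Rightarrow> real" where
  "second_eigenvalue s p \<Omega> V =
     (INF f \<in> C1_maps s p \<Omega> V. SUP u \<in> f ` sphere 0 1. energy s p u)"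

definition changes_sign :: "'a::euclidean_space set \<Rightarrow> ('a \<Rightarrow> real) \<Rightarrow> bool" where
  "changes_sign \<Omega> u \<longleftrightarrow>
     emeasure lebesgue {x \<in> \<Omega>. u x > 0} > 0 \<and> emeasure lebesgue {x \<in> \<Omega>. u x < 0} > 0"

end

(* The second eigenvalue is attained without any deformation argument. For u in W let T u be the
   solution w of (-Delta_p)^s w + |w|^(p-2) w = V |u|^(p-2) u (one step of inverse iteration). T is odd
   and continuous, and on S_V it does not increase the Rayleigh quotient; if the quotient stays the
   same, u is an eigenfunction. Hence T (normalized) maps admissible circles to admissible circles,
   and applying it to nearly optimal ones yields points where the quotient almost does not decrease.
   By compactness they converge to an eigenfunction at the level lambda_2.

   Compactness in L^p(V) comes from averages over dyadic cubes: for r > N/(sp) the V-weighted distance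
   of u to its averages at scale 2^-k decays geometrically in k, uniformly on bounded sets of W.

   lambda_1 < lambda_2: every admissible circle contains a point u with equal weighted mass of its
   positive and negative parts, and a limit of such points with energy lambda_1 is impossible because
   splitting u into u+ and u- strictly lowers the energy. An eigenfunction of constant sign would, by
   Picone's inequality, give lambda_2 <= lambda_1. *)

theory Submission
  imports Defs "HOL-Complex_Analysis.Great_Picard"
begin

subsection \<open>Real inequalities\<close>

text \<open>The usual route deforms circles along a pseudo-gradient flow on S_V and relies on a
  Palais-Smale condition. Iterating a solution operator avoids both because T is completely
  continuous: almost everywhere convergence together with convergence of the weighted p-th powers
  already forces convergence of T u in W, and compactness supplies exactly these two for a sequence
  bounded in energy. The condition r > N/(sp) enters through three factors. On a cube of side 2^-k
  the weight has mass of order at most 2^(-k(N - N/r)), normalizing the averages costs 2^(kN), and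
  the p-th power of the fluctuation of u carries 2^(-ksp). The product is 2^(-k(sp - N/r)). No
  boundedness or Harnack inequality for eigenfunctions is used. Picone's inequality is tested with
  bounded v and with u + e in place of u, and e tends to 0. The deficit in this inequality, usually
  discarded, blows up at pairs where u vanishes at exactly one point; this gives the strong maximum
  principle that the limit e to 0 requires.\<close>

definition dpowr :: "real \<Rightarrow> real \<Rightarrow> real" where
  "dpowr p a = \<bar>a\<bar> powr (p - 2) * a"

lemma dpowr_0 [simp]: "dpowr p 0 = 0"
  by (simp add: dpowr_def)

lemma dpowr_minus [simp]: "dpowr p (- a) = - dpowr p a"
  by (simp add: dpowr_def)

lemma dpowr_nonneg: "0 \<le> a \<Longrightarrow> 0 \<le> dpowr p a"
  by (simp add: dpowr_def)

lemma dpowr_eq_powr: "0 \<le> a \<Longrightarrow> dpowr p a = a powr (p - 1)"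
  using powr_mult_base[of a "p - 2"] by (cases "a = 0") (auto simp: dpowr_def mult.commute)

lemma abs_dpowr: "\<bar>dpowr p a\<bar> = \<bar>a\<bar> powr (p - 1)"
  using dpowr_eq_powr[of "\<bar>a\<bar>" p] by (simp add: dpowr_def abs_mult)

lemma dpowr_mult_self: "dpowr p a * a = \<bar>a\<bar> powr p"
proof (cases "a = 0")
  case False
  have "dpowr p a * a = \<bar>a\<bar> powr (p - 2) * \<bar>a\<bar> powr 2"
    using False by (simp add: dpowr_def power2_eq_square)
  also have "\<dots> = \<bar>a\<bar> powr p"
    by (subst powr_add[symmetric]) simp
  finally show ?thesis .
qed simp

lemma dpowr_scale: "0 \<le> c \<Longrightarrow> dpowr p (c * a) = c powr (p - 1) * dpowr p a"
  using dpowr_eq_powr[of c p] by (simp add: dpowr_def abs_mult powr_mult)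

lemma borel_measurable_dpowr [measurable]: "dpowr p \<in> borel_measurable borel"
  unfolding dpowr_def by measurable

lemma tendsto_abs_powr: "(p::real) > 0 \<Longrightarrow> (f \<longlongrightarrow> (a::real)) F \<Longrightarrow> ((\<lambda>x. \<bar>f x\<bar> powr p) \<longlongrightarrow> \<bar>a\<bar> powr p) F"
  by (intro tendsto_powr2 tendsto_intros) auto

text \<open>For p < 2 the factor \<open>\<bar>a\<bar> powr (p - 2)\<close> is unbounded near 0, so
  continuity cannot be read off the definition. It comes from the form sgn a * |a|^(p-1) away from
  0, and at 0 from the absolute value alone.\<close>

lemma tendsto_dpowr:
  assumes p: "1 < (p::real)" and f: "(f \<longlongrightarrow> a) F"
  shows "((\<lambda>x. dpowr p (f x)) \<longlongrightarrow> dpowr p a) F"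
proof -
  have eq: "dpowr p b = sgn b * \<bar>b\<bar> powr (p - 1)" for b
    using dpowr_eq_powr[of "\<bar>b\<bar>" p] by (auto simp: dpowr_def sgn_if)
  have lim: "((\<lambda>x. \<bar>f x\<bar> powr (p - 1)) \<longlongrightarrow> \<bar>a\<bar> powr (p - 1)) F"
    using p f by (intro tendsto_abs_powr) auto
  show ?thesis
  proof (cases "a = 0")
    case True
    then have "((\<lambda>x. \<bar>dpowr p (f x)\<bar>) \<longlongrightarrow> 0) F"
      using lim p by (simp add: abs_dpowr)
    then show ?thesis
      using True by (simp add: tendsto_rabs_zero_iff)
  next
    case False
    then show ?thesis
      unfolding eq by (intro tendsto_mult tendsto_sgn lim f)
  qed
qed

text \<open>Young's inequality with the conjugate exponent p / (p - 1), which turns |a|^(p-1) into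
  |a|^p.\<close>

lemma Young_dpowr:
  assumes p: "1 < (p::real)"
  shows "dpowr p a * b \<le> (1 - 1 / p) * \<bar>a\<bar> powr p + \<bar>b\<bar> powr p / p"
proof -
  have "dpowr p a * b \<le> \<bar>a\<bar> powr (p - 1) * \<bar>b\<bar>"
    by (metis abs_dpowr abs_ge_self abs_mult)
  also have "\<dots> \<le> (\<bar>a\<bar> powr (p - 1)) powr (p / (p - 1)) / (p / (p - 1)) + \<bar>b\<bar> powr p / p"
    using p by (intro Youngs_inequality) (auto simp: field_simps)
  also have "(\<bar>a\<bar> powr (p - 1)) powr (p / (p - 1)) = \<bar>a\<bar> powr p"
    using p by (simp add: powr_powr)
  finally show ?thesis
    using p by (simp add: field_simps)
qed

text \<open>Young's inequality times p, read as convexity: the graph of |.|^p lies above its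
  tangents. Integrated versions of this line take the place of derivatives of integrals later
  on.\<close>

lemma tangent_le:
  assumes p: "1 < (p::real)"
  shows "\<bar>a\<bar> powr p + p * dpowr p a * (b - a) \<le> \<bar>b\<bar> powr p"
proof -
  have "p * (dpowr p a * b) \<le> p * ((1 - 1 / p) * \<bar>a\<bar> powr p + \<bar>b\<bar> powr p / p)"
    using p by (intro mult_left_mono Young_dpowr) auto
  also have "\<dots> = (p - 1) * \<bar>a\<bar> powr p + \<bar>b\<bar> powr p"
    using p by (simp add: field_simps)
  finally have "p * (dpowr p a * b) \<le> (p - 1) * (dpowr p a * a) + \<bar>b\<bar> powr p"
    by (simp add: dpowr_mult_self)
  then show ?thesis
    unfolding dpowr_mult_self[of p a, symmetric] by (simp add: algebra_simps)
qed

text \<open>The tangents at the intermediate point c are averaged with weights 1 - t and t; the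
  linear terms cancel.\<close>

lemma convex_abs_powr:
  assumes p: "1 < (p::real)" and t: "0 \<le> t" "t \<le> 1"
  shows "\<bar>(1 - t) * a + t * b\<bar> powr p \<le> (1 - t) * \<bar>a\<bar> powr p + t * \<bar>b\<bar> powr p"
proof -
  define c where "c = (1 - t) * a + t * b"
  have "(1 - t) * (\<bar>c\<bar> powr p + p * dpowr p c * (a - c)) + t * (\<bar>c\<bar> powr p + p * dpowr p c * (b - c))
      \<le> (1 - t) * \<bar>a\<bar> powr p + t * \<bar>b\<bar> powr p"
    using t by (intro add_mono mult_left_mono tangent_le p) auto
  moreover have "(1 - t) * (\<bar>c\<bar> powr p + p * dpowr p c * (a - c)) + t * (\<bar>c\<bar> powr p + p * dpowr p c * (b - c))
      = \<bar>c\<bar> powr p + p * dpowr p c * ((1 - t) * a + t * b - c)"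
    by (simp add: algebra_simps)
  ultimately show ?thesis
    by (simp add: c_def)
qed

text \<open>Convexity applied to a / (1 - t) and b / t. The free parameter is the point: the
  constant in front of the first term tends to 1 as t tends to 0, which keeps the sum over dyadic
  levels under control, and a special choice of t yields Picone's inequality.\<close>

lemma add_powr_le:
  assumes p: "1 < (p::real)" and t: "0 < t" "t < 1"
  shows "\<bar>a + b\<bar> powr p \<le> (1 - t) powr (1 - p) * \<bar>a\<bar> powr p + t powr (1 - p) * \<bar>b\<bar> powr p"
proof -
  have eq: "s * \<bar>c / s\<bar> powr p = s powr (1 - p) * \<bar>c\<bar> powr p" if "s > 0" for s c :: real
    using that by (simp add: powr_divide powr_diff abs_divide)
  have "\<bar>(1 - t) * (a / (1 - t)) + t * (b / t)\<bar> powr p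
      \<le> (1 - t) * \<bar>a / (1 - t)\<bar> powr p + t * \<bar>b / t\<bar> powr p"
    using t by (intro convex_abs_powr p) auto
  then show ?thesis
    using t by (simp only: eq) simp
qed

lemma add_powr_le2:
  assumes p: "1 < (p::real)"
  shows "\<bar>a + b\<bar> powr p \<le> 2 powr p * (\<bar>a\<bar> powr p + \<bar>b\<bar> powr p)"
proof -
  have "\<bar>a + b\<bar> powr p \<le> (1 - 1/2) powr (1 - p) * \<bar>a\<bar> powr p + (1/2) powr (1 - p) * \<bar>b\<bar> powr p"
    by (intro add_powr_le p) auto
  also have "\<dots> = 2 powr (p - 1) * (\<bar>a\<bar> powr p + \<bar>b\<bar> powr p)"
    by (simp add: powr_divide powr_diff field_simps)
  also have "\<dots> \<le> 2 powr p * (\<bar>a\<bar> powr p + \<bar>b\<bar> powr p)"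
    by (intro mult_right_mono powr_mono) auto
  finally show ?thesis .
qed

lemma diff_powr_le2:
  assumes p: "1 < (p::real)"
  shows "\<bar>a - b\<bar> powr p \<le> 2 powr p * (\<bar>a\<bar> powr p + \<bar>b\<bar> powr p)"
  using add_powr_le2[OF p, of a "- b"] by simp

lemma dpowr_strict_mono:
  assumes p: "1 < (p::real)" and ab: "a < b"
  shows "dpowr p a < dpowr p b"
proof -
  consider "0 \<le> a" | "a < 0" "0 < b" | "b \<le> 0" using ab by linarith
  then show ?thesis
  proof cases
    case 1
    then show ?thesis using p ab by (simp add: dpowr_eq_powr powr_less_mono2)
  next
    case 2
    have "0 < (-a) powr (p - 1)" "0 < b powr (p-1)" using 2 by auto
    then show ?thesis using 2 dpowr_eq_powr[of "-a" p] dpowr_eq_powr[of b p] dpowr_minus[of p a] by linarith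
  next
    case 3
    have "(-b) powr (p - 1) < (-a) powr (p - 1)" using 3 ab p by (intro powr_less_mono2) auto
    then show ?thesis using 3 ab dpowr_eq_powr[of "-a" p] dpowr_eq_powr[of "-b" p] by simp
  qed
qed

text \<open>Equality at b, compared with the tangents at a and at the midpoint m, would give (dpowr
  p m - dpowr p a) * (b - m) \<le> 0, against strict monotonicity of \<open>dpowr\<close>.\<close>

lemma tangent_strict:
  assumes p: "1 < (p::real)" and ne: "a \<noteq> b"
  shows "\<bar>a\<bar> powr p + p * dpowr p a * (b - a) < \<bar>b\<bar> powr p"
proof (rule ccontr)
  assume "\<not> ?thesis"
  then have eq: "\<bar>b\<bar> powr p = \<bar>a\<bar> powr p + p * dpowr p a * (b - a)"
    using tangent_le[OF p, of a b] by simp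
  define m where "m = (a + b) / 2"
  have 2: "\<bar>m\<bar> powr p + p * dpowr p m * (b - m) \<le> \<bar>b\<bar> powr p"
    by (rule tangent_le[OF p])
  have "p * ((dpowr p m - dpowr p a) * (b - m)) \<le> 0"
    using 2 tangent_le[OF p, of a m] unfolding eq by (simp add: algebra_simps)
  then have "(dpowr p m - dpowr p a) * (b - m) \<le> 0"
    using p by (simp add: mult_le_0_iff)
  moreover have "a < m \<and> m < b \<or> b < m \<and> m < a"
    using ne by (auto simp: m_def)
  ultimately show False
    using dpowr_strict_mono[OF p, of a m] dpowr_strict_mono[OF p, of m a]
    by (auto simp: mult_le_0_iff)
qed

lemma midpoint_strict:
  assumes p: "1 < (p::real)" and ne: "a \<noteq> b"
  shows "\<bar>(a + b) / 2\<bar> powr p < (\<bar>a\<bar> powr p + \<bar>b\<bar> powr p) / 2"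
proof -
  define m where "m = (a + b) / 2"
  have "\<bar>m\<bar> powr p + p * dpowr p m * (a - m) < \<bar>a\<bar> powr p"
    using ne by (intro tangent_strict p) (auto simp: m_def)
  moreover have "\<bar>m\<bar> powr p + p * dpowr p m * (b - m) \<le> \<bar>b\<bar> powr p"
    by (intro tangent_le p)
  ultimately have "2 * \<bar>m\<bar> powr p + p * dpowr p m * (a + b - 2 * m) < \<bar>a\<bar> powr p + \<bar>b\<bar> powr p"
    by (simp add: algebra_simps)
  moreover have "a + b - 2 * m = 0"
    by (simp add: m_def)
  ultimately show ?thesis
    unfolding m_def[symmetric] by simp
qed

text \<open>Write c^p = c * c^(p-1) and enlarge the second factor to (a + b)^(p-1).\<close>

lemma add_powr_superadditive:
  fixes a b :: real
  assumes p: "1 < (p::real)" and ab: "0 \<le> a" "0 \<le> b"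
  shows "a powr p + b powr p \<le> (a + b) powr p"
    and "0 < a \<Longrightarrow> 0 < b \<Longrightarrow> a powr p + b powr p < (a + b) powr p"
proof -
  have eq: "c powr p = c * c powr (p - 1)" if "0 \<le> c" for c :: real
    using that powr_mult_base[of c "p - 1"] by (cases "c = 0") auto
  have le: "a powr (p - 1) \<le> (a + b) powr (p - 1)" "b powr (p - 1) \<le> (a + b) powr (p - 1)"
    using p ab by (auto intro!: powr_mono2)
  have split: "(a + b) powr p = a * (a + b) powr (p - 1) + b * (a + b) powr (p - 1)"
    using ab by (subst eq) (auto simp: algebra_simps)
  show "a powr p + b powr p \<le> (a + b) powr p"
    unfolding split eq[OF ab(1)] eq[OF ab(2)] using ab le by (intro add_mono mult_left_mono) auto
  assume pos: "0 < a" "0 < b"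
  have "a powr (p - 1) < (a + b) powr (p - 1)" "b powr (p - 1) < (a + b) powr (p - 1)"
    using p pos by (auto intro!: powr_less_mono2)
  then show "a powr p + b powr p < (a + b) powr p"
    unfolding split eq[OF ab(1)] eq[OF ab(2)] using pos by (intro add_strict_mono mult_strict_left_mono) auto
qed

text \<open>For a and b of the same sign only one part sees the difference. For opposite signs |a -
  b| = |a| + |b|, and superadditivity is strict; this is the sole source of the strict loss of
  energy when a function is split into its parts.\<close>

lemma pos_neg_parts_powr:
  fixes a b :: real
  assumes p: "1 < (p::real)"
  shows "\<bar>max a 0 - max b 0\<bar> powr p + \<bar>max (- a) 0 - max (- b) 0\<bar> powr p \<le> \<bar>a - b\<bar> powr p"
    and "a > 0 \<Longrightarrow> b < 0 \<Longrightarrow>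
      \<bar>max a 0 - max b 0\<bar> powr p + \<bar>max (- a) 0 - max (- b) 0\<bar> powr p < \<bar>a - b\<bar> powr p"
proof -
  consider "0 \<le> a" "0 \<le> b" | "a \<le> 0" "b \<le> 0" | "0 < a" "b < 0" | "a < 0" "0 < b" by linarith
  then show "\<bar>max a 0 - max b 0\<bar> powr p + \<bar>max (- a) 0 - max (- b) 0\<bar> powr p \<le> \<bar>a - b\<bar> powr p"
  proof cases
    case 3
    then show ?thesis using add_powr_superadditive(1)[OF p, of a "- b"] by (simp add: max_def)
  next
    case 4
    then show ?thesis using add_powr_superadditive(1)[OF p, of "- a" b]
      by (simp add: max_def add.commute abs_if)
  qed (auto simp: max_def abs_minus_commute)
  assume "a > 0" "b < 0"
  then show "\<bar>max a 0 - max b 0\<bar> powr p + \<bar>max (- a) 0 - max (- b) 0\<bar> powr p < \<bar>a - b\<bar> powr p"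
    using add_powr_superadditive(2)[OF p, of a "- b"] by (simp add: max_def)
qed

text \<open>For b < a this is \<open>add_powr_le\<close> for c = (c - d) + d, multiplied by (1 -
  t)^(p-1). The case a < b follows because the left-hand side is invariant under exchanging the two
  points.\<close>

lemma Picone:
  assumes p: "1 < (p::real)" and ab: "0 < a" "0 < b" and cd: "0 \<le> c" "0 \<le> d"
  shows "dpowr p (a - b) * (c powr p / a powr (p - 1) - d powr p / b powr (p - 1)) \<le> \<bar>c - d\<bar> powr p"
proof -
  have main: "dpowr p (a - b) * (c powr p / a powr (p - 1) - d powr p / b powr (p - 1)) \<le> \<bar>c - d\<bar> powr p"
    if ab: "0 < b" "b < a" and cd: "0 \<le> c" "0 \<le> d" for a b c d :: real
  proof -
    \<comment> \<open>With this ratio (a - b)^(p-1) = a^(p-1) (1 - t)^(p-1) and t^(1-p) = (a /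
      b)^(p-1), so the weights of \<open>add_powr_le\<close> become the quotients in the
      claim.\<close>
    define t where "t = b / a"
    have t: "0 < t" "t < 1" using ab by (auto simp: t_def)
    have "c powr p \<le> (1 - t) powr (1 - p) * \<bar>c - d\<bar> powr p + t powr (1 - p) * d powr p"
      using add_powr_le[OF p t, of "c - d" d] cd by simp
    then have "(1 - t) powr (p - 1) * c powr p
        \<le> (1 - t) powr (p - 1) * ((1 - t) powr (1 - p) * \<bar>c - d\<bar> powr p + t powr (1 - p) * d powr p)"
      by (intro mult_left_mono) auto
    also have "\<dots> = ((1 - t) powr (p - 1) * (1 - t) powr (1 - p)) * \<bar>c - d\<bar> powr p
        + (1 - t) powr (p - 1) * t powr (1 - p) * d powr p"
      by (simp add: algebra_simps)
    also have "(1 - t) powr (p - 1) * (1 - t) powr (1 - p) = 1"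
      using t by (simp add: powr_add[symmetric])
    finally have le: "(1 - t) powr (p - 1) * (c powr p - t powr (1 - p) * d powr p) \<le> \<bar>c - d\<bar> powr p"
      by (simp add: algebra_simps)
    have "dpowr p (a - b) = (a * (1 - t)) powr (p - 1)"
      using ab by (simp add: dpowr_eq_powr t_def right_diff_distrib)
    also have "\<dots> = a powr (p - 1) * (1 - t) powr (p - 1)"
      using ab t by (simp add: powr_mult)
    finally have 1: "dpowr p (a - b) = a powr (p - 1) * (1 - t) powr (p - 1)" .
    have "t powr (1 - p) = 1 / t powr (p - 1)"
      using powr_minus_divide[of t "p - 1"] by simp
    also have "\<dots> = a powr (p - 1) / b powr (p - 1)"
      using ab by (simp add: t_def powr_divide)
    finally have 2: "t powr (1 - p) = a powr (p - 1) / b powr (p - 1)" .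
    have "dpowr p (a - b) * (c powr p / a powr (p - 1) - d powr p / b powr (p - 1))
      = (1 - t) powr (p - 1) * (c powr p - t powr (1 - p) * d powr p)"
      unfolding 1 2 using ab by (simp add: field_simps)
    with le show ?thesis by simp
  qed
  consider "a = b" | "b < a" | "a < b" by linarith
  then show ?thesis
  proof cases
    case 3
    have "dpowr p (a - b) = - dpowr p (b - a)"
      using dpowr_minus[of p "b - a"] by simp
    then show ?thesis
      using main[OF ab(1) 3 cd(2) cd(1)] by (simp add: algebra_simps abs_minus_commute)
  qed (use main ab cd in auto)
qed

subsection \<open>Convergence lemmas for \<open>p\<close>-th power integrals\<close>

lemma abs_dpowr_mult_le:
  assumes p: "1 < (p::real)"
  shows "\<bar>dpowr p a * b\<bar> \<le> \<bar>a\<bar> powr p + \<bar>b\<bar> powr p"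
proof -
  have "\<bar>dpowr p a * b\<bar> = dpowr p \<bar>a\<bar> * \<bar>b\<bar>"
    by (simp add: dpowr_def abs_mult)
  also have "\<dots> \<le> (1 - 1 / p) * \<bar>a\<bar> powr p + (1 / p) * \<bar>b\<bar> powr p"
    using Young_dpowr[OF p, of "\<bar>a\<bar>" "\<bar>b\<bar>"] by simp
  also have "\<dots> \<le> 1 * \<bar>a\<bar> powr p + 1 * \<bar>b\<bar> powr p"
    using p by (intro add_mono mult_right_mono) auto
  finally show ?thesis by simp
qed

lemma in_LpD [dest]:
  assumes "in_Lp p M f"
  shows "f \<in> borel_measurable M" "integrable M (\<lambda>x. \<bar>f x\<bar> powr p)"
  using assms by (auto simp: in_Lp_def)

lemma in_Lp_bound:
  assumes f: "integrable M F" and g: "g \<in> borel_measurable M"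
    and le: "AE x in M. \<bar>g x\<bar> powr p \<le> F x"
  shows "in_Lp p M g"
  unfolding in_Lp_def
proof
  show "integrable M (\<lambda>x. \<bar>g x\<bar> powr p)"
    using le g by (intro Bochner_Integration.integrable_bound[OF f]) auto
qed (rule g)

lemma in_Lp_add:
  assumes p: "1 < (p::real)" and f: "in_Lp p M f" and g: "in_Lp p M g"
  shows "in_Lp p M (\<lambda>x. f x + g x)"
proof (rule in_Lp_bound)
  show "integrable M (\<lambda>x. 2 powr p * (\<bar>f x\<bar> powr p + \<bar>g x\<bar> powr p))"
    using f g by (intro integrable_mult_right Bochner_Integration.integrable_add) auto
qed (use f g add_powr_le2[OF p] in \<open>auto intro!: borel_measurable_add simp: in_Lp_def\<close>)

lemma in_Lp_cmult:
  assumes f: "in_Lp p M f"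
  shows "in_Lp p M (\<lambda>x. c * f x)"
  using f by (auto simp: in_Lp_def abs_mult powr_mult)

lemma in_Lp_uminus: "in_Lp p M f \<Longrightarrow> in_Lp p M (\<lambda>x. - f x)"
  using in_Lp_cmult[of p M f "-1"] by simp

lemma in_Lp_diff:
  assumes p: "1 < (p::real)" and f: "in_Lp p M f" and g: "in_Lp p M g"
  shows "in_Lp p M (\<lambda>x. f x - g x)"
  using in_Lp_add[OF p f in_Lp_uminus[OF g]] by simp

lemma integral_cmult_powr:
  fixes f :: "'b \<Rightarrow> real"
  shows "(LINT x|M. \<bar>c * f x\<bar> powr p) = \<bar>c\<bar> powr p * (LINT x|M. \<bar>f x\<bar> powr p)"
  by (simp add: abs_mult powr_mult)

lemma integrable_dpowr_mult:
  assumes p: "1 < (p::real)" and f: "in_Lp p M f" and g: "in_Lp p M g"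
  shows "integrable M (\<lambda>x. dpowr p (f x) * g x)"
proof (rule Bochner_Integration.integrable_bound)
  show "integrable M (\<lambda>x. \<bar>f x\<bar> powr p + \<bar>g x\<bar> powr p)"
    using f g by auto
  show "(\<lambda>x. dpowr p (f x) * g x) \<in> borel_measurable M"
    using f g by (intro borel_measurable_times measurable_compose[OF _ borel_measurable_dpowr]) auto
  show "AE x in M. norm (dpowr p (f x) * g x) \<le> norm (\<bar>f x\<bar> powr p + \<bar>g x\<bar> powr p)"
    using abs_dpowr_mult_le[OF p] by auto
qed

text \<open>Lower semicontinuity is stated as an eventual inequality up to e, so that several such
  statements combine without real-valued liminf. The bound C makes the limit integrable.\<close>

lemma Fatou_real:
  fixes f :: "nat \<Rightarrow> 'b \<Rightarrow> real"
  assumes f: "\<And>n. integrable M (f n)" and nonneg: "\<And>n. AE x in M. 0 \<le> f n x"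
    and g: "g \<in> borel_measurable M" and lim: "AE x in M. (\<lambda>n. f n x) \<longlonglongrightarrow> g x"
    and bound: "\<And>n. (LINT x|M. f n x) \<le> C"
  shows "integrable M g"
    and "e > 0 \<Longrightarrow> \<forall>\<^sub>F n in sequentially. (LINT x|M. g x) - e < (LINT x|M. f n x)"
proof -
  have nonneg': "AE x in M. \<forall>n. 0 \<le> f n x"
    using nonneg by (simp add: AE_all_countable)
  then have g0: "AE x in M. 0 \<le> g x"
    using lim
  proof eventually_elim
    case (elim x)
    then show ?case by (intro LIMSEQ_le_const[OF elim(2)]) auto
  qed
  have [measurable]: "f n \<in> borel_measurable M" for n using f by auto
  have "(\<integral>\<^sup>+x. ennreal (g x) \<partial>M) = (\<integral>\<^sup>+x. liminf (\<lambda>n. ennreal (f n x)) \<partial>M)"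
  proof (rule nn_integral_cong_AE)
    show "AE x in M. ennreal (g x) = liminf (\<lambda>n. ennreal (f n x))"
      using lim
    proof eventually_elim
      case (elim x)
      then have "(\<lambda>n. ennreal (f n x)) \<longlonglongrightarrow> ennreal (g x)" by simp
      then show ?case by (simp add: lim_imp_Liminf)
    qed
  qed
  also have "\<dots> \<le> liminf (\<lambda>n. \<integral>\<^sup>+x. ennreal (f n x) \<partial>M)"
    by (intro nn_integral_liminf) auto
  also have "(\<lambda>n. \<integral>\<^sup>+x. ennreal (f n x) \<partial>M) = (\<lambda>n. ennreal (LINT x|M. f n x))"
    using f nonneg by (intro ext nn_integral_eq_integral) auto
  finally have le: "(\<integral>\<^sup>+x. ennreal (g x) \<partial>M) \<le> liminf (\<lambda>n. ennreal (LINT x|M. f n x))" .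
  also have "\<dots> \<le> ennreal C"
    by (intro Liminf_le) (auto intro!: always_eventually ennreal_leI bound)
  finally have "(\<integral>\<^sup>+x. ennreal (g x) \<partial>M) < \<infinity>"
    by (rule le_less_trans) simp
  then show int: "integrable M g"
    using g g0 by (intro integrableI_nonneg) auto
  assume e: "e > 0"
  show "\<forall>\<^sub>F n in sequentially. (LINT x|M. g x) - e < (LINT x|M. f n x)"
  \<comment> \<open>\<open>ennreal\<close> sends negative numbers to 0, so the comparison there is
    meaningful only for a nonnegative threshold.\<close>
  proof (cases "(LINT x|M. g x) - e < 0")
    case True
    have "0 \<le> (LINT x|M. f n x)" for n
      using nonneg by (rule integral_nonneg_AE)
    then show ?thesis using True by (intro always_eventually allI) (meson less_le_trans)
  next
    case False
    have "ennreal ((LINT x|M. g x) - e) < ennreal (LINT x|M. g x)"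
      using False e by (intro ennreal_lessI) auto
    also have "\<dots> \<le> liminf (\<lambda>n. ennreal (LINT x|M. f n x))"
      using le g0 int by (simp add: nn_integral_eq_integral)
    finally have "\<forall>\<^sub>F n in sequentially. ennreal ((LINT x|M. g x) - e) < ennreal (LINT x|M. f n x)"
      by (rule less_LiminfD)
    then show ?thesis
      by eventually_elim (use False in \<open>auto simp: ennreal_less_iff\<close>)
  qed
qed

text \<open>Dominated convergence with a varying majorant: Fatou is applied to H n + G - |h n - k|,
  which is nonnegative and tends to 2 * G.\<close>

lemma Pratt_dominated_convergence:
  fixes h H :: "nat \<Rightarrow> 'b \<Rightarrow> real"
  assumes h: "\<And>n. h n \<in> borel_measurable M" and k: "k \<in> borel_measurable M"
    and H: "\<And>n. integrable M (H n)" and G: "integrable M G"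
    and limh: "AE x in M. (\<lambda>n. h n x) \<longlonglongrightarrow> k x"
    and limH: "AE x in M. (\<lambda>n. H n x) \<longlonglongrightarrow> G x"
    and le: "\<And>n x. \<bar>h n x\<bar> \<le> H n x"
    and int: "(\<lambda>n. LINT x|M. H n x) \<longlonglongrightarrow> (LINT x|M. G x)"
  shows "(\<lambda>n. LINT x|M. h n x) \<longlonglongrightarrow> (LINT x|M. k x)"
proof -
  have kG: "AE x in M. \<bar>k x\<bar> \<le> G x"
    using limh limH
  proof eventually_elim
    case (elim x)
    show ?case
      by (rule LIMSEQ_le[OF tendsto_rabs[OF elim(1)] elim(2)]) (use le in auto)
  qed
  have inth: "integrable M (h n)" for n
    by (rule Bochner_Integration.integrable_bound[OF H[of n] h])
       (use le[of n] in \<open>auto intro!: AE_I2 intro: order_trans[OF le abs_ge_self]\<close>)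
  have intk: "integrable M k"
    by (rule Bochner_Integration.integrable_bound[OF G k])
       (use kG in eventually_elim, auto)
  obtain C where C: "\<And>n. (LINT x|M. H n x) \<le> C"
  proof -
    have "Bseq (\<lambda>n. LINT x|M. H n x)" using int by (rule convergent_imp_Bseq[OF convergentI])
    then obtain C where "\<And>n. norm (LINT x|M. H n x) \<le> C" by (auto simp: Bseq_def)
    then show ?thesis by (intro that[of C]) (auto intro: order_trans[OF abs_ge_self])
  qed
  let ?f = "\<lambda>n x. H n x + G x - \<bar>h n x - k x\<bar>"
  have fint: "integrable M (?f n)" for n
    using H G inth intk by auto
  have f_eq: "(LINT x|M. ?f n x) = (LINT x|M. H n x) + (LINT x|M. G x) - (LINT x|M. \<bar>h n x - k x\<bar>)" for n
    using H G inth intk by simp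
  have f0: "AE x in M. 0 \<le> ?f n x" for n
    using kG
  proof eventually_elim
    case (elim x)
    then show ?case using le[of n x] by linarith
  qed
  have f_lim: "AE x in M. (\<lambda>n. ?f n x) \<longlonglongrightarrow> 2 * G x"
    using limh limH
  proof eventually_elim
    case (elim x)
    have "(\<lambda>n. ?f n x) \<longlonglongrightarrow> G x + G x - \<bar>k x - k x\<bar>"
      by (intro tendsto_intros elim)
    then show ?case by simp
  qed
  have "(\<lambda>n. LINT x|M. \<bar>h n x - k x\<bar>) \<longlonglongrightarrow> 0"
  proof (rule tendstoI)
    fix e :: real assume e: "e > 0"
    have "\<forall>\<^sub>F n in sequentially. (LINT x|M. 2 * G x) - e / 2 < (LINT x|M. ?f n x)"
    proof (rule Fatou_real(2)[OF fint f0 _ f_lim])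
      show "(LINT x|M. ?f n x) \<le> C + (LINT x|M. G x)" for n
      proof -
      have "0 \<le> (LINT x|M. \<bar>h n x - k x\<bar>)"
        by (rule integral_nonneg_AE) auto
      then show ?thesis unfolding f_eq using C[of n] by linarith
    qed
    qed (use G e in auto)
    moreover have "\<forall>\<^sub>F n in sequentially. dist (LINT x|M. H n x) (LINT x|M. G x) < e / 2"
      using int e by (intro tendstoD) auto
    ultimately show "\<forall>\<^sub>F n in sequentially. dist (LINT x|M. \<bar>h n x - k x\<bar>) 0 < e"
    proof eventually_elim
      case (elim n)
      have "0 \<le> (LINT x|M. \<bar>h n x - k x\<bar>)" by (rule integral_nonneg_AE) auto
      moreover have "\<bar>(LINT x|M. H n x) - (LINT x|M. G x)\<bar> < e / 2"
        using elim(2) by (simp only: dist_real_def)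
      moreover have "(LINT x|M. G x) - e / 2 < (LINT x|M. H n x) - (LINT x|M. \<bar>h n x - k x\<bar>)"
        using elim(1) unfolding f_eq by simp
      ultimately have "\<bar>(LINT x|M. \<bar>h n x - k x\<bar>) - 0\<bar> < e"
        by linarith
      then show ?case by (simp only: dist_real_def)
    qed
  qed
  moreover have "\<bar>(LINT x|M. h n x) - (LINT x|M. k x)\<bar> \<le> (LINT x|M. \<bar>h n x - k x\<bar>)" for n
    using inth intk integral_abs_bound[of M "\<lambda>x. h n x - k x"] by simp
  ultimately have "(\<lambda>n. (LINT x|M. h n x) - (LINT x|M. k x)) \<longlonglongrightarrow> 0"
    by (intro Lim_null_comparison[of "\<lambda>n. (LINT x|M. h n x) - (LINT x|M. k x)"] always_eventually allI) auto
  then show ?thesis by (rule LIM_zero_cancel)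
qed

lemma Lp_Fatou:
  assumes p: "1 < (p::real)" and f: "\<And>n::nat. in_Lp p M (f n)" and g: "g \<in> borel_measurable M"
    and lim: "AE x in M. (\<lambda>n. f n x) \<longlonglongrightarrow> g x"
    and bound: "\<And>n. (LINT x|M. \<bar>f n x\<bar> powr p) \<le> C"
  shows "in_Lp p M g"
    and "e > 0 \<Longrightarrow> \<forall>\<^sub>F n in sequentially. (LINT x|M. \<bar>g x\<bar> powr p) - e < (LINT x|M. \<bar>f n x\<bar> powr p)"
proof -
  have lim': "AE x in M. (\<lambda>n. \<bar>f n x\<bar> powr p) \<longlonglongrightarrow> \<bar>g x\<bar> powr p"
    using lim by eventually_elim (use p in \<open>intro tendsto_abs_powr; simp\<close>)
  note F = Fatou_real[OF in_LpD(2)[OF f] _ _ lim' bound]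
  show "in_Lp p M g"
    unfolding in_Lp_def using g F(1) by simp
  show "e > 0 \<Longrightarrow> \<forall>\<^sub>F n in sequentially. (LINT x|M. \<bar>g x\<bar> powr p) - e < (LINT x|M. \<bar>f n x\<bar> powr p)"
    using g by (intro F(2)) auto
qed

text \<open>The Radon-Riesz property along almost everywhere convergent sequences. The majorants 2^p
  (|f n|^p + |g|^p) vary with n, but their integrals converge by assumption.\<close>

lemma Lp_tendsto_of_norm_tendsto:
  assumes p: "1 < (p::real)" and f: "\<And>n::nat. in_Lp p M (f n)" and g: "in_Lp p M g"
    and lim: "AE x in M. (\<lambda>n. f n x) \<longlonglongrightarrow> g x"
    and norm: "(\<lambda>n. LINT x|M. \<bar>f n x\<bar> powr p) \<longlonglongrightarrow> (LINT x|M. \<bar>g x\<bar> powr p)"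
  shows "(\<lambda>n. LINT x|M. \<bar>f n x - g x\<bar> powr p) \<longlonglongrightarrow> 0"
proof -
  have [measurable]: "f n \<in> borel_measurable M" "g \<in> borel_measurable M" for n using f g by auto
  have "(\<lambda>n. LINT x|M. \<bar>f n x - g x\<bar> powr p) \<longlonglongrightarrow> (LINT x|M. 0)"
  proof (rule Pratt_dominated_convergence)
    show "integrable M (\<lambda>x. 2 powr p * (\<bar>f n x\<bar> powr p + \<bar>g x\<bar> powr p))" for n
      using f g by (intro integrable_mult_right Bochner_Integration.integrable_add) auto
    show "integrable M (\<lambda>x. 2 powr p * (\<bar>g x\<bar> powr p + \<bar>g x\<bar> powr p))"
      using g by (intro integrable_mult_right Bochner_Integration.integrable_add) auto
    show "AE x in M. (\<lambda>n. \<bar>f n x - g x\<bar> powr p) \<longlonglongrightarrow> 0"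
      using lim
    proof eventually_elim
      case (elim x)
      have "(\<lambda>n. \<bar>f n x - g x\<bar> powr p) \<longlonglongrightarrow> \<bar>g x - g x\<bar> powr p"
        using p by (intro tendsto_abs_powr tendsto_intros elim) auto
      then show ?case using p by simp
    qed
    show "AE x in M. (\<lambda>n. 2 powr p * (\<bar>f n x\<bar> powr p + \<bar>g x\<bar> powr p))
        \<longlonglongrightarrow> 2 powr p * (\<bar>g x\<bar> powr p + \<bar>g x\<bar> powr p)"
      using lim
    proof eventually_elim
      case (elim x)
      show ?case using p by (intro tendsto_mult tendsto_add tendsto_const tendsto_abs_powr elim) auto
    qed
    show "\<bar>\<bar>f n x - g x\<bar> powr p\<bar> \<le> 2 powr p * (\<bar>f n x\<bar> powr p + \<bar>g x\<bar> powr p)" for n x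
      using diff_powr_le2[OF p, of "f n x" "g x"] by simp
    have "(\<lambda>n. 2 powr p * ((LINT x|M. \<bar>f n x\<bar> powr p) + (LINT x|M. \<bar>g x\<bar> powr p)))
      \<longlonglongrightarrow> 2 powr p * ((LINT x|M. \<bar>g x\<bar> powr p) + (LINT x|M. \<bar>g x\<bar> powr p))"
      by (intro tendsto_intros norm)
    then show "(\<lambda>n. LINT x|M. 2 powr p * (\<bar>f n x\<bar> powr p + \<bar>g x\<bar> powr p))
      \<longlonglongrightarrow> (LINT x|M. 2 powr p * (\<bar>g x\<bar> powr p + \<bar>g x\<bar> powr p))"
      using f g by (simp add: in_LpD)
  qed auto
  then show ?thesis by simp
qed

text \<open>The converse direction, with the majorants 2^p (|f n - g|^p + |g|^p).\<close>

lemma Lp_norm_tendsto_of_tendsto: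
  assumes p: "1 < (p::real)" and f: "\<And>n::nat. in_Lp p M (f n)" and g: "in_Lp p M g"
    and lim: "AE x in M. (\<lambda>n. f n x) \<longlonglongrightarrow> g x"
    and conv: "(\<lambda>n. LINT x|M. \<bar>f n x - g x\<bar> powr p) \<longlonglongrightarrow> 0"
  shows "(\<lambda>n. LINT x|M. \<bar>f n x\<bar> powr p) \<longlonglongrightarrow> (LINT x|M. \<bar>g x\<bar> powr p)"
proof -
  have [measurable]: "f n \<in> borel_measurable M" "g \<in> borel_measurable M" for n using f g by auto
  have d: "in_Lp p M (\<lambda>x. f n x - g x)" for n using p f g by (intro in_Lp_diff) auto
  show ?thesis
  proof (rule Pratt_dominated_convergence)
    show "integrable M (\<lambda>x. 2 powr p * (\<bar>f n x - g x\<bar> powr p + \<bar>g x\<bar> powr p))" for n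
      using d g by (intro integrable_mult_right Bochner_Integration.integrable_add) auto
    show "integrable M (\<lambda>x. 2 powr p * (0 + \<bar>g x\<bar> powr p))"
      using g by (intro integrable_mult_right Bochner_Integration.integrable_add) auto
    show "AE x in M. (\<lambda>n. \<bar>f n x\<bar> powr p) \<longlonglongrightarrow> \<bar>g x\<bar> powr p"
      using lim by eventually_elim (use p in \<open>intro tendsto_abs_powr; simp\<close>)
    show "AE x in M. (\<lambda>n. 2 powr p * (\<bar>f n x - g x\<bar> powr p + \<bar>g x\<bar> powr p))
        \<longlonglongrightarrow> 2 powr p * (0 + \<bar>g x\<bar> powr p)"
      using lim
    proof eventually_elim
      case (elim x)
      have "(\<lambda>n. \<bar>f n x - g x\<bar> powr p) \<longlonglongrightarrow> \<bar>g x - g x\<bar> powr p"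
        using p by (intro tendsto_abs_powr tendsto_intros elim) auto
      then show ?case using p by (intro tendsto_mult tendsto_add tendsto_const) auto
    qed
    show "\<bar>\<bar>f n x\<bar> powr p\<bar> \<le> 2 powr p * (\<bar>f n x - g x\<bar> powr p + \<bar>g x\<bar> powr p)" for n x
      using add_powr_le2[OF p, of "f n x - g x" "g x"] by simp
    have "(\<lambda>n. 2 powr p * ((LINT x|M. \<bar>f n x - g x\<bar> powr p) + (LINT x|M. \<bar>g x\<bar> powr p)))
      \<longlonglongrightarrow> 2 powr p * (0 + (LINT x|M. \<bar>g x\<bar> powr p))"
      by (intro tendsto_intros conv)
    then show "(\<lambda>n. LINT x|M. 2 powr p * (\<bar>f n x - g x\<bar> powr p + \<bar>g x\<bar> powr p))
      \<longlonglongrightarrow> (LINT x|M. 2 powr p * (0 + \<bar>g x\<bar> powr p))"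
      using d g by (simp add: in_LpD)
  qed auto
qed

text \<open>Joint continuity of the duality pairing; |f n|^p + |g n|^p is the varying majorant.
  Every passage to the limit in a first-order term goes through this statement.\<close>

lemma dpowr_mult_integral_tendsto:
  assumes p: "1 < (p::real)" and f: "\<And>n::nat. in_Lp p M (f n)" and f': "in_Lp p M f'"
    and g: "\<And>n::nat. in_Lp p M (g n)" and g': "in_Lp p M g'"
    and limf: "AE x in M. (\<lambda>n. f n x) \<longlonglongrightarrow> f' x" and limg: "AE x in M. (\<lambda>n. g n x) \<longlonglongrightarrow> g' x"
    and nf: "(\<lambda>n. LINT x|M. \<bar>f n x\<bar> powr p) \<longlonglongrightarrow> (LINT x|M. \<bar>f' x\<bar> powr p)"
    and ng: "(\<lambda>n. LINT x|M. \<bar>g n x\<bar> powr p) \<longlonglongrightarrow> (LINT x|M. \<bar>g' x\<bar> powr p)"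
  shows "(\<lambda>n. LINT x|M. dpowr p (f n x) * g n x) \<longlonglongrightarrow> (LINT x|M. dpowr p (f' x) * g' x)"
proof (rule Pratt_dominated_convergence)
  show "(\<lambda>x. dpowr p (f n x) * g n x) \<in> borel_measurable M" for n
    using integrable_dpowr_mult[OF p f g] by auto
  show "(\<lambda>x. dpowr p (f' x) * g' x) \<in> borel_measurable M"
    using integrable_dpowr_mult[OF p f' g'] by auto
  show "integrable M (\<lambda>x. \<bar>f n x\<bar> powr p + \<bar>g n x\<bar> powr p)" for n
    using f g by (simp add: in_LpD)
  show "integrable M (\<lambda>x. \<bar>f' x\<bar> powr p + \<bar>g' x\<bar> powr p)"
    using f' g' by (simp add: in_LpD)
  show "AE x in M. (\<lambda>n. dpowr p (f n x) * g n x) \<longlonglongrightarrow> dpowr p (f' x) * g' x"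
    using limf limg by eventually_elim (intro tendsto_mult tendsto_dpowr[OF p])
  show "AE x in M. (\<lambda>n. \<bar>f n x\<bar> powr p + \<bar>g n x\<bar> powr p) \<longlonglongrightarrow> \<bar>f' x\<bar> powr p + \<bar>g' x\<bar> powr p"
    using limf limg by eventually_elim (use p in \<open>intro tendsto_add tendsto_abs_powr; simp\<close>)
  show "\<bar>dpowr p (f n x) * g n x\<bar> \<le> \<bar>f n x\<bar> powr p + \<bar>g n x\<bar> powr p" for n x
    by (rule abs_dpowr_mult_le[OF p])
  show "(\<lambda>n. LINT x|M. \<bar>f n x\<bar> powr p + \<bar>g n x\<bar> powr p) \<longlonglongrightarrow> (LINT x|M. \<bar>f' x\<bar> powr p + \<bar>g' x\<bar> powr p)"
    using f g f' g' nf ng by (simp add: in_LpD tendsto_add)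
qed

subsection \<open>Dyadic cubes\<close>

text \<open>Two points lie in the same half-open dyadic cube of side \<open>1 / 2 ^ k\<close> iff \<open>cell k\<close> takes the same
  value at them; this value serves as the label of the cube.\<close>

definition cell :: "nat \<Rightarrow> 'a::euclidean_space \<Rightarrow> 'a" where
  "cell k x = (\<Sum>i\<in>Basis. of_int \<lfloor>2 ^ k * (x \<bullet> i)\<rfloor> *\<^sub>R i)"

lemma cell_inner: "i \<in> Basis \<Longrightarrow> cell k x \<bullet> i = of_int \<lfloor>2 ^ k * (x \<bullet> i)\<rfloor>"
  by (simp add: cell_def)

lemma cell_eq_iff: "cell k x = cell k y \<longleftrightarrow> (\<forall>i\<in>Basis. \<lfloor>2 ^ k * (x \<bullet> i)\<rfloor> = \<lfloor>2 ^ k * (y \<bullet> i)\<rfloor>)"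
  by (simp add: euclidean_eq_iff[of "cell k x"] cell_inner)

lemma cell_measurable [measurable]: "cell k \<in> borel_measurable borel"
  unfolding cell_def by measurable

text \<open>Nestedness of the cubes: in each coordinate the coarse label is the fine one divided by
  2 and rounded down.\<close>

lemma cell_Suc_eqD: 
  assumes "cell (Suc k) x = cell (Suc k) y"
  shows "cell k x = cell k y"
  unfolding cell_eq_iff
proof
  fix i :: 'a assume i: "i \<in> Basis"
  have half: "\<lfloor>2 ^ k * a\<rfloor> = \<lfloor>2 ^ Suc k * a\<rfloor> div 2" for a :: real
    using floor_divide_real_eq_div[of 2 "2 ^ Suc k * a"] by simp
  show "\<lfloor>2 ^ k * (x \<bullet> i)\<rfloor> = \<lfloor>2 ^ k * (y \<bullet> i)\<rfloor>"
    unfolding half using assms i by (simp add: cell_eq_iff)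
qed

lemma cell_eq_norm_le:
  fixes x y :: "'a::euclidean_space"
  assumes "cell k x = cell k y"
  shows "norm (x - y) \<le> real DIM('a) * (1 / 2 ^ k)"
proof -
  have "norm (x - y) \<le> (\<Sum>i\<in>Basis. \<bar>(x - y) \<bullet> i\<bar>)"
    by (rule norm_le_l1)
  also have "\<dots> \<le> (\<Sum>i\<in>(Basis::'a set). 1 / 2 ^ k)"
  proof (rule sum_mono)
    fix i :: 'a assume i: "i \<in> Basis"
    have "\<lfloor>2 ^ k * (x \<bullet> i)\<rfloor> = \<lfloor>2 ^ k * (y \<bullet> i)\<rfloor>"
      using assms i by (simp add: cell_eq_iff)
    then have "\<bar>2 ^ k * (x \<bullet> i) - 2 ^ k * (y \<bullet> i)\<bar> \<le> 1"
      by linarith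
    also have "2 ^ k * (x \<bullet> i) - 2 ^ k * (y \<bullet> i) = 2 ^ k * ((x - y) \<bullet> i)"
      by (simp add: algebra_simps)
    finally show "\<bar>(x - y) \<bullet> i\<bar> \<le> 1 / 2 ^ k"
      by (simp add: abs_mult field_simps)
  qed
  finally show ?thesis by simp
qed

text \<open>The half-open cube lies between an open and a closed box of the same volume.\<close>

lemma emeasure_cell:
  fixes x :: "'a::euclidean_space"
  shows "emeasure lborel {y. cell k y = cell k x} = ennreal ((1 / 2 ^ k) ^ DIM('a))"
proof -
  define l where "l = (1 / 2 ^ k) *\<^sub>R cell k x"
  define u where "u = l + (1 / 2 ^ k) *\<^sub>R One"
  have ul: "(u - l) \<bullet> i = 1 / 2 ^ k" "l \<bullet> i \<le> u \<bullet> i" if "i \<in> Basis" for i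
    using that by (auto simp: u_def inner_simps)
  have l: "l \<bullet> i = of_int \<lfloor>2 ^ k * (x \<bullet> i)\<rfloor> / 2 ^ k" if "i \<in> Basis" for i
    using that by (simp add: l_def cell_inner)
  have u: "u \<bullet> i = (of_int \<lfloor>2 ^ k * (x \<bullet> i)\<rfloor> + 1) / 2 ^ k" if "i \<in> Basis" for i
    using that by (simp add: u_def inner_simps l add_divide_distrib)
  have "box l u \<subseteq> {y. cell k y = cell k x}"
  proof
    fix y assume y: "y \<in> box l u"
    have "\<lfloor>2 ^ k * (y \<bullet> i)\<rfloor> = \<lfloor>2 ^ k * (x \<bullet> i)\<rfloor>" if "i \<in> Basis" for i
      using y that by (intro floor_unique) (auto simp: mem_box l u field_simps dest!: bspec[of _ _ i])
    then show "y \<in> {y. cell k y = cell k x}"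
      by (simp add: cell_eq_iff)
  qed
  then have 1: "emeasure lborel (box l u) \<le> emeasure lborel {y. cell k y = cell k x}"
    by (intro emeasure_mono) auto
  have "{y. cell k y = cell k x} \<subseteq> cbox l u"
  proof
    fix y assume "y \<in> {y. cell k y = cell k x}"
    then have y: "\<lfloor>2 ^ k * (y \<bullet> i)\<rfloor> = \<lfloor>2 ^ k * (x \<bullet> i)\<rfloor>" if "i \<in> Basis" for i
      using that by (simp add: cell_eq_iff)
    show "y \<in> cbox l u"
      unfolding mem_box
    proof
      fix i :: 'a assume i: "i \<in> Basis"
      have "of_int \<lfloor>2 ^ k * (x \<bullet> i)\<rfloor> \<le> 2 ^ k * (y \<bullet> i)" "2 ^ k * (y \<bullet> i) \<le> of_int \<lfloor>2 ^ k * (x \<bullet> i)\<rfloor> + 1"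
        using y[OF i] by linarith+
      then show "l \<bullet> i \<le> y \<bullet> i \<and> y \<bullet> i \<le> u \<bullet> i"
        using i by (simp add: l u field_simps)
    qed
  qed
  then have 2: "emeasure lborel {y. cell k y = cell k x} \<le> emeasure lborel (cbox l u)"
    by (intro emeasure_mono) auto
  have "emeasure lborel (box l u) = ennreal ((1 / 2 ^ k) ^ DIM('a))"
    using ul by (simp add: emeasure_lborel_box)
  moreover have "emeasure lborel (cbox l u) = ennreal ((1 / 2 ^ k) ^ DIM('a))"
    using ul by (simp add: emeasure_lborel_cbox)
  ultimately show ?thesis
    using 1 2 by simp
qed

text \<open>Countability of the labels has two uses: functions of the label are measurable, and the
  diagonal argument for the averages runs over a countable set.\<close>

lemma countable_range_cell: "countable (range (cell k :: 'a::euclidean_space \<Rightarrow> 'a))"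
proof (rule countable_subset)
  show "countable ((\<lambda>f. \<Sum>i\<in>Basis. of_int (f i) *\<^sub>R i :: 'a) ` (PiE Basis (\<lambda>_. UNIV :: int set)))"
    by (intro countable_image countable_PiE) auto
  show "range (cell k :: 'a \<Rightarrow> 'a) \<subseteq> (\<lambda>f. \<Sum>i\<in>Basis. of_int (f i) *\<^sub>R i) ` (PiE Basis (\<lambda>_. UNIV :: int set))"
  proof
    fix z :: 'a assume "z \<in> range (cell k)"
    then obtain x :: 'a where x: "z = cell k x" by auto
    show "z \<in> (\<lambda>f. \<Sum>i\<in>Basis. of_int (f i) *\<^sub>R i) ` (PiE Basis (\<lambda>_. UNIV :: int set))"
      by (rule image_eqI[where x = "restrict (\<lambda>i. \<lfloor>2 ^ k * (x \<bullet> i)\<rfloor>) Basis"]) (auto simp: x cell_def)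
  qed
qed

section \<open>Averages over dyadic cubes\<close>

definition cell_measure :: "nat \<Rightarrow> 'a::euclidean_space \<Rightarrow> 'a measure" where
  "cell_measure k m = uniform_measure lborel {y. cell k y = m}"

definition cell_avg :: "nat \<Rightarrow> ('a::euclidean_space \<Rightarrow> real) \<Rightarrow> 'a \<Rightarrow> real" where
  "cell_avg k u m = (LINT y|cell_measure k m. u y)"

lemma sets_cell_measure [simp, measurable_cong]: "sets (cell_measure k m) = sets borel"
  by (simp add: cell_measure_def uniform_measure_def)

lemma space_cell_measure [simp]: "space (cell_measure k m) = UNIV"
  by (simp add: cell_measure_def uniform_measure_def)

lemma nn_integral_cell_measure:
  fixes x :: "'a::euclidean_space"
  assumes [measurable]: "f \<in> borel_measurable borel"
  shows "(\<integral>\<^sup>+y. f y \<partial>cell_measure k (cell k x))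
    = ennreal (2 ^ (k * DIM('a))) * (\<integral>\<^sup>+y. f y * indicator {y. cell k y = cell k x} y \<partial>lborel)"
proof -
  have "inverse (ennreal ((1 / 2 ^ k) ^ DIM('a))) = ennreal (2 ^ (k * DIM('a)))"
    by (subst inverse_ennreal) (auto simp: power_one_over power_mult)
  then show ?thesis
    unfolding cell_measure_def
    by (subst nn_integral_uniform_measure)
       (auto simp: emeasure_cell divide_ennreal_def mult.commute)
qed

lemma emeasure_cell_measure [simp]:
  fixes x :: "'a::euclidean_space"
  shows "emeasure (cell_measure k (cell k x)) UNIV = 1"
proof -
  have "emeasure (cell_measure k (cell k x)) UNIV = (\<integral>\<^sup>+y. 1 \<partial>cell_measure k (cell k x))"
    by simp
  also have "\<dots> = ennreal (2 ^ (k * DIM('a))) * ennreal ((1 / 2 ^ k) ^ DIM('a))"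
    by (subst nn_integral_cell_measure) (auto simp: emeasure_cell)
  also have "\<dots> = 1"
    by (simp add: ennreal_mult[symmetric] power_one_over power_mult)
  finally show ?thesis .
qed

text \<open>The tangent inequality at the mean, integrated: its linear term has integral 0. The
  right-hand side is an extended integral because it may be infinite.\<close>

lemma Jensen_powr:
  assumes p: "1 < (p::real)" and M: "emeasure M (space M) = 1" and f: "integrable M f"
  shows "ennreal (\<bar>(LINT y|M. f y) - c\<bar> powr p) \<le> (\<integral>\<^sup>+y. ennreal (\<bar>f y - c\<bar> powr p) \<partial>M)"
proof (cases "(\<integral>\<^sup>+y. ennreal (\<bar>f y - c\<bar> powr p) \<partial>M) = \<infinity>")
  case False
  have [measurable]: "f \<in> borel_measurable M" using f by auto
  interpret finite_measure M by (rule finite_measureI) (simp add: M)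
  have m1: "measure M (space M) = 1" using M by (simp add: measure_def)
  have int: "integrable M (\<lambda>y. \<bar>f y - c\<bar> powr p)"
    using False by (intro integrableI_nonneg) (auto simp: top.not_eq_extremum)
  define a where "a = (LINT y|M. f y) - c"
  have "(LINT y|M. \<bar>a\<bar> powr p + p * dpowr p a * ((f y - c) - a)) \<le> (LINT y|M. \<bar>f y - c\<bar> powr p)"
    using f int by (intro integral_mono tangent_le p) auto
  also have "(LINT y|M. \<bar>a\<bar> powr p + p * dpowr p a * ((f y - c) - a)) = \<bar>a\<bar> powr p"
    using f by (simp add: m1 a_def)
  finally have "ennreal (\<bar>a\<bar> powr p) \<le> ennreal (LINT y|M. \<bar>f y - c\<bar> powr p)"
    by (rule ennreal_leI)
  also have "\<dots> = (\<integral>\<^sup>+y. ennreal (\<bar>f y - c\<bar> powr p) \<partial>M)"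
    using int by (simp add: nn_integral_eq_integral)
  finally show ?thesis by (simp add: a_def)
qed simp

text \<open>On a probability measure |u| \<le> 1 + |u|^p suffices.\<close>

lemma integrable_cell_measure:
  fixes u :: "'a::euclidean_space \<Rightarrow> real"
  assumes p: "1 < (p::real)" and u: "in_Lp p lborel u"
  shows "integrable (cell_measure k (cell k x)) u"
proof (rule Bochner_Integration.integrable_bound)
  have [measurable]: "u \<in> borel_measurable borel" using u by (simp add: in_Lp_def)
  have fin: "(\<integral>\<^sup>+y. ennreal (\<bar>u y\<bar> powr p) \<partial>lborel) < \<infinity>"
    using u by (simp add: in_Lp_def nn_integral_eq_integral)
  have "(\<integral>\<^sup>+y. ennreal (1 + \<bar>u y\<bar> powr p) \<partial>cell_measure k (cell k x))
      = (\<integral>\<^sup>+y. 1 \<partial>cell_measure k (cell k x)) + (\<integral>\<^sup>+y. ennreal (\<bar>u y\<bar> powr p) \<partial>cell_measure k (cell k x))"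
    by (subst nn_integral_add[symmetric]) auto
  also have "\<dots> \<le> 1 + ennreal (2 ^ (k * DIM('a))) * (\<integral>\<^sup>+y. ennreal (\<bar>u y\<bar> powr p) \<partial>lborel)"
    by (subst (2) nn_integral_cell_measure)
       (auto intro!: add_mono mult_left_mono nn_integral_mono simp: indicator_def)
  also have "\<dots> < \<infinity>"
    using fin by (simp add: ennreal_mult_less_top)
  finally show "integrable (cell_measure k (cell k x)) (\<lambda>y. 1 + \<bar>u y\<bar> powr p)"
    by (intro integrableI_nonneg) auto
  show "AE y in cell_measure k (cell k x). norm (u y) \<le> norm (1 + \<bar>u y\<bar> powr p)"
  proof (rule AE_I2)
    fix y
    have "\<bar>u y\<bar> \<le> 1 + \<bar>u y\<bar> powr p"
    proof (cases "\<bar>u y\<bar> \<le> 1")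
      case False
      then have "\<bar>u y\<bar> powr 1 \<le> \<bar>u y\<bar> powr p" using p by (intro powr_mono) auto
      then show ?thesis using False by simp
    qed (use powr_ge_zero[of "\<bar>u y\<bar>" p] in linarith)
    then show "norm (u y) \<le> norm (1 + \<bar>u y\<bar> powr p)"
      by simp
  qed
  show "u \<in> borel_measurable (cell_measure k (cell k x))"
    by measurable
qed

text \<open>The map factors through the countable discrete space of labels.\<close>

lemma measurable_cell_comp: "(\<lambda>x. g (cell k x) :: real) \<in> borel_measurable borel"
proof -
  have "cell k \<in> borel \<rightarrow>\<^sub>M count_space (range (cell k :: 'a \<Rightarrow> 'a))"
    by (subst measurable_count_space_eq_countable[OF countable_range_cell])
       (auto intro!: measurable_sets_borel[OF cell_measurable])
  then show ?thesis
    by (rule measurable_compose) simp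
qed

lemma cell_avg_measurable [measurable]: "(\<lambda>x. cell_avg k u (cell k x)) \<in> borel_measurable borel"
  by (rule measurable_cell_comp)

text \<open>The share of the point x in the Gagliardo seminorm. It is extended real valued since it
  is finite only almost everywhere.\<close>

definition local_density :: "real \<Rightarrow> real \<Rightarrow> ('a::euclidean_space \<Rightarrow> real) \<Rightarrow> 'a \<Rightarrow> ennreal" where
  "local_density s p u x = (\<integral>\<^sup>+y. ennreal (gagliardo_density s p u (x, y)) \<partial>lborel)"

lemma gagliardo_density_borel [measurable]:
  fixes u :: "'a::euclidean_space \<Rightarrow> real"
  assumes [measurable]: "u \<in> borel_measurable borel"
  shows "gagliardo_density s p u \<in> borel_measurable (borel \<Otimes>\<^sub>M borel)"
  unfolding gagliardo_density_def by measurable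

lemma local_density_borel [measurable]:
  fixes u :: "'a::euclidean_space \<Rightarrow> real"
  assumes u [measurable]: "u \<in> borel_measurable borel"
  shows "local_density s p u \<in> borel_measurable borel"
  unfolding local_density_def by measurable

lemma nn_integral_local_density:
  fixes u :: "'a::euclidean_space \<Rightarrow> real"
  assumes u [measurable]: "u \<in> borel_measurable borel"
  shows "(\<integral>\<^sup>+x. local_density s p u x \<partial>lborel) = (\<integral>\<^sup>+z. ennreal (gagliardo_density s p u z) \<partial>lborel)"
proof -
  have "(\<integral>\<^sup>+z. ennreal (gagliardo_density s p u z) \<partial>lborel)
      = (\<integral>\<^sup>+z. ennreal (gagliardo_density s p u z) \<partial>(lborel \<Otimes>\<^sub>M lborel))"
    by (simp add: lborel_prod)
  also have "\<dots> = (\<integral>\<^sup>+x. \<integral>\<^sup>+y. ennreal (gagliardo_density s p u (x, y)) \<partial>lborel \<partial>lborel)"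
    by (rule lborel.nn_integral_fst[symmetric]) measurable
  finally show ?thesis by (simp add: local_density_def)
qed

lemma gagliardo_density_nonneg [simp]: "0 \<le> gagliardo_density s p u z"
  by (cases z) (simp add: gagliardo_density_def)

text \<open>Jensen, with the inverse volume 2^(kN) of the cube as the price. It is applied to
  functions with exponent p and to the weight with exponent r.\<close>

lemma cell_avg_le:
  fixes u :: "'a::euclidean_space \<Rightarrow> real"
  assumes p: "1 < (p::real)" and u: "in_Lp p lborel u"
  shows "\<bar>cell_avg k u (cell k x)\<bar> powr p \<le> 2 ^ (k * DIM('a)) * (LINT y|lborel. \<bar>u y\<bar> powr p)"
proof -
  have [measurable]: "u \<in> borel_measurable borel" using u by (simp add: in_Lp_def)
  have "ennreal (\<bar>cell_avg k u (cell k x) - 0\<bar> powr p)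
      \<le> (\<integral>\<^sup>+y. ennreal (\<bar>u y - 0\<bar> powr p) \<partial>cell_measure k (cell k x))"
    unfolding cell_avg_def by (intro Jensen_powr p integrable_cell_measure[OF p u]) simp
  also have "\<dots> \<le> ennreal (2 ^ (k * DIM('a))) * (\<integral>\<^sup>+y. ennreal (\<bar>u y\<bar> powr p) \<partial>lborel)"
    by (subst nn_integral_cell_measure) (auto intro!: mult_left_mono nn_integral_mono simp: indicator_def)
  also have "\<dots> = ennreal (2 ^ (k * DIM('a)) * (LINT y|lborel. \<bar>u y\<bar> powr p))"
    using u by (simp add: nn_integral_eq_integral in_Lp_def ennreal_mult)
  finally show ?thesis
    by (subst (asm) ennreal_le_iff) auto
qed

text \<open>\<open>w_cell\<close> is a Morrey type growth condition on the measure with density w.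
  For a weight in L^r it holds with \<beta> = N / r, and \<beta> < s * p then says r > N / (s *
  p).\<close>

locale dyadic =
  fixes s p :: real and \<beta> A :: real and w :: "'a::euclidean_space \<Rightarrow> ennreal"
  assumes s: "0 < s" and p: "1 < p" and \<beta>: "0 \<le> \<beta>" "\<beta> < s * p" and A: "0 \<le> A"
    and w_borel [measurable]: "w \<in> borel_measurable borel"
    and w_cell: "\<And>k x. (\<integral>\<^sup>+y. w y * indicator {y. cell k y = cell k x} y \<partial>lborel)
        \<le> ennreal (A * 2 powr (- (real k * (real DIM('a) - \<beta>))))"
begin

text \<open>N bounds the diameter of the unit cube through the l1 norm; the exponent is that of the
  kernel.\<close>

definition "C0 = real DIM('a) powr (real DIM('a) + s * p)"

lemma C0_pos: "0 < C0"
  by (simp add: C0_def)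

text \<open>Inside a cube |x - y| \<le> N 2^-k, so |u x - u y|^p is at most (N 2^-k)^(N+sp) times
  the Gagliardo density. Dividing by the volume of the cube leaves 2^(-ksp).\<close>

lemma cell_measure_le_local_density:
  fixes u :: "'a \<Rightarrow> real"
  assumes u [measurable]: "u \<in> borel_measurable borel"
  shows "(\<integral>\<^sup>+y. ennreal (\<bar>u x - u y\<bar> powr p) \<partial>cell_measure k (cell k x))
    \<le> ennreal (C0 * 2 powr (- (real k * (s * p)))) * local_density s p u x"
proof -
  let ?n = "real DIM('a)"
  have sp: "0 < s * p" using s p by simp
  have le: "\<bar>u x - u y\<bar> powr p \<le> (?n * (1 / 2 ^ k)) powr (?n + s * p) * gagliardo_density s p u (x, y)"
    if "cell k y = cell k x" for y
  proof (cases "x = y")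
    case False
    have "\<bar>u x - u y\<bar> powr p = norm (x - y) powr (?n + s * p) * gagliardo_density s p u (x, y)"
      using False by (simp add: gagliardo_density_def)
    also have "\<dots> \<le> (?n * (1 / 2 ^ k)) powr (?n + s * p) * gagliardo_density s p u (x, y)"
      using cell_eq_norm_le[of k x y] that sp by (intro mult_right_mono powr_mono2) auto
    finally show ?thesis .
  qed (use p in simp)
  have const: "2 ^ (k * DIM('a)) * (?n * (1 / 2 ^ k)) powr (?n + s * p) = C0 * 2 powr (- (real k * (s * p)))"
  proof -
    have "(?n * (1 / 2 ^ k)) powr (?n + s * p) = C0 * (2 powr (- real k)) powr (?n + s * p)"
      unfolding C0_def by (subst powr_mult) (auto simp: powr_minus powr_realpow inverse_eq_divide)
    also have "(2 powr (- real k)) powr (?n + s * p) = 2 powr (- (real k * ?n)) * 2 powr (- (real k * (s * p)))"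
      by (simp add: powr_powr powr_add[symmetric] algebra_simps)
    moreover have "(2::real) ^ (k * DIM('a)) = 2 powr (real k * ?n)"
      by (simp add: powr_realpow[symmetric])
    ultimately show ?thesis
      by (simp add: powr_minus)
  qed
  have "(\<integral>\<^sup>+y. ennreal (\<bar>u x - u y\<bar> powr p) \<partial>cell_measure k (cell k x))
    = ennreal (2 ^ (k * DIM('a))) * (\<integral>\<^sup>+y. ennreal (\<bar>u x - u y\<bar> powr p) * indicator {y. cell k y = cell k x} y \<partial>lborel)"
    by (rule nn_integral_cell_measure) measurable
  also have "\<dots> \<le> ennreal (2 ^ (k * DIM('a))) *
      (\<integral>\<^sup>+y. ennreal ((?n * (1 / 2 ^ k)) powr (?n + s * p)) * ennreal (gagliardo_density s p u (x, y)) \<partial>lborel)"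
    by (intro mult_left_mono nn_integral_mono)
       (auto simp: indicator_def ennreal_mult[symmetric] intro!: ennreal_leI le[simplified])
  also have "\<dots> = ennreal (2 ^ (k * DIM('a))) * (ennreal ((?n * (1 / 2 ^ k)) powr (?n + s * p)) * local_density s p u x)"
    unfolding local_density_def by (subst nn_integral_cmult) auto
  also have "\<dots> = ennreal (2 ^ (k * DIM('a)) * (?n * (1 / 2 ^ k)) powr (?n + s * p)) * local_density s p u x"
    by (subst ennreal_mult) (auto simp: mult.assoc)
  finally show ?thesis unfolding const .
qed

lemma diff_cell_avg_le:
  fixes u :: "'a \<Rightarrow> real"
  assumes u: "in_Lp p lborel u"
  shows "ennreal (\<bar>u x - cell_avg k u (cell k x)\<bar> powr p)
    \<le> ennreal (C0 * 2 powr (- (real k * (s * p)))) * local_density s p u x"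
proof -
  have [measurable]: "u \<in> borel_measurable borel" using u by (simp add: in_Lp_def)
  have "ennreal (\<bar>cell_avg k u (cell k x) - u x\<bar> powr p)
      \<le> (\<integral>\<^sup>+y. ennreal (\<bar>u y - u x\<bar> powr p) \<partial>cell_measure k (cell k x))"
    unfolding cell_avg_def by (intro Jensen_powr p integrable_cell_measure[OF p u]) simp
  also have "\<dots> \<le> ennreal (C0 * 2 powr (- (real k * (s * p)))) * local_density s p u x"
    using cell_measure_le_local_density[where u = u and x = x and k = k] by (simp add: abs_minus_commute)
  finally show ?thesis by (simp add: abs_minus_commute)
qed

text \<open>Jensen on the fine cube, then Fubini: the weight gets integrated over the fine cube
  around y, where \<open>w_cell\<close> applies. The powers of 2 combine to 2^\<beta> *
  2^(-k(sp-\<beta>)).\<close>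

lemma cell_avg_step:
  fixes u :: "'a \<Rightarrow> real"
  assumes u: "in_Lp p lborel u"
  shows "(\<integral>\<^sup>+x. w x * ennreal (\<bar>cell_avg (Suc k) u (cell (Suc k) x) - cell_avg k u (cell k x)\<bar> powr p) \<partial>lborel)
    \<le> ennreal (A * C0 * 2 powr \<beta> * 2 powr (- (real k * (s * p - \<beta>)))) * (\<integral>\<^sup>+x. local_density s p u x \<partial>lborel)"
proof -
  let ?n = "real DIM('a)"
  have [measurable]: "u \<in> borel_measurable borel" using u by (simp add: in_Lp_def)
  define c where "c = C0 * 2 powr (- (real k * (s * p)))"
  have c: "0 \<le> c" using C0_pos by (simp add: c_def)
  let ?I = "\<lambda>x y. (if cell (Suc k) y = cell (Suc k) x then 1 else 0) :: ennreal"
  have I: "indicator {y. cell (Suc k) y = cell (Suc k) x} y = ?I x y" for x y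
    by simp
  let ?g = "local_density s p u"
  have le: "ennreal (\<bar>cell_avg (Suc k) u (cell (Suc k) x) - cell_avg k u (cell k x)\<bar> powr p)
      \<le> ennreal (2 ^ (Suc k * DIM('a)) * c) * (\<integral>\<^sup>+y. ?g y * ?I x y \<partial>lborel)" (is "?L \<le> _") for x
  proof -
    have "?L \<le> (\<integral>\<^sup>+y. ennreal (\<bar>u y - cell_avg k u (cell k x)\<bar> powr p) \<partial>cell_measure (Suc k) (cell (Suc k) x))"
      unfolding cell_avg_def[of "Suc k"] by (intro Jensen_powr p integrable_cell_measure[OF p u]) simp
    also have "\<dots> = ennreal (2 ^ (Suc k * DIM('a))) *
        (\<integral>\<^sup>+y. ennreal (\<bar>u y - cell_avg k u (cell k x)\<bar> powr p) * ?I x y \<partial>lborel)"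
      unfolding I[symmetric] by (rule nn_integral_cell_measure) measurable
    also have "(\<integral>\<^sup>+y. ennreal (\<bar>u y - cell_avg k u (cell k x)\<bar> powr p) * ?I x y \<partial>lborel)
        \<le> (\<integral>\<^sup>+y. ennreal c * (?g y * ?I x y) \<partial>lborel)"
    proof (rule nn_integral_mono)
      fix y
      show "ennreal (\<bar>u y - cell_avg k u (cell k x)\<bar> powr p) * ?I x y \<le> ennreal c * (?g y * ?I x y)"
      proof (cases "cell (Suc k) y = cell (Suc k) x")
        case True
        \<comment> \<open>The coarse average belongs to y as well as to x, which makes the pointwise
          estimate available at y.\<close>
        have "cell k x = cell k y" by (rule cell_Suc_eqD) (simp add: True)
        then show ?thesis
          using diff_cell_avg_le[OF u, where x = y and k = k] True by (simp add: c_def)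
      qed simp
    qed
    also have "(\<integral>\<^sup>+y. ennreal c * (?g y * ?I x y) \<partial>lborel) = ennreal c * (\<integral>\<^sup>+y. ?g y * ?I x y \<partial>lborel)"
      by (rule nn_integral_cmult) measurable
    finally show ?thesis
      using c by (simp add: ennreal_mult mult.assoc mult_left_mono)
  qed
  have "(\<integral>\<^sup>+x. w x * ennreal (\<bar>cell_avg (Suc k) u (cell (Suc k) x) - cell_avg k u (cell k x)\<bar> powr p) \<partial>lborel)
     \<le> (\<integral>\<^sup>+x. w x * (ennreal (2 ^ (Suc k * DIM('a)) * c) * (\<integral>\<^sup>+y. ?g y * ?I x y \<partial>lborel)) \<partial>lborel)"
    by (intro nn_integral_mono mult_left_mono le) auto
  also have "\<dots> = (\<integral>\<^sup>+x. ennreal (2 ^ (Suc k * DIM('a)) * c) * (\<integral>\<^sup>+y. w x * (?g y * ?I x y) \<partial>lborel) \<partial>lborel)"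
    by (subst nn_integral_cmult) (auto simp: mult_ac)
  also have "\<dots> = ennreal (2 ^ (Suc k * DIM('a)) * c) * (\<integral>\<^sup>+x. \<integral>\<^sup>+y. w x * (?g y * ?I x y) \<partial>lborel \<partial>lborel)"
    by (rule nn_integral_cmult) measurable
  also have "(\<integral>\<^sup>+x. \<integral>\<^sup>+y. w x * (?g y * ?I x y) \<partial>lborel \<partial>lborel)
      = (\<integral>\<^sup>+y. \<integral>\<^sup>+x. w x * (?g y * ?I x y) \<partial>lborel \<partial>lborel)"
    by (rule lborel_pair.Fubini') measurable
  also have "\<dots> = (\<integral>\<^sup>+y. ?g y * (\<integral>\<^sup>+x. w x * indicator {x. cell (Suc k) x = cell (Suc k) y} x \<partial>lborel) \<partial>lborel)"
    by (subst nn_integral_cmult[symmetric]) (auto intro!: nn_integral_cong simp: indicator_def mult.commute)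
  also have "\<dots> \<le> (\<integral>\<^sup>+y. ?g y * ennreal (A * 2 powr (- (real (Suc k) * (?n - \<beta>)))) \<partial>lborel)"
    by (intro nn_integral_mono mult_left_mono w_cell) auto
  also have "\<dots> = (\<integral>\<^sup>+y. ?g y \<partial>lborel) * ennreal (A * 2 powr (- (real (Suc k) * (?n - \<beta>))))"
    by (rule nn_integral_multc) measurable
  finally have "(\<integral>\<^sup>+x. w x * ennreal (\<bar>cell_avg (Suc k) u (cell (Suc k) x) - cell_avg k u (cell k x)\<bar> powr p) \<partial>lborel)
     \<le> ennreal (2 ^ (Suc k * DIM('a)) * c) * ((\<integral>\<^sup>+y. ?g y \<partial>lborel) * ennreal (A * 2 powr (- (real (Suc k) * (?n - \<beta>)))))"
    by (simp add: mult_left_mono)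
  also have "\<dots> = ennreal (2 ^ (Suc k * DIM('a)) * c * (A * 2 powr (- (real (Suc k) * (?n - \<beta>))))) * (\<integral>\<^sup>+y. ?g y \<partial>lborel)"
    using A c by (simp add: ennreal_mult mult_ac)
  also have "2 ^ (Suc k * DIM('a)) * c * (A * 2 powr (- (real (Suc k) * (?n - \<beta>))))
     = A * C0 * 2 powr \<beta> * 2 powr (- (real k * (s * p - \<beta>)))"
  proof -
    have "(2::real) ^ (Suc k * DIM('a)) = 2 powr (real (Suc k) * ?n)"
      by (simp only: powr_realpow[symmetric] of_nat_mult)
    then have "2 ^ (Suc k * DIM('a)) * c * (A * 2 powr (- (real (Suc k) * (?n - \<beta>))))
       = A * C0 * (2 powr (real (Suc k) * ?n) * 2 powr (- (real k * (s * p))) * 2 powr (- (real (Suc k) * (?n - \<beta>))))"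
      by (simp add: c_def)
    also have "2 powr (real (Suc k) * ?n) * 2 powr (- (real k * (s * p))) * 2 powr (- (real (Suc k) * (?n - \<beta>)))
       = 2 powr (\<beta> + - (real k * (s * p - \<beta>)))"
      unfolding powr_add[symmetric]
      by (rule arg_cong[where f = "\<lambda>t. 2 powr t"]) (simp add: algebra_simps)
    finally show ?thesis by (simp only: powr_add mult.assoc)
  qed
  finally show ?thesis .
qed

definition "\<delta> = s * p - \<beta>"
text \<open>Chosen so that the loss (1 - \<theta>)^(1-p) per level equals 2^(\<delta>/2), half of
  the gain 2^(-\<delta>) on the exponential scale.\<close>

definition "\<theta> = 1 - 2 powr (- (\<delta> / (2 * (p - 1))))"
text \<open>The solution of B = \<theta>^(1-p) A C0 2^\<beta> + 2^(-\<delta>/2) B, the recursion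
  that the induction over levels has to reproduce.\<close>

definition "B = A * C0 * 2 powr \<beta> * \<theta> powr (1 - p) / (1 - 2 powr (- (\<delta> / 2)))"

lemma \<delta>_pos: "0 < \<delta>" using \<beta> by (simp add: \<delta>_def)

lemma two_powr_less_1: "0 < a \<Longrightarrow> (2::real) powr (- a) < 1"
  by (simp add: powr_less_one)

lemma \<theta>: "0 < \<theta>" "\<theta> < 1" "(1 - \<theta>) powr (1 - p) = 2 powr (\<delta> / 2)"
proof -
  show "0 < \<theta>" using two_powr_less_1[of "\<delta> / (2 * (p - 1))"] \<delta>_pos p by (simp add: \<theta>_def)
  show "\<theta> < 1" by (simp add: \<theta>_def)
  have "(\<delta> / (2 * (p - 1))) * (p - 1) = \<delta> / 2" using p by (simp add: field_simps)
  moreover have "- X * (1 - p) = X * (p - 1)" for X by (simp add: algebra_simps)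
  ultimately have "- (\<delta> / (2 * (p - 1))) * (1 - p) = \<delta> / 2" by metis
  then show "(1 - \<theta>) powr (1 - p) = 2 powr (\<delta> / 2)"
    by (simp only: \<theta>_def powr_powr diff_diff_eq2 add_diff_cancel_left')
qed

lemma B_nonneg: "0 \<le> B"
  using two_powr_less_1[of "\<delta> / 2"] \<delta>_pos A C0_pos by (simp add: B_def)

lemma B_step: "\<theta> powr (1 - p) * (A * C0 * 2 powr \<beta> * 2 powr (- (real k * \<delta>)))
    + (1 - \<theta>) powr (1 - p) * (B * 2 powr (- (real (Suc k) * \<delta>))) = B * 2 powr (- (real k * \<delta>))"
proof -
  \<comment> \<open>The net ratio per level: loss 2^(\<delta>/2) times gain 2^(-\<delta>).\<close>
  define q where "q = (2::real) powr (- (\<delta> / 2))"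
  have q: "q < 1" using two_powr_less_1[of "\<delta> / 2"] \<delta>_pos by (simp add: q_def)
  have BB: "A * C0 * 2 powr \<beta> * \<theta> powr (1 - p) = B * (1 - q)"
    using q unfolding B_def q_def[symmetric] by simp
  have "(1 - \<theta>) powr (1 - p) * 2 powr (- (real (Suc k) * \<delta>)) = q * 2 powr (- (real k * \<delta>))"
    unfolding \<theta>(3) q_def powr_add[symmetric]
    by (rule arg_cong[where f = "\<lambda>t. 2 powr t"]) (simp add: field_simps)
  then have "\<theta> powr (1 - p) * (A * C0 * 2 powr \<beta> * 2 powr (- (real k * \<delta>)))
    + (1 - \<theta>) powr (1 - p) * (B * 2 powr (- (real (Suc k) * \<delta>)))
    = (A * C0 * 2 powr \<beta> * \<theta> powr (1 - p)) * 2 powr (- (real k * \<delta>)) + B * (q * 2 powr (- (real k * \<delta>)))"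
    by (simp add: algebra_simps)
  also have "\<dots> = B * 2 powr (- (real k * \<delta>))"
    unfolding BB by (simp add: algebra_simps)
  finally show ?thesis .
qed

text \<open>Backward induction on the level, so that no infinite telescoping sum is needed.\<close>

lemma cell_avg_telescope:
  fixes u :: "'a \<Rightarrow> real"
  assumes u: "in_Lp p lborel u"
  shows "(\<integral>\<^sup>+x. w x * ennreal (\<bar>cell_avg (k + j) u (cell (k + j) x) - cell_avg k u (cell k x)\<bar> powr p) \<partial>lborel)
    \<le> ennreal (B * 2 powr (- (real k * \<delta>))) * (\<integral>\<^sup>+x. local_density s p u x \<partial>lborel)"
proof (induction j arbitrary: k)
  case 0
  show ?case using p by simp
next
  case (Suc j)
  let ?a = "\<lambda>k x. cell_avg k u (cell k x)"
  let ?G = "\<integral>\<^sup>+x. local_density s p u x \<partial>lborel"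
  have "(\<integral>\<^sup>+x. w x * ennreal (\<bar>?a (k + Suc j) x - ?a k x\<bar> powr p) \<partial>lborel)
     \<le> (\<integral>\<^sup>+x. ennreal (\<theta> powr (1 - p)) * (w x * ennreal (\<bar>?a (Suc k) x - ?a k x\<bar> powr p))
        + ennreal ((1 - \<theta>) powr (1 - p)) * (w x * ennreal (\<bar>?a (Suc k + j) x - ?a (Suc k) x\<bar> powr p)) \<partial>lborel)"
  proof (rule nn_integral_mono)
    fix x
    have "\<bar>(?a (Suc k + j) x - ?a (Suc k) x) + (?a (Suc k) x - ?a k x)\<bar> powr p
      \<le> (1 - \<theta>) powr (1 - p) * \<bar>?a (Suc k + j) x - ?a (Suc k) x\<bar> powr p + \<theta> powr (1 - p) * \<bar>?a (Suc k) x - ?a k x\<bar> powr p"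
      by (rule add_powr_le[OF p \<theta>(1,2)])
    then have "ennreal (\<bar>?a (k + Suc j) x - ?a k x\<bar> powr p)
      \<le> ennreal (\<theta> powr (1 - p)) * ennreal (\<bar>?a (Suc k) x - ?a k x\<bar> powr p)
        + ennreal ((1 - \<theta>) powr (1 - p)) * ennreal (\<bar>?a (Suc k + j) x - ?a (Suc k) x\<bar> powr p)"
      by (simp add: ennreal_mult[symmetric] ennreal_plus[symmetric] ennreal_leI add.commute del: ennreal_plus)
    then have "w x * ennreal (\<bar>?a (k + Suc j) x - ?a k x\<bar> powr p)
      \<le> w x * (ennreal (\<theta> powr (1 - p)) * ennreal (\<bar>?a (Suc k) x - ?a k x\<bar> powr p)
        + ennreal ((1 - \<theta>) powr (1 - p)) * ennreal (\<bar>?a (Suc k + j) x - ?a (Suc k) x\<bar> powr p))"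
      by (rule mult_left_mono) simp
    then show "w x * ennreal (\<bar>?a (k + Suc j) x - ?a k x\<bar> powr p)
      \<le> ennreal (\<theta> powr (1 - p)) * (w x * ennreal (\<bar>?a (Suc k) x - ?a k x\<bar> powr p))
        + ennreal ((1 - \<theta>) powr (1 - p)) * (w x * ennreal (\<bar>?a (Suc k + j) x - ?a (Suc k) x\<bar> powr p))"
      by (simp add: distrib_left mult_ac)
  qed
  also have "\<dots> = ennreal (\<theta> powr (1 - p)) * (\<integral>\<^sup>+x. w x * ennreal (\<bar>?a (Suc k) x - ?a k x\<bar> powr p) \<partial>lborel)
        + ennreal ((1 - \<theta>) powr (1 - p)) * (\<integral>\<^sup>+x. w x * ennreal (\<bar>?a (Suc k + j) x - ?a (Suc k) x\<bar> powr p) \<partial>lborel)"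
    by (simp add: nn_integral_add nn_integral_cmult)
  also have "\<dots> \<le> ennreal (\<theta> powr (1 - p)) * (ennreal (A * C0 * 2 powr \<beta> * 2 powr (- (real k * \<delta>))) * ?G)
        + ennreal ((1 - \<theta>) powr (1 - p)) * (ennreal (B * 2 powr (- (real (Suc k) * \<delta>))) * ?G)"
    unfolding \<delta>_def by (intro add_mono mult_left_mono cell_avg_step[OF u] Suc.IH[unfolded \<delta>_def]) auto
  also have "\<dots> = ennreal (\<theta> powr (1 - p) * (A * C0 * 2 powr \<beta> * 2 powr (- (real k * \<delta>)))
        + (1 - \<theta>) powr (1 - p) * (B * 2 powr (- (real (Suc k) * \<delta>)))) * ?G"
    using A C0_pos B_nonneg
    by (subst ennreal_plus) (auto simp: ennreal_mult distrib_right mult.assoc)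
  finally show ?case unfolding B_step .
qed

text \<open>A differentiation theorem that comes for free: wherever the local density is finite,
  \<open>diff_cell_avg_le\<close> decays geometrically in k.\<close>

lemma AE_cell_avg_tendsto:
  fixes u :: "'a \<Rightarrow> real"
  assumes u: "in_Lp p lborel u" and G: "(\<integral>\<^sup>+x. local_density s p u x \<partial>lborel) < \<infinity>"
  shows "AE x in lborel. (\<lambda>k. cell_avg k u (cell k x)) \<longlonglongrightarrow> u x"
proof -
  have [measurable]: "u \<in> borel_measurable borel" using u by (simp add: in_Lp_def)
  have "AE x in lborel. local_density s p u x \<noteq> \<infinity>"
    using G by (intro nn_integral_PInf_AE) auto
  then show ?thesis
  proof eventually_elim
    case (elim x)
    then obtain g where g: "local_density s p u x = ennreal g" "0 \<le> g"
      by (cases "local_density s p u x") auto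
    have le: "\<bar>u x - cell_avg k u (cell k x)\<bar> powr p \<le> C0 * 2 powr (- (real k * (s * p))) * g" for k
      using diff_cell_avg_le[OF u, where x = x and k = k] g C0_pos
      by (simp add: ennreal_mult[symmetric] ennreal_le_iff)
    have "(\<lambda>k. 2 powr (- (real k * (s * p)))) \<longlonglongrightarrow> 0"
    proof -
      have "(\<lambda>k. (2 powr (- (s * p))) ^ k) \<longlonglongrightarrow> 0"
        using two_powr_less_1[of "s * p"] s p by (intro LIMSEQ_realpow_zero) auto
      then show ?thesis
        by (simp add: powr_realpow[symmetric] powr_powr mult_ac)
    qed
    then have "(\<lambda>k. C0 * 2 powr (- (real k * (s * p))) * g) \<longlonglongrightarrow> 0"
      by (intro tendsto_mult_left_zero tendsto_mult_right_zero)
    then have "(\<lambda>k. \<bar>u x - cell_avg k u (cell k x)\<bar> powr p) \<longlonglongrightarrow> 0"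
      by (rule tendsto_sandwich[OF always_eventually always_eventually tendsto_const, rotated 2]) (use le in auto)
    then have "(\<lambda>k. (\<bar>u x - cell_avg k u (cell k x)\<bar> powr p) powr (1 / p)) \<longlonglongrightarrow> 0 powr (1 / p)"
      using p by (intro tendsto_powr2) auto
    then have "(\<lambda>k. \<bar>u x - cell_avg k u (cell k x)\<bar>) \<longlonglongrightarrow> 0"
      using p by (simp add: powr_powr)
    then have "(\<lambda>k. u x - cell_avg k u (cell k x)) \<longlonglongrightarrow> 0"
      by (simp add: tendsto_rabs_zero_iff)
    then have "(\<lambda>k. u x - (u x - cell_avg k u (cell k x))) \<longlonglongrightarrow> u x - 0"
      by (intro tendsto_intros)
    then show ?case by simp
  qed
qed

text \<open>Fatou in \<open>cell_avg_telescope\<close> as j tends to infinity. Finiteness of w makes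
  multiplication by w x continuous on the extended reals.\<close>

lemma weighted_diff_cell_avg_le:
  fixes u :: "'a \<Rightarrow> real"
  assumes u: "in_Lp p lborel u" and G: "(\<integral>\<^sup>+x. local_density s p u x \<partial>lborel) < \<infinity>"
    and w: "\<And>x. w x < \<infinity>"
  shows "(\<integral>\<^sup>+x. w x * ennreal (\<bar>u x - cell_avg k u (cell k x)\<bar> powr p) \<partial>lborel)
    \<le> ennreal (B * 2 powr (- (real k * \<delta>))) * (\<integral>\<^sup>+x. local_density s p u x \<partial>lborel)"
proof -
  have [measurable]: "u \<in> borel_measurable borel" using u by (simp add: in_Lp_def)
  let ?a = "\<lambda>k x. cell_avg k u (cell k x)"
  have "(\<integral>\<^sup>+x. w x * ennreal (\<bar>u x - ?a k x\<bar> powr p) \<partial>lborel)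
      = (\<integral>\<^sup>+x. liminf (\<lambda>j. w x * ennreal (\<bar>?a (k + j) x - ?a k x\<bar> powr p)) \<partial>lborel)"
  proof (rule nn_integral_cong_AE)
    show "AE x in lborel. w x * ennreal (\<bar>u x - ?a k x\<bar> powr p)
        = liminf (\<lambda>j. w x * ennreal (\<bar>?a (k + j) x - ?a k x\<bar> powr p))"
      using AE_cell_avg_tendsto[OF u G]
    proof eventually_elim
      case (elim x)
      then have "(\<lambda>j. ?a (j + k) x) \<longlonglongrightarrow> u x" by (rule LIMSEQ_ignore_initial_segment)
      then have "(\<lambda>j. w x * ennreal (\<bar>?a (k + j) x - ?a k x\<bar> powr p)) \<longlonglongrightarrow> w x * ennreal (\<bar>u x - ?a k x\<bar> powr p)"
        using p w[of x] by (intro ennreal_tendsto_cmult tendsto_ennrealI tendsto_abs_powr tendsto_intros) (auto simp: add.commute)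
      then show ?case by (simp add: lim_imp_Liminf)
    qed
  qed
  also have "\<dots> \<le> liminf (\<lambda>j. \<integral>\<^sup>+x. w x * ennreal (\<bar>?a (k + j) x - ?a k x\<bar> powr p) \<partial>lborel)"
    by (intro nn_integral_liminf) measurable
  also have "\<dots> \<le> ennreal (B * 2 powr (- (real k * \<delta>))) * (\<integral>\<^sup>+x. local_density s p u x \<partial>lborel)"
    by (intro Liminf_le) (auto intro!: always_eventually cell_avg_telescope[OF u])
  finally show ?thesis .
qed

end

subsection \<open>The function space and its functionals\<close>

lemma null_sets_vimage_fst_snd:
  fixes N :: "'a::euclidean_space set"
  assumes N: "N \<in> null_sets lborel"
  shows "N \<times> UNIV \<in> null_sets (lborel :: ('a \<times> 'a) measure)"
    and "UNIV \<times> N \<in> null_sets (lborel :: ('a \<times> 'a) measure)"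
proof -
  have [measurable]: "N \<in> sets lborel" and N0: "emeasure lborel N = 0" using N by auto
  have [measurable]: "N \<in> sets borel" using N by auto
  have "emeasure (lborel \<Otimes>\<^sub>M lborel) (N \<times> (UNIV :: 'a set)) = emeasure lborel N * emeasure lborel (UNIV :: 'a set)"
    "emeasure (lborel \<Otimes>\<^sub>M lborel) ((UNIV :: 'a set) \<times> N) = emeasure lborel (UNIV :: 'a set) * emeasure lborel N"
    by (rule lborel.emeasure_pair_measure_Times; simp)+
  moreover have "N \<times> (UNIV :: 'a set) \<in> sets (lborel \<Otimes>\<^sub>M lborel)" "(UNIV :: 'a set) \<times> N \<in> sets (lborel \<Otimes>\<^sub>M lborel)"
    by (intro pair_measureI; simp)+
  ultimately have "N \<times> (UNIV :: 'a set) \<in> null_sets (lborel \<Otimes>\<^sub>M lborel)"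
    "(UNIV :: 'a set) \<times> N \<in> null_sets (lborel \<Otimes>\<^sub>M lborel)"
    using N0 by (auto simp: null_sets_def)
  then show "N \<times> UNIV \<in> null_sets (lborel :: ('a \<times> 'a) measure)"
    "UNIV \<times> N \<in> null_sets (lborel :: ('a \<times> 'a) measure)"
    by (simp_all add: lborel_prod)
qed

lemma AE_lebesgue_fst_snd:
  fixes P :: "'a::euclidean_space \<Rightarrow> bool"
  assumes P: "AE x in lebesgue. P x"
  shows "AE z in (lebesgue :: ('a \<times> 'a) measure). P (fst z) \<and> P (snd z)"
proof -
  have "AE x in lborel. P x" using P by (simp add: AE_completion_iff)
  then obtain N where N: "N \<in> null_sets lborel" "{x. \<not> P x} \<subseteq> N"
    by (auto simp: eventually_ae_filter)
  have "AE z in (lborel :: ('a \<times> 'a) measure). P (fst z) \<and> P (snd z)"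
    by (rule AE_I'[where N = "N \<times> UNIV \<union> UNIV \<times> N"])
       (use N null_sets_vimage_fst_snd[OF N(1)] in \<open>auto intro!: null_sets.Un\<close>)
  then show ?thesis by (rule AE_completion)
qed

text \<open>Borel measurability extends to the completed target because preimages of null sets under
  the projection are null.\<close>

lemma measurable_lebesgue_fst [measurable]: "fst \<in> (lebesgue :: ('a::euclidean_space \<times> 'a) measure) \<rightarrow>\<^sub>M lebesgue"
proof (rule completion.measurable_completion2)
  show m: "fst \<in> (lebesgue :: ('a \<times> 'a) measure) \<rightarrow>\<^sub>M (lborel :: 'a measure)"
    by (intro measurable_completion) (simp add: lborel_prod[symmetric])
  show "null_sets (lborel :: 'a measure) \<subseteq> null_sets (distr (lebesgue :: ('a \<times> 'a) measure) lborel fst)"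
  proof
    fix N :: "'a set" assume N: "N \<in> null_sets lborel"
    have "(fst -` N :: ('a \<times> 'a) set) = N \<times> UNIV" by auto
    then show "N \<in> null_sets (distr (lebesgue :: ('a \<times> 'a) measure) lborel fst)"
      using null_sets_vimage_fst_snd(1)[OF N] N m by (subst null_sets_distr_iff) (auto intro: null_sets_completionI)
  qed
qed

lemma measurable_lebesgue_snd [measurable]: "snd \<in> (lebesgue :: ('a::euclidean_space \<times> 'a) measure) \<rightarrow>\<^sub>M lebesgue"
proof (rule completion.measurable_completion2)
  show m: "snd \<in> (lebesgue :: ('a \<times> 'a) measure) \<rightarrow>\<^sub>M (lborel :: 'a measure)"
    by (intro measurable_completion) (simp add: lborel_prod[symmetric])
  show "null_sets (lborel :: 'a measure) \<subseteq> null_sets (distr (lebesgue :: ('a \<times> 'a) measure) lborel snd)"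
  proof
    fix N :: "'a set" assume N: "N \<in> null_sets lborel"
    have "(snd -` N :: ('a \<times> 'a) set) = UNIV \<times> N" by auto
    then show "N \<in> null_sets (distr (lebesgue :: ('a \<times> 'a) measure) lborel snd)"
      using null_sets_vimage_fst_snd(2)[OF N] N m by (subst null_sets_distr_iff) (auto intro: null_sets_completionI)
  qed
qed

lemma borel_imp_lebesgue_measurable: "f \<in> borel_measurable borel \<Longrightarrow> f \<in> borel_measurable lebesgue"
  by (simp add: measurable_completion)

text \<open>The constant is an inverse, so the spherical integral must be shown to be nonzero. If it
  vanished, x \<bullet> b = 0 would hold almost everywhere in the unit ball, hence everywhere there,
  the hyperplane being closed.\<close>

lemma K_sphere_pos:
  assumes p: "1 < (p::real)"
  shows "0 < K_sphere TYPE('a::euclidean_space) p"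
proof -
  define b :: 'a where "b = (SOME b. b \<in> Basis)"
  have b: "b \<in> Basis" unfolding b_def by (rule SOME_Basis)
  define M where "M = distr (restrict_space lborel (ball (0::'a) 1)) borel sgn"
  define f where "f = (\<lambda>\<omega>::'a. indicator (sphere 0 1) \<omega> * \<bar>\<omega> \<bullet> b\<bar> powr p)"
  have sgn [measurable]: "(sgn :: 'a \<Rightarrow> 'a) \<in> borel_measurable borel"
    unfolding sgn_div_norm by measurable
  then have sgn': "(sgn :: 'a \<Rightarrow> 'a) \<in> restrict_space lborel (ball (0::'a) 1) \<rightarrow>\<^sub>M borel"
    by (simp add: measurable_restrict_space1)
  have f [measurable]: "f \<in> borel_measurable borel" unfolding f_def using p
    by (intro borel_measurable_times borel_measurable_indicator borel_closed borel_measurable_continuous_onI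
        continuous_on_powr' continuous_intros) auto
  have f01: "0 \<le> f x" "f x \<le> 1" for x
  proof -
    show "0 \<le> f x" by (simp add: f_def)
    have "\<bar>x \<bullet> b\<bar> powr p \<le> 1" if "norm x = 1"
      using Basis_le_norm[OF b, of x] that p by (intro powr_le1) auto
    then show "f x \<le> 1" by (auto simp: f_def indicator_def)
  qed
  have M: "emeasure M UNIV < \<infinity>"
  proof -
    have "emeasure M UNIV = emeasure lborel (ball (0::'a) 1)"
      using sgn' by (simp add: M_def emeasure_distr emeasure_restrict_space)
    also have "\<dots> < \<infinity>" by (rule emeasure_bounded_finite) simp
    finally show ?thesis .
  qed
  have surf: "(LINT \<omega>:sphere (0::'a) 1|surface_measure. \<bar>\<omega> \<bullet> b\<bar> powr p) = real DIM('a) * (LINT \<omega>|M. f \<omega>)"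
  proof -
    have "(LINT \<omega>:sphere (0::'a) 1|surface_measure. \<bar>\<omega> \<bullet> b\<bar> powr p) = (LINT \<omega>|surface_measure. f \<omega>)"
      by (simp add: set_lebesgue_integral_def f_def)
    also have "\<dots> = enn2real (\<integral>\<^sup>+\<omega>. ennreal (f \<omega>) \<partial>surface_measure)"
      by (intro integral_eq_nn_integral) (use f01 in \<open>auto simp: surface_measure_def\<close>)
    also have "\<dots> = enn2real (of_nat DIM('a) * (\<integral>\<^sup>+\<omega>. ennreal (f \<omega>) \<partial>M))"
      unfolding surface_measure_def M_def[symmetric]
      by (subst nn_integral_scale_measure) (auto simp: M_def)
    also have "\<dots> = real DIM('a) * enn2real (\<integral>\<^sup>+\<omega>. ennreal (f \<omega>) \<partial>M)"
      by (simp add: enn2real_mult ennreal_of_nat_eq_real_of_nat)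
    also have "enn2real (\<integral>\<^sup>+\<omega>. ennreal (f \<omega>) \<partial>M) = (LINT \<omega>|M. f \<omega>)"
      by (intro integral_eq_nn_integral[symmetric]) (use f01 in \<open>auto simp: M_def\<close>)
    finally show ?thesis .
  qed
  have int: "integrable M f"
  proof (rule Bochner_Integration.integrable_bound)
    interpret finite_measure M by (rule finite_measureI) (use M in \<open>auto simp: M_def\<close>)
    show "integrable M (\<lambda>_. 1::real)" by simp
  qed (use f01 in \<open>auto simp: M_def\<close>)
  have "(LINT \<omega>|M. f \<omega>) \<noteq> 0"
  proof
    assume "(LINT \<omega>|M. f \<omega>) = 0"
    then have "AE \<omega> in M. f \<omega> = 0"
      using int f01 by (subst (asm) integral_nonneg_eq_0_iff_AE) auto
    then have "AE x in lborel. x \<in> ball 0 1 \<longrightarrow> f (sgn x) = 0"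
      unfolding M_def using sgn' by (subst (asm) AE_distr_iff) (auto simp: AE_restrict_space_iff)
    then have "AE x in lborel. x \<in> ball 0 1 \<longrightarrow> x \<in> {x. x \<bullet> b = 0}"
    proof eventually_elim
      case (elim x)
      show ?case
      proof
        assume "x \<in> ball 0 1"
        with elim have "f (sgn x) = 0" by simp
        then show "x \<in> {x. x \<bullet> b = 0}"
          by (cases "x = 0") (auto simp: f_def indicator_def norm_sgn sgn_div_norm split: if_splits)
      qed
    qed
    then have ae: "AE x\<in>ball 0 1 in lebesgue. x \<in> {x. x \<bullet> b = 0}"
      by (rule AE_completion)
    have cl: "closed {x. x \<bullet> b = 0}" by (intro closed_Collect_eq continuous_intros)
    have "norm b = 1" using b by simp
    \<comment> \<open>The point b / 2 of the ball lies off the hyperplane.\<close>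
    then have mem: "b /\<^sub>R 2 \<in> ball 0 1" by simp
    have "b /\<^sub>R 2 \<in> {x. x \<bullet> b = 0}"
      by (rule mem_closed_if_AE_lebesgue_open[OF open_ball cl ae mem])
    then show False using b by simp
  qed
  moreover have "0 \<le> (LINT \<omega>|M. f \<omega>)" using f01 by (intro integral_nonneg_AE) auto
  ultimately have "0 < (LINT \<omega>|M. f \<omega>)" by simp
  then show ?thesis
    unfolding K_sphere_def b_def[symmetric] surf using p by simp
qed

section \<open>Measures absorbing the kernel and the weight\<close>

definition diff_fun :: "('a::ab_group_add \<Rightarrow> real) \<Rightarrow> 'a \<times> 'a \<Rightarrow> real" where
  "diff_fun u z = u (fst z) - u (snd z)"

definition kernel :: "real \<Rightarrow> real \<Rightarrow> 'a::euclidean_space \<times> 'a \<Rightarrow> real" where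
  "kernel s p z = K_const TYPE('a) s p / norm (fst z - snd z) powr (real DIM('a) + s * p)"

lemma kernel_measurable [measurable]: "kernel s p \<in> borel_measurable (lebesgue :: ('a::euclidean_space \<times> 'a) measure)"
proof -
  have "kernel s p \<in> borel_measurable (borel :: ('a \<times> 'a) measure)"
    unfolding kernel_def borel_prod[symmetric] by measurable
  then show ?thesis by (rule borel_imp_lebesgue_measurable)
qed

text \<open>The constant and the kernel of the seminorm are absorbed in the measure.  Division by zero makes
  the kernel vanish on the diagonal, which is a null set anyway.\<close>

definition pair_measure :: "real \<Rightarrow> real \<Rightarrow> ('a::euclidean_space \<times> 'a) measure" where
  "pair_measure s p = density lebesgue (\<lambda>z. ennreal (kernel s p z))"

lemma sets_pair_measure [simp, measurable_cong]: "sets (pair_measure s p) = sets lebesgue"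
  by (simp add: pair_measure_def)

lemma space_pair_measure [simp]: "space (pair_measure s p) = UNIV"
  by (simp add: pair_measure_def)

lemma AE_pair_measureI:
  assumes "AE x in lebesgue. P x"
  shows "AE z in pair_measure s p. P (fst z) \<and> P (snd z)"
  unfolding pair_measure_def using AE_lebesgue_fst_snd[OF assms]
  by (subst AE_density) (measurable, auto)

lemma diff_fun_measurable:
  assumes [measurable]: "u \<in> borel_measurable lebesgue"
  shows "diff_fun u \<in> borel_measurable (pair_measure s p)"
  unfolding diff_fun_def by measurable

definition weight_measure :: "'a::euclidean_space set \<Rightarrow> ('a \<Rightarrow> real) \<Rightarrow> 'a measure" where
  "weight_measure \<Omega> V = density lebesgue (\<lambda>x. ennreal (if x \<in> \<Omega> then V x else 0))"

lemma sets_weight_measure [simp, measurable_cong]: "sets (weight_measure \<Omega> V) = sets lebesgue"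
  by (simp add: weight_measure_def)

lemma space_weight_measure [simp]: "space (weight_measure \<Omega> V) = UNIV"
  by (simp add: weight_measure_def)

locale weighted_problem =
  fixes \<Omega> :: "'a::euclidean_space set" and V :: "'a \<Rightarrow> real" and s p r :: real
  assumes \<Omega>: "open \<Omega>" "bounded \<Omega>" "\<Omega> \<noteq> {}"
    and s: "0 < s" "s < 1" and p: "1 < p" "p < real DIM('a) / s"
    and r: "real DIM('a) / (s * p) < r"
    and V: "in_Lp r (lebesgue_on \<Omega>) V" "AE x in lebesgue_on \<Omega>. V x > 0"
begin

abbreviation "\<mu> \<equiv> pair_measure s p :: ('a \<times> 'a) measure"
abbreviation "\<nu> \<equiv> weight_measure \<Omega> V"
abbreviation "W \<equiv> W0 s p \<Omega>"
abbreviation "E \<equiv> energy s p :: ('a \<Rightarrow> real) \<Rightarrow> real"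
abbreviation "\<Psi> \<equiv> weighted_pow p \<Omega> V"

lemma sp_pos: "0 < s * p" using s p by simp

lemma K_pos: "0 < K_const TYPE('a) s p"
  using K_sphere_pos[OF p(1), where 'a = 'a] s by (simp add: K_const_def)

lemma kernel_nonneg: "0 \<le> kernel s p (z :: 'a \<times> 'a)"
  using K_pos by (simp add: kernel_def)

lemma \<Omega>_lebesgue [measurable]: "\<Omega> \<in> sets lebesgue" "\<Omega> \<in> sets borel"
  using \<Omega>(1) by auto

lemma weight_measurable [measurable]: "(\<lambda>x. if x \<in> \<Omega> then V x else 0) \<in> borel_measurable lebesgue"
  using V(1) by (intro borel_measurable_if_I) (auto simp: in_Lp_def)

lemma weight_pos_AE: "AE x in lebesgue. x \<in> \<Omega> \<longrightarrow> 0 < V x"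
  using V(2) by (subst (asm) AE_restrict_space_iff) auto

lemma weight_nonneg_AE: "AE x in lebesgue. 0 \<le> (if x \<in> \<Omega> then V x else 0)"
  using weight_pos_AE by eventually_elim auto

text \<open>Positivity of V almost everywhere makes \<nu> and Lebesgue measure on \<Omega> have the
  same null sets.\<close>

lemma AE_\<nu>_iff: "(AE x in \<nu>. P x) \<longleftrightarrow> (AE x in lebesgue. x \<in> \<Omega> \<longrightarrow> P x)"
proof -
  have "(AE x in \<nu>. P x) \<longleftrightarrow> (AE x in lebesgue. 0 < ennreal (if x \<in> \<Omega> then V x else 0) \<longrightarrow> P x)"
    unfolding weight_measure_def by (rule AE_density) measurable
  also have "\<dots> \<longleftrightarrow> (AE x in lebesgue. x \<in> \<Omega> \<longrightarrow> P x)"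
  proof
    assume "AE x in lebesgue. 0 < ennreal (if x \<in> \<Omega> then V x else 0) \<longrightarrow> P x"
    with weight_pos_AE show "AE x in lebesgue. x \<in> \<Omega> \<longrightarrow> P x" by eventually_elim auto
  next
    assume "AE x in lebesgue. x \<in> \<Omega> \<longrightarrow> P x"
    then show "AE x in lebesgue. 0 < ennreal (if x \<in> \<Omega> then V x else 0) \<longrightarrow> P x" by eventually_elim auto
  qed
  finally show ?thesis .
qed

lemma AE_\<nu>I: "AE x in lebesgue. P x \<Longrightarrow> AE x in \<nu>. P x"
  unfolding AE_\<nu>_iff by (rule eventually_mono) auto

lemma borel_measurable_\<nu> [simp]: "borel_measurable \<nu> = borel_measurable lebesgue"
  by (intro measurable_cong_sets) auto

lemma integral_\<nu>:
  assumes [measurable]: "f \<in> borel_measurable lebesgue"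
  shows "(LINT x|\<nu>. f x) = (LINT x|lebesgue_on \<Omega>. V x * f x)"
  unfolding weight_measure_def
  by (subst integral_density)
     (auto simp: integral_restrict_space weight_nonneg_AE intro!: Bochner_Integration.integral_cong)

lemma weighted_pow_eq: "u \<in> borel_measurable lebesgue \<Longrightarrow> \<Psi> u = (LINT x|\<nu>. \<bar>u x\<bar> powr p)"
  unfolding weighted_pow_def by (subst integral_\<nu>) auto

lemma gagliardo_density_eq:
  fixes u :: "'a \<Rightarrow> real"
  shows "K_const TYPE('a) s p * gagliardo_density s p u z = kernel s p z * \<bar>diff_fun u z\<bar> powr p"
  by (cases z) (simp add: gagliardo_density_def kernel_def diff_fun_def)

lemma integrable_gagliardo_iff:
  assumes u: "u \<in> borel_measurable lebesgue"
  shows "integrable lebesgue (gagliardo_density s p u) \<longleftrightarrow> in_Lp p \<mu> (diff_fun u)"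
proof -
  have [measurable]: "diff_fun u \<in> borel_measurable lebesgue"
    using diff_fun_measurable[OF u, of s p] by (simp add: measurable_cong_sets[OF sets_pair_measure refl])
  have "in_Lp p \<mu> (diff_fun u) \<longleftrightarrow> integrable \<mu> (\<lambda>z. \<bar>diff_fun u z\<bar> powr p)"
    using diff_fun_measurable[OF u] by (simp add: in_Lp_def)
  also have "\<dots> \<longleftrightarrow> integrable lebesgue (\<lambda>z. kernel s p z *\<^sub>R \<bar>diff_fun u z\<bar> powr p)"
    unfolding pair_measure_def by (rule integrable_density) (auto simp: kernel_nonneg)
  also have "\<dots> \<longleftrightarrow> integrable lebesgue (\<lambda>z. K_const TYPE('a) s p * gagliardo_density s p u z)"
    by (simp add: gagliardo_density_eq)
  also have "\<dots> \<longleftrightarrow> integrable lebesgue (gagliardo_density s p u)"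
    using K_pos by simp
  finally show ?thesis ..
qed

lemma gagliardo_pow_eq:
  assumes u: "u \<in> borel_measurable lebesgue"
  shows "gagliardo_pow s p u = (LINT z|\<mu>. \<bar>diff_fun u z\<bar> powr p)"
proof -
  have [measurable]: "diff_fun u \<in> borel_measurable lebesgue"
    using diff_fun_measurable[OF u, of s p] by (simp add: measurable_cong_sets[OF sets_pair_measure refl])
  have "(LINT z|\<mu>. \<bar>diff_fun u z\<bar> powr p) = (LINT z|lebesgue. kernel s p z *\<^sub>R \<bar>diff_fun u z\<bar> powr p)"
    unfolding pair_measure_def by (rule integral_density) (auto simp: kernel_nonneg)
  then show ?thesis
    unfolding gagliardo_pow_def by (simp add: gagliardo_density_eq[symmetric])
qed

lemma frac_p_laplacian_eq:
  assumes u: "u \<in> borel_measurable lebesgue" and v: "v \<in> borel_measurable lebesgue"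
  shows "frac_p_laplacian s p u v = (LINT z|\<mu>. dpowr p (diff_fun u z) * diff_fun v z)"
proof -
  have [measurable]: "diff_fun u \<in> borel_measurable lebesgue" "diff_fun v \<in> borel_measurable lebesgue"
    using diff_fun_measurable[OF u, of s p] diff_fun_measurable[OF v, of s p]
    by (simp_all add: measurable_cong_sets[OF sets_pair_measure refl])
  have "(LINT z|\<mu>. dpowr p (diff_fun u z) * diff_fun v z)
      = (LINT z|lebesgue. kernel s p z *\<^sub>R (dpowr p (diff_fun u z) * diff_fun v z))"
    unfolding pair_measure_def by (rule integral_density) (auto simp: kernel_nonneg)
  also have "\<dots> = (LINT z|lebesgue. K_const TYPE('a) s p * (\<bar>u (fst z) - u (snd z)\<bar> powr (p - 2) * (u (fst z) - u (snd z))
      * (v (fst z) - v (snd z)) / norm (fst z - snd z) powr (real DIM('a) + s * p)))"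
    by (intro Bochner_Integration.integral_cong) (auto simp: kernel_def diff_fun_def dpowr_def)
  also have "\<dots> = K_const TYPE('a) s p * (LINT z|lebesgue. \<bar>u (fst z) - u (snd z)\<bar> powr (p - 2) * (u (fst z) - u (snd z))
      * (v (fst z) - v (snd z)) / norm (fst z - snd z) powr (real DIM('a) + s * p))"
    by (rule integral_mult_right_zero)
  finally show ?thesis
    unfolding frac_p_laplacian_def by (simp only: case_prod_beta')
qed

lemma W_iff: "u \<in> W \<longleftrightarrow> in_Lp p lebesgue u \<and> in_Lp p \<mu> (diff_fun u) \<and> (AE x in lebesgue. x \<notin> \<Omega> \<longrightarrow> u x = 0)"
  using integrable_gagliardo_iff[of u] by (auto simp: W0_def in_Lp_def)

lemma WD:
  assumes "u \<in> W"
  shows "in_Lp p lebesgue u" "in_Lp p \<mu> (diff_fun u)" "AE x in lebesgue. x \<notin> \<Omega> \<longrightarrow> u x = 0"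
    "u \<in> borel_measurable lebesgue"
  using assms by (auto simp: W_iff in_Lp_def)

lemma energy_eq:
  "u \<in> borel_measurable lebesgue \<Longrightarrow> E u = (LINT z|\<mu>. \<bar>diff_fun u z\<bar> powr p) + (LINT x|lebesgue. \<bar>u x\<bar> powr p)"
  by (simp add: energy_def gagliardo_pow_eq)

lemma W_add: 
  assumes u: "u \<in> W" and v: "v \<in> W"
  shows "(\<lambda>x. u x + v x) \<in> W"
  unfolding W_iff
proof (intro conjI)
  show "in_Lp p lebesgue (\<lambda>x. u x + v x)"
    by (intro in_Lp_add p WD u v)
  have "in_Lp p \<mu> (\<lambda>z. diff_fun u z + diff_fun v z)"
    by (intro in_Lp_add p WD u v)
  then show "in_Lp p \<mu> (diff_fun (\<lambda>x. u x + v x))"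
    by (simp add: diff_fun_def[abs_def] algebra_simps)
  show "AE x in lebesgue. x \<notin> \<Omega> \<longrightarrow> u x + v x = 0"
    using WD(3)[OF u] WD(3)[OF v] by eventually_elim auto
qed

lemma W_cmult: 
  assumes u: "u \<in> W"
  shows "(\<lambda>x. c * u x) \<in> W"
  unfolding W_iff
proof (intro conjI)
  show "in_Lp p lebesgue (\<lambda>x. c * u x)"
    by (intro in_Lp_cmult WD u)
  have "in_Lp p \<mu> (\<lambda>z. c * diff_fun u z)"
    by (intro in_Lp_cmult WD u)
  then show "in_Lp p \<mu> (diff_fun (\<lambda>x. c * u x))"
    by (simp add: diff_fun_def[abs_def] algebra_simps)
  show "AE x in lebesgue. x \<notin> \<Omega> \<longrightarrow> c * u x = 0"
    using WD(3)[OF u] by eventually_elim auto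
qed

lemma W_diff: "u \<in> W \<Longrightarrow> v \<in> W \<Longrightarrow> (\<lambda>x. u x - v x) \<in> W"
  using W_add[OF _ W_cmult[of v "-1"]] by simp

lemma diff_fun_cmult: "diff_fun (\<lambda>x. c * u x) z = c * diff_fun u z"
  by (simp add: diff_fun_def algebra_simps)

lemma E_cmult: 
  assumes u: "u \<in> W"
  shows "E (\<lambda>x. c * u x) = \<bar>c\<bar> powr p * E u"
  using WD(4)[OF u] WD(4)[OF W_cmult[OF u]]
  by (simp only: energy_eq diff_fun_cmult integral_cmult_powr) (simp add: algebra_simps)

lemma \<Psi>_cmult: "u \<in> W \<Longrightarrow> \<Psi> (\<lambda>x. c * u x) = \<bar>c\<bar> powr p * \<Psi> u"
  using WD(4)[of u] WD(4)[OF W_cmult[of u]] by (simp only: weighted_pow_eq integral_cmult_powr)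

lemma E_nonneg: "u \<in> W \<Longrightarrow> 0 \<le> E u"
  using WD(4)[of u] by (simp add: energy_eq)

lemma \<Psi>_nonneg: "u \<in> W \<Longrightarrow> 0 \<le> \<Psi> u"
  using WD(4)[of u] by (simp add: weighted_pow_eq)

text \<open>The derivatives of \<open>E / p\<close> and \<open>\<Psi> / p\<close>.\<close>

definition dE :: "('a \<Rightarrow> real) \<Rightarrow> ('a \<Rightarrow> real) \<Rightarrow> real" where
  "dE u v = (LINT z|\<mu>. dpowr p (diff_fun u z) * diff_fun v z) + (LINT x|lebesgue. dpowr p (u x) * v x)"

definition d\<Psi> :: "('a \<Rightarrow> real) \<Rightarrow> ('a \<Rightarrow> real) \<Rightarrow> real" where
  "d\<Psi> u v = (LINT x|\<nu>. dpowr p (u x) * v x)"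

text \<open>Since u vanishes almost everywhere outside \<Omega>, the zeroth order integral over
  \<Omega> equals the one over the whole space, and the equation becomes a relation between two
  derivatives.\<close>

lemma eigenfunction_iff:
  "eigenfunction s p \<Omega> V c u \<longleftrightarrow>
    u \<in> W \<and> \<not> (AE x in lebesgue. u x = 0) \<and> (\<forall>v\<in>W. dE u v = c * d\<Psi> u v)"
proof -
  have "frac_p_laplacian s p u v + (LINT x|lebesgue_on \<Omega>. \<bar>u x\<bar> powr (p - 2) * u x * v x) = dE u v
     \<and> (LINT x|lebesgue_on \<Omega>. V x * \<bar>u x\<bar> powr (p - 2) * u x * v x) = d\<Psi> u v"
    if u: "u \<in> W" and v: "v \<in> W" for v
  proof
    have [measurable]: "u \<in> borel_measurable lebesgue" "v \<in> borel_measurable lebesgue" using WD(4) u v by auto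
    have m [measurable]: "(\<lambda>x. dpowr p (u x) * v x) \<in> borel_measurable lebesgue" by measurable
    have "(LINT x|lebesgue_on \<Omega>. \<bar>u x\<bar> powr (p - 2) * u x * v x)
        = (LINT x|lebesgue. indicator \<Omega> x *\<^sub>R (dpowr p (u x) * v x))"
      by (subst integral_restrict_space) (auto simp: dpowr_def)
    also have "\<dots> = (LINT x|lebesgue. dpowr p (u x) * v x)"
    proof (rule integral_cong_AE)
      show "AE x in lebesgue. indicator \<Omega> x *\<^sub>R (dpowr p (u x) * v x) = dpowr p (u x) * v x"
        using WD(3)[OF u] by eventually_elim (auto simp: indicator_def)
    qed measurable
    finally show "frac_p_laplacian s p u v + (LINT x|lebesgue_on \<Omega>. \<bar>u x\<bar> powr (p - 2) * u x * v x) = dE u v"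
      by (simp add: dE_def frac_p_laplacian_eq)
    show "(LINT x|lebesgue_on \<Omega>. V x * \<bar>u x\<bar> powr (p - 2) * u x * v x) = d\<Psi> u v"
      unfolding d\<Psi>_def by (subst integral_\<nu>[OF m]) (simp add: dpowr_def mult.assoc)
  qed
  then show ?thesis
    unfolding eigenfunction_def by auto
qed

end

subsection \<open>The weighted embedding\<close>

text \<open>A substitute for Hoelder without roots: either |a| \<le> \<eta>, or |a| \<le>
  \<eta>^(1-p) |a|^p. Choosing \<eta> small passes from smallness of p-th powers to smallness in
  L1.\<close>

lemma integral_abs_le_powr:
  assumes p: "1 < (p::real)" and M: "finite_measure M" and f: "in_Lp p M f" and \<eta>: "0 < \<eta>"
  shows "integrable M f"
    and "(LINT x|M. \<bar>f x\<bar>) \<le> \<eta> * measure M (space M) + \<eta> powr (1 - p) * (LINT x|M. \<bar>f x\<bar> powr p)"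
proof -
  interpret finite_measure M by fact
  have [measurable]: "f \<in> borel_measurable M" using f by (simp add: in_Lp_def)
  have le: "\<bar>a\<bar> \<le> \<eta> + \<eta> powr (1 - p) * \<bar>a\<bar> powr p" for a
  proof (cases "\<bar>a\<bar> \<le> \<eta>")
    case True
    have "0 \<le> \<eta> powr (1 - p) * \<bar>a\<bar> powr p" by simp
    then show ?thesis using True by linarith
  next
    case False
    have "\<bar>a\<bar> = \<bar>a\<bar> powr (1 - p) * \<bar>a\<bar> powr p"
      using False \<eta> by (simp add: powr_add[symmetric])
    also have "\<dots> \<le> \<eta> powr (1 - p) * \<bar>a\<bar> powr p"
      using False \<eta> p by (intro mult_right_mono powr_mono2') auto
    finally show ?thesis using \<eta> by linarith
  qed
  have int: "integrable M (\<lambda>x. \<eta> + \<eta> powr (1 - p) * \<bar>f x\<bar> powr p)"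
    using f by (simp add: in_LpD)
  show fi: "integrable M f"
    by (rule Bochner_Integration.integrable_bound[OF int])
       (auto intro!: AE_I2 order_trans[OF le abs_ge_self])
  have "(LINT x|M. \<bar>f x\<bar>) \<le> (LINT x|M. \<eta> + \<eta> powr (1 - p) * \<bar>f x\<bar> powr p)"
    using fi int by (intro integral_mono le) auto
  also have "\<dots> = \<eta> * measure M (space M) + \<eta> powr (1 - p) * (LINT x|M. \<bar>f x\<bar> powr p)"
    using f by (simp add: in_LpD)
  finally show "(LINT x|M. \<bar>f x\<bar>) \<le> \<eta> * measure M (space M) + \<eta> powr (1 - p) * (LINT x|M. \<bar>f x\<bar> powr p)" .
qed

text \<open>Prepares the extraction of an almost everywhere convergent subsequence, which is carried
  out in L1.\<close>

lemma Lp_Cauchy_imp_L1_Cauchy: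
  fixes f :: "nat \<Rightarrow> 'b \<Rightarrow> real"
  assumes p: "1 < (p::real)" and M: "finite_measure M" and f: "\<And>n. in_Lp p M (f n)"
    and C: "\<And>e. 0 < e \<Longrightarrow> \<exists>N. \<forall>i\<ge>N. \<forall>j\<ge>N. (LINT x|M. \<bar>f i x - f j x\<bar> powr p) < e"
    and e: "0 < e"
  shows "\<exists>N. \<forall>i\<ge>N. \<forall>j\<ge>N. (LINT x|M. norm (f i x - f j x)) < e"
proof -
  define m where "m = measure M (space M)"
  have m: "0 \<le> m" by (simp add: m_def)
  \<comment> \<open>Gives \<eta> * m < e / 2; the added 1 covers m = 0.\<close>
  define \<eta> where "\<eta> = e / (2 * (m + 1))"
  have \<eta>: "0 < \<eta>" "\<eta> * m < e / 2" using e m by (auto simp: \<eta>_def field_simps)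
  obtain N where N: "\<And>i j. i \<ge> N \<Longrightarrow> j \<ge> N \<Longrightarrow> (LINT x|M. \<bar>f i x - f j x\<bar> powr p) < (e / 2) / \<eta> powr (1 - p)"
    using C[of "(e / 2) / \<eta> powr (1 - p)"] e \<eta> by auto
  show ?thesis
  proof (intro exI allI impI)
    fix i j assume ij: "i \<ge> N" "j \<ge> N"
    have "(LINT x|M. \<bar>f i x - f j x\<bar>) \<le> \<eta> * m + \<eta> powr (1 - p) * (LINT x|M. \<bar>f i x - f j x\<bar> powr p)"
      unfolding m_def by (intro integral_abs_le_powr p M in_Lp_diff f \<eta>)
    also have "\<dots> < e / 2 + e / 2"
      using N[OF ij] \<eta> by (intro add_strict_mono) (auto simp: field_simps)
    finally show "(LINT x|M. norm (f i x - f j x)) < e" by simp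
  qed
qed

context weighted_problem
begin

lemma r_gt_1: "1 < r"
proof -
  have "1 < real DIM('a) / (s * p)" using s p by (simp add: field_simps)
  then show ?thesis using r by simp
qed

lemma finite_emeasure_\<Omega>: "emeasure lborel \<Omega> < \<infinity>"
  using emeasure_bounded_finite[OF \<Omega>(2)] by simp

text \<open>Take |g| + 1 on \<Omega> for a Borel version g of V. The constant 1 is in L^r because
  \<Omega> is bounded, and the majorant is Borel, as the dyadic estimates demand.\<close>

lemma ex_weight_majorant:
  "\<exists>f. f \<in> borel_measurable borel \<and> (\<forall>x. 0 \<le> f x) \<and> (\<forall>x. x \<in> \<Omega> \<longrightarrow> 1 \<le> f x)
     \<and> (\<forall>x. x \<notin> \<Omega> \<longrightarrow> f x = 0) \<and> in_Lp r lborel f \<and> (AE x in lebesgue. x \<in> \<Omega> \<longrightarrow> V x \<le> f x)"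
proof -
  let ?V = "\<lambda>x. if x \<in> \<Omega> then V x else 0"
  obtain g where g [measurable]: "g \<in> borel_measurable borel" and Vg: "AE x in lborel. ?V x = g x"
    using completion_ex_borel_measurable_real[OF weight_measurable] by auto
  define f where "f = (\<lambda>x. indicator \<Omega> x * (\<bar>g x\<bar> + 1))"
  have f [measurable]: "f \<in> borel_measurable borel" unfolding f_def by measurable
  have "integrable lebesgue (\<lambda>x. indicator \<Omega> x *\<^sub>R \<bar>V x\<bar> powr r)"
    using V(1) by (subst integrable_restrict_space[symmetric]) (auto simp: in_Lp_def)
  then have "integrable lebesgue (\<lambda>x. indicator \<Omega> x * \<bar>g x\<bar> powr r)"
  proof (rule Bochner_Integration.integrable_cong_AE_imp)
    show "(\<lambda>x. indicator \<Omega> x * \<bar>g x\<bar> powr r) \<in> borel_measurable lebesgue"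
      by (rule borel_imp_lebesgue_measurable) measurable
    show "AE x in lebesgue. indicator \<Omega> x *\<^sub>R \<bar>V x\<bar> powr r = indicator \<Omega> x * \<bar>g x\<bar> powr r"
      using AE_completion[OF Vg] by eventually_elim (auto simp: indicator_def)
  qed
  then have 1: "integrable lborel (\<lambda>x. indicator \<Omega> x * \<bar>g x\<bar> powr r)"
    by (subst (asm) integrable_completion) auto
  have 2: "integrable lborel (indicator \<Omega> :: 'a \<Rightarrow> real)"
    using finite_emeasure_\<Omega> by (intro integrable_real_indicator) auto
  have "in_Lp r lborel f"
  proof (rule in_Lp_bound)
    show "integrable lborel (\<lambda>x. 2 powr r * (indicator \<Omega> x * \<bar>g x\<bar> powr r + indicator \<Omega> x))"
      using 1 2 by auto
    show "AE x in lborel. \<bar>f x\<bar> powr r \<le> 2 powr r * (indicator \<Omega> x * \<bar>g x\<bar> powr r + indicator \<Omega> x)"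
      using add_powr_le2[OF r_gt_1, of "\<bar>g x\<bar>" 1 for x] by (auto simp: f_def indicator_def)
  qed simp
  moreover have "AE x in lebesgue. x \<in> \<Omega> \<longrightarrow> V x \<le> f x"
    using AE_completion[OF Vg] by eventually_elim (auto simp: f_def)
  ultimately show ?thesis
    using f by (intro exI[of _ f]) (auto simp: f_def)
qed

text \<open>Since \<open>Vm \<ge> 1\<close> on \<open>\<Omega>\<close>, the measure \<open>Mw\<close> with density \<open>Vm\<close> controls \<open>V\<close>-weighted integrals and, at the
  same time, convergence almost everywhere on \<open>\<Omega>\<close>.\<close>

definition Vm :: "'a \<Rightarrow> real" where
  "Vm = (SOME f. f \<in> borel_measurable borel \<and> (\<forall>x. 0 \<le> f x) \<and> (\<forall>x. x \<in> \<Omega> \<longrightarrow> 1 \<le> f x)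
     \<and> (\<forall>x. x \<notin> \<Omega> \<longrightarrow> f x = 0) \<and> in_Lp r lborel f \<and> (AE x in lebesgue. x \<in> \<Omega> \<longrightarrow> V x \<le> f x))"

lemma Vm:
  shows Vm_borel [measurable]: "Vm \<in> borel_measurable borel" and Vm_nonneg: "0 \<le> Vm x"
    and Vm_ge_1: "x \<in> \<Omega> \<Longrightarrow> 1 \<le> Vm x" and Vm_outside: "x \<notin> \<Omega> \<Longrightarrow> Vm x = 0"
    and Vm_Lr: "in_Lp r lborel Vm" and V_le_Vm: "AE x in lebesgue. x \<in> \<Omega> \<longrightarrow> V x \<le> Vm x"
  using someI_ex[OF ex_weight_majorant, folded Vm_def] by auto

definition "Vm_norm = (LINT x|lborel. \<bar>Vm x\<bar> powr r) powr (1 / r)"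

text \<open>The growth condition is Hoelder's inequality on a cube, obtained from Jensen with
  exponent r: the mass is the volume times the average, and the average is at most 2^(kN/r) times
  the L^r norm.\<close>

sublocale D: dyadic s p "real DIM('a) / r" Vm_norm "\<lambda>x. ennreal (Vm x)"
proof
  show "0 < s" "1 < p" "0 \<le> real DIM('a) / r" "0 \<le> Vm_norm" "(\<lambda>x. ennreal (Vm x)) \<in> borel_measurable borel"
    using s p r_gt_1 by (auto simp: Vm_norm_def)
  show "real DIM('a) / r < s * p"
    using r r_gt_1 sp_pos by (simp add: field_simps)
  fix k :: nat and x :: 'a
  let ?n = "real DIM('a)"
  let ?I = "\<integral>\<^sup>+y. ennreal (Vm y) * indicator {y. cell k y = cell k x} y \<partial>lborel"
  define c where "c = cell_avg k Vm (cell k x)"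
  have c0: "0 \<le> c" unfolding c_def cell_avg_def by (intro integral_nonneg_AE) (auto simp: Vm_nonneg)
  have "ennreal c = (\<integral>\<^sup>+y. ennreal (Vm y) \<partial>cell_measure k (cell k x))"
    unfolding c_def cell_avg_def
    by (intro nn_integral_eq_integral[symmetric] integrable_cell_measure[OF r_gt_1 Vm_Lr]) (simp add: Vm_nonneg)
  also have "\<dots> = ennreal (2 ^ (k * DIM('a))) * ?I"
    by (rule nn_integral_cell_measure) measurable
  finally have "ennreal ((1/2) ^ (k * DIM('a))) * ennreal c
      = ennreal ((1/2) ^ (k * DIM('a))) * ennreal (2 ^ (k * DIM('a))) * ?I"
    by (simp add: mult.assoc)
  also have "ennreal ((1/2) ^ (k * DIM('a))) * ennreal (2 ^ (k * DIM('a))) = 1"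
    by (simp add: ennreal_mult[symmetric] power_mult_distrib[symmetric])
  finally have I: "?I = ennreal ((1/2) ^ (k * DIM('a)) * c)"
    using c0 by (simp add: ennreal_mult)
  have "c powr r \<le> 2 ^ (k * DIM('a)) * (LINT y|lborel. \<bar>Vm y\<bar> powr r)"
    using cell_avg_le[OF r_gt_1 Vm_Lr, of k x] c0 by (simp add: c_def)
  then have "(c powr r) powr (1 / r) \<le> (2 ^ (k * DIM('a)) * (LINT y|lborel. \<bar>Vm y\<bar> powr r)) powr (1 / r)"
    using r_gt_1 by (intro powr_mono2) auto
  then have c: "c \<le> 2 powr (real k * ?n / r) * Vm_norm"
    using r_gt_1 c0 by (simp add: powr_powr powr_mult Vm_norm_def powr_realpow[symmetric])
  have "(1/2) ^ (k * DIM('a)) = 2 powr (- (real k * ?n))"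
    by (simp add: powr_minus powr_realpow[symmetric] power_one_over inverse_eq_divide)
  then have "(1/2) ^ (k * DIM('a)) * c \<le> 2 powr (- (real k * ?n)) * (2 powr (real k * ?n / r) * Vm_norm)"
    using c by (simp add: mult_left_mono)
  also have "\<dots> = Vm_norm * 2 powr (- (real k * ?n) + real k * ?n / r)"
    unfolding powr_add by simp
  also have "- (real k * ?n) + real k * ?n / r = - (real k * (?n - ?n / r))"
    by (simp add: algebra_simps)
  finally show "?I \<le> ennreal (Vm_norm * 2 powr (- (real k * (?n - ?n / r))))"
    unfolding I by (rule ennreal_leI)
qed

section \<open>The dominating finite measure and the continuous embedding\<close>

definition "Mw = density lborel (\<lambda>x. ennreal (Vm x))"

lemma Vm_integrable: "integrable lborel Vm"
proof (rule Bochner_Integration.integrable_bound)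
  have "integrable lborel (indicator \<Omega> :: 'a \<Rightarrow> real)"
    using finite_emeasure_\<Omega> by (intro integrable_real_indicator) auto
  then show "integrable lborel (\<lambda>x. indicator \<Omega> x + \<bar>Vm x\<bar> powr r)"
    using Vm_Lr by (auto simp: in_Lp_def)
  show "AE x in lborel. norm (Vm x) \<le> norm (indicator \<Omega> x + \<bar>Vm x\<bar> powr r)"
  proof (rule AE_I2)
    fix x
    have "Vm x powr 1 \<le> Vm x powr r" if "x \<in> \<Omega>"
      using Vm_ge_1[OF that] r_gt_1 by (intro powr_mono) auto
    then show "norm (Vm x) \<le> norm (indicator \<Omega> x + \<bar>Vm x\<bar> powr r)"
      using Vm_nonneg[of x] Vm_outside[of x] Vm_ge_1[of x] by (cases "x \<in> \<Omega>") auto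
  qed
qed simp

lemma sets_Mw [simp, measurable_cong]: "sets Mw = sets borel" by (simp add: Mw_def)
lemma space_Mw [simp]: "space Mw = UNIV" by (simp add: Mw_def)

lemma finite_Mw: "finite_measure Mw"
proof
  have "emeasure Mw UNIV = ennreal (LINT x|lborel. Vm x)"
    using Vm_integrable Vm_nonneg by (simp add: Mw_def emeasure_density nn_integral_eq_integral)
  then show "emeasure Mw (space Mw) \<noteq> \<infinity>" by simp
qed

lemma nn_integral_Mw: "f \<in> borel_measurable borel \<Longrightarrow> (\<integral>\<^sup>+x. f x \<partial>Mw) = (\<integral>\<^sup>+x. ennreal (Vm x) * f x \<partial>lborel)"
  unfolding Mw_def by (subst nn_integral_density) auto

lemma AE_Mw_iff: "(AE x in Mw. P x) \<longleftrightarrow> (AE x in lborel. x \<in> \<Omega> \<longrightarrow> P x)"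
proof -
  have "0 < Vm x \<longleftrightarrow> x \<in> \<Omega>" for x
    using Vm_ge_1[of x] Vm_outside[of x] by force
  then show ?thesis unfolding Mw_def by (subst AE_density) auto
qed

lemma Mw_dominates_\<nu>:
  assumes [measurable]: "h \<in> borel_measurable lebesgue" "h' \<in> borel_measurable borel"
    and eq: "AE x in lebesgue. h x = h' x" and h': "in_Lp p Mw h'"
  shows "in_Lp p \<nu> h" and "(LINT x|\<nu>. \<bar>h x\<bar> powr p) \<le> (LINT x|Mw. \<bar>h' x\<bar> powr p)"
proof -
  have "(\<integral>\<^sup>+x. ennreal (\<bar>h x\<bar> powr p) \<partial>\<nu>)
      = (\<integral>\<^sup>+x. ennreal (if x \<in> \<Omega> then V x else 0) * ennreal (\<bar>h x\<bar> powr p) \<partial>lebesgue)"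
    unfolding weight_measure_def by (rule nn_integral_density) measurable
  also have "\<dots> \<le> (\<integral>\<^sup>+x. ennreal (Vm x) * ennreal (\<bar>h' x\<bar> powr p) \<partial>lebesgue)"
  proof (rule nn_integral_mono_AE)
    show "AE x in lebesgue. ennreal (if x \<in> \<Omega> then V x else 0) * ennreal (\<bar>h x\<bar> powr p)
        \<le> ennreal (Vm x) * ennreal (\<bar>h' x\<bar> powr p)"
      using V_le_Vm eq by eventually_elim (auto intro!: mult_right_mono ennreal_leI)
  qed
  also have "\<dots> = (\<integral>\<^sup>+x. ennreal (\<bar>h' x\<bar> powr p) \<partial>Mw)"
    by (subst nn_integral_Mw) (auto simp: nn_integral_completion)
  also have "\<dots> = ennreal (LINT x|Mw. \<bar>h' x\<bar> powr p)"
    using h' by (intro nn_integral_eq_integral) auto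
  finally have le: "(\<integral>\<^sup>+x. ennreal (\<bar>h x\<bar> powr p) \<partial>\<nu>) \<le> ennreal (LINT x|Mw. \<bar>h' x\<bar> powr p)" .
  have int: "integrable \<nu> (\<lambda>x. \<bar>h x\<bar> powr p)"
    using le by (intro integrableI_nonneg) (auto intro: le_less_trans)
  then show "in_Lp p \<nu> h" by (simp add: in_Lp_def)
  have "ennreal (LINT x|\<nu>. \<bar>h x\<bar> powr p) \<le> ennreal (LINT x|Mw. \<bar>h' x\<bar> powr p)"
    using le int by (subst nn_integral_eq_integral[symmetric]) auto
  then show "(LINT x|\<nu>. \<bar>h x\<bar> powr p) \<le> (LINT x|Mw. \<bar>h' x\<bar> powr p)"
    by (subst (asm) ennreal_le_iff) auto
qed

text \<open>The dyadic estimates are formulated for Borel functions, while members of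
  \<open>W\<close> are only Lebesgue measurable.\<close>

definition borel_rep :: "('a \<Rightarrow> real) \<Rightarrow> 'a \<Rightarrow> real" where
  "borel_rep u = (SOME u'. u' \<in> borel_measurable borel \<and> (AE x in lebesgue. u x = u' x))"

lemma borel_rep:
  assumes u: "u \<in> W"
  shows borel_rep_borel: "borel_rep u \<in> borel_measurable borel" and borel_rep_AE: "AE x in lebesgue. u x = borel_rep u x"
    and borel_rep_Lp: "in_Lp p lborel (borel_rep u)"
    and borel_rep_norm: "(LINT x|lborel. \<bar>borel_rep u x\<bar> powr p) = (LINT x|lebesgue. \<bar>u x\<bar> powr p)"
    and borel_rep_local_density: "(\<integral>\<^sup>+x. local_density s p (borel_rep u) x \<partial>lborel) \<le> ennreal (E u / K_const TYPE('a) s p)"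
proof -
  obtain u' where "u' \<in> borel_measurable borel" "AE x in lborel. u x = u' x"
    using completion_ex_borel_measurable_real[of u lborel] WD(4)[OF u] by auto
  then have "u' \<in> borel_measurable borel \<and> (AE x in lebesgue. u x = u' x)"
    by (auto intro: AE_completion)
  then have *: "borel_rep u \<in> borel_measurable borel \<and> (AE x in lebesgue. u x = borel_rep u x)"
    unfolding borel_rep_def by (rule someI[where P = "\<lambda>u'. u' \<in> borel_measurable borel \<and> (AE x in lebesgue. u x = u' x)"])
  show b [measurable]: "borel_rep u \<in> borel_measurable borel" using * by (rule conjunct1)
  show ae: "AE x in lebesgue. u x = borel_rep u x" using * by (rule conjunct2)
  note [measurable] = WD(4)[OF u] borel_imp_lebesgue_measurable[OF b]
  have "integrable lebesgue (\<lambda>x. \<bar>borel_rep u x\<bar> powr p)"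
  proof (rule Bochner_Integration.integrable_cong_AE_imp[OF in_LpD(2)[OF WD(1)[OF u]]])
    show "AE x in lebesgue. \<bar>u x\<bar> powr p = \<bar>borel_rep u x\<bar> powr p"
      using ae by eventually_elim simp
  qed measurable
  then show "in_Lp p lborel (borel_rep u)"
    unfolding in_Lp_def by (subst (asm) integrable_completion) auto
  have "(LINT x|lebesgue. \<bar>u x\<bar> powr p) = (LINT x|lebesgue. \<bar>borel_rep u x\<bar> powr p)"
  proof (rule integral_cong_AE)
    show "AE x in lebesgue. \<bar>u x\<bar> powr p = \<bar>borel_rep u x\<bar> powr p"
      using ae by eventually_elim simp
  qed measurable
  also have "\<dots> = (LINT x|lborel. \<bar>borel_rep u x\<bar> powr p)"
    by (rule integral_completion) measurable
  finally show "(LINT x|lborel. \<bar>borel_rep u x\<bar> powr p) = (LINT x|lebesgue. \<bar>u x\<bar> powr p)" ..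
  have int: "integrable lebesgue (gagliardo_density s p u)"
    using WD(2)[OF u] integrable_gagliardo_iff[of u] by simp
  have "(\<integral>\<^sup>+x. local_density s p (borel_rep u) x \<partial>lborel) = (\<integral>\<^sup>+z. ennreal (gagliardo_density s p (borel_rep u) z) \<partial>lborel)"
    by (rule nn_integral_local_density) measurable
  also have "\<dots> = (\<integral>\<^sup>+z. ennreal (gagliardo_density s p (borel_rep u) z) \<partial>lebesgue)"
    by (simp add: nn_integral_completion)
  also have "\<dots> = (\<integral>\<^sup>+z. ennreal (gagliardo_density s p u z) \<partial>lebesgue)"
  proof (rule nn_integral_cong_AE)
    show "AE z in lebesgue. ennreal (gagliardo_density s p (borel_rep u) z) = ennreal (gagliardo_density s p u z)"
      using AE_lebesgue_fst_snd[OF ae] by eventually_elim (auto simp: gagliardo_density_def split: prod.splits)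
  qed
  also have "\<dots> = ennreal (LINT z|lebesgue. gagliardo_density s p u z)"
    using int by (intro nn_integral_eq_integral) auto
  also have "(LINT z|lebesgue. gagliardo_density s p u z) = gagliardo_pow s p u / K_const TYPE('a) s p"
    using K_pos by (simp add: gagliardo_pow_def)
  also have "ennreal \<dots> \<le> ennreal (E u / K_const TYPE('a) s p)"
    using K_pos by (intro ennreal_leI divide_right_mono) (auto simp: energy_def)
  finally show "(\<integral>\<^sup>+x. local_density s p (borel_rep u) x \<partial>lborel) \<le> ennreal (E u / K_const TYPE('a) s p)" .
qed

lemma norm_le_E: "u \<in> W \<Longrightarrow> (LINT x|lebesgue. \<bar>u x\<bar> powr p) \<le> E u"
  using WD(4)[of u] by (simp add: energy_eq)

lemma seminorm_le_E: "u \<in> W \<Longrightarrow> (LINT z|\<mu>. \<bar>diff_fun u z\<bar> powr p) \<le> E u"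
  using WD(4)[of u] by (simp add: energy_eq)

lemma borel_rep_diff_cell_avg:
  assumes u: "u \<in> W"
  shows "in_Lp p Mw (\<lambda>x. borel_rep u x - cell_avg k (borel_rep u) (cell k x))"
    and "(LINT x|Mw. \<bar>borel_rep u x - cell_avg k (borel_rep u) (cell k x)\<bar> powr p)
      \<le> D.B * 2 powr (- (real k * D.\<delta>)) * (E u / K_const TYPE('a) s p)"
proof -
  note [measurable] = borel_rep_borel[OF u]
  let ?d = "\<lambda>x. borel_rep u x - cell_avg k (borel_rep u) (cell k x)"
  have G: "(\<integral>\<^sup>+x. local_density s p (borel_rep u) x \<partial>lborel) < \<infinity>"
    using borel_rep_local_density[OF u] by (rule le_less_trans) simp
  have "(\<integral>\<^sup>+x. ennreal (\<bar>?d x\<bar> powr p) \<partial>Mw) = (\<integral>\<^sup>+x. ennreal (Vm x) * ennreal (\<bar>?d x\<bar> powr p) \<partial>lborel)"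
    by (rule nn_integral_Mw) measurable
  also have "\<dots> \<le> ennreal (D.B * 2 powr (- (real k * D.\<delta>))) * (\<integral>\<^sup>+x. local_density s p (borel_rep u) x \<partial>lborel)"
    by (rule D.weighted_diff_cell_avg_le[OF borel_rep_Lp[OF u] G]) simp
  also have "\<dots> \<le> ennreal (D.B * 2 powr (- (real k * D.\<delta>))) * ennreal (E u / K_const TYPE('a) s p)"
    by (intro mult_left_mono borel_rep_local_density u) auto
  also have "\<dots> = ennreal (D.B * 2 powr (- (real k * D.\<delta>)) * (E u / K_const TYPE('a) s p))"
    using E_nonneg[OF u] K_pos D.B_nonneg by (intro ennreal_mult[symmetric]) auto
  finally have le: "(\<integral>\<^sup>+x. ennreal (\<bar>?d x\<bar> powr p) \<partial>Mw)
      \<le> ennreal (D.B * 2 powr (- (real k * D.\<delta>)) * (E u / K_const TYPE('a) s p))" .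
  have int: "integrable Mw (\<lambda>x. \<bar>?d x\<bar> powr p)"
    using le by (intro integrableI_nonneg) (auto intro: le_less_trans)
  then show "in_Lp p Mw ?d" by (simp add: in_Lp_def)
  have "ennreal (LINT x|Mw. \<bar>?d x\<bar> powr p) \<le> ennreal (D.B * 2 powr (- (real k * D.\<delta>)) * (E u / K_const TYPE('a) s p))"
    using le int by (subst nn_integral_eq_integral[symmetric]) auto
  then show "(LINT x|Mw. \<bar>?d x\<bar> powr p) \<le> D.B * 2 powr (- (real k * D.\<delta>)) * (E u / K_const TYPE('a) s p)"
    using E_nonneg[OF u] K_pos D.B_nonneg by (subst (asm) ennreal_le_iff) auto
qed

lemma borel_rep_cell_avg:
  assumes u: "u \<in> W"
  shows "in_Lp p Mw (\<lambda>x. cell_avg k (borel_rep u) (cell k x))"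
    and "\<bar>cell_avg k (borel_rep u) (cell k x)\<bar> powr p \<le> 2 ^ (k * DIM('a)) * E u"
proof -
  interpret finite_measure Mw by (rule finite_Mw)
  show le: "\<bar>cell_avg k (borel_rep u) (cell k x)\<bar> powr p \<le> 2 ^ (k * DIM('a)) * E u" for x
  proof -
    have "\<bar>cell_avg k (borel_rep u) (cell k x)\<bar> powr p \<le> 2 ^ (k * DIM('a)) * (LINT y|lborel. \<bar>borel_rep u y\<bar> powr p)"
      by (rule cell_avg_le[OF p(1) borel_rep_Lp[OF u]])
    also have "\<dots> \<le> 2 ^ (k * DIM('a)) * E u"
      unfolding borel_rep_norm[OF u] by (intro mult_left_mono norm_le_E u) simp
    finally show ?thesis .
  qed
  show "in_Lp p Mw (\<lambda>x. cell_avg k (borel_rep u) (cell k x))"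
    by (rule in_Lp_bound[where F = "\<lambda>_. 2 ^ (k * DIM('a)) * E u"]) (use le in auto)
qed

text \<open>Split at level 0: the deviation from the averages over unit cubes is controlled by the
  seminorm, the averages themselves are bounded uniformly by the L^p norm, and \<open>Mw\<close> is
  finite.\<close>

lemma borel_rep_Mw:
  assumes u: "u \<in> W"
  shows "in_Lp p Mw (borel_rep u)"
    and "(LINT x|Mw. \<bar>borel_rep u x\<bar> powr p)
      \<le> 2 powr p * (D.B / K_const TYPE('a) s p + measure Mw UNIV) * E u"
proof -
  interpret finite_measure Mw by (rule finite_Mw)
  let ?a = "\<lambda>x. cell_avg 0 (borel_rep u) (cell 0 x)"
  let ?d = "\<lambda>x. borel_rep u x - ?a x"
  have "in_Lp p Mw (\<lambda>x. ?d x + ?a x)"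
    by (intro in_Lp_add p borel_rep_diff_cell_avg borel_rep_cell_avg u)
  then show b: "in_Lp p Mw (borel_rep u)" by simp
  have "(LINT x|Mw. \<bar>borel_rep u x\<bar> powr p) \<le> (LINT x|Mw. 2 powr p * (\<bar>?d x\<bar> powr p + \<bar>?a x\<bar> powr p))"
    using add_powr_le2[OF p(1), of "?d x" "?a x" for x]
    by (intro integral_mono in_LpD(2)[OF b] integrable_mult_right Bochner_Integration.integrable_add
        in_LpD(2)[OF borel_rep_diff_cell_avg(1)[OF u]] in_LpD(2)[OF borel_rep_cell_avg(1)[OF u]]) simp
  also have "\<dots> = 2 powr p * ((LINT x|Mw. \<bar>?d x\<bar> powr p) + (LINT x|Mw. \<bar>?a x\<bar> powr p))"
    using in_LpD(2)[OF borel_rep_diff_cell_avg(1)[OF u]] in_LpD(2)[OF borel_rep_cell_avg(1)[OF u]] by simp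
  also have "\<dots> \<le> 2 powr p * (D.B * (E u / K_const TYPE('a) s p) + (LINT x|Mw. E u))"
    using borel_rep_diff_cell_avg(2)[OF u, of 0] borel_rep_cell_avg(2)[OF u, of 0]
    by (intro mult_left_mono add_mono integral_mono in_LpD(2)[OF borel_rep_cell_avg(1)[OF u]]) auto
  also have "\<dots> = 2 powr p * (D.B / K_const TYPE('a) s p + measure Mw UNIV) * E u"
    by (simp add: algebra_simps)
  finally show "(LINT x|Mw. \<bar>borel_rep u x\<bar> powr p)
      \<le> 2 powr p * (D.B / K_const TYPE('a) s p + measure Mw UNIV) * E u" .
qed

text \<open>The added 1 yields positivity at once, as needed for dividing by the constant.\<close>

definition "C_emb = 2 powr p * (D.B / K_const TYPE('a) s p + measure Mw UNIV) + 1"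

lemma C_emb_pos: "0 < C_emb"
proof -
  have "0 \<le> 2 powr p * (D.B / K_const TYPE('a) s p + measure Mw UNIV)"
    using K_pos D.B_nonneg by (intro mult_nonneg_nonneg add_nonneg_nonneg divide_nonneg_nonneg) auto
  then show ?thesis unfolding C_emb_def by linarith
qed

lemma W_in_Lp_\<nu>:
  assumes u: "u \<in> W"
  shows "in_Lp p \<nu> u" and "\<Psi> u \<le> C_emb * E u"
proof -
  note D = Mw_dominates_\<nu>[OF WD(4)[OF u] borel_rep_borel[OF u] borel_rep_AE[OF u] borel_rep_Mw(1)[OF u]]
  show "in_Lp p \<nu> u" by (rule D)
  have "\<Psi> u \<le> 2 powr p * (D.B / K_const TYPE('a) s p + measure Mw UNIV) * E u"
    using D(2) borel_rep_Mw(2)[OF u] WD(4)[OF u] by (simp add: weighted_pow_eq)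
  also have "\<dots> \<le> C_emb * E u"
    using E_nonneg[OF u] by (intro mult_right_mono) (auto simp: C_emb_def)
  finally show "\<Psi> u \<le> C_emb * E u" .
qed

end

subsection \<open>Compactness\<close>

lemma integral_add_powr_le:
  assumes p: "1 < (p::real)" and f: "in_Lp p M f" and g: "in_Lp p M g"
  shows "(LINT x|M. \<bar>f x + g x\<bar> powr p) \<le> 2 powr p * ((LINT x|M. \<bar>f x\<bar> powr p) + (LINT x|M. \<bar>g x\<bar> powr p))"
proof -
  have "(LINT x|M. \<bar>f x + g x\<bar> powr p) \<le> (LINT x|M. 2 powr p * (\<bar>f x\<bar> powr p + \<bar>g x\<bar> powr p))"
    by (intro integral_mono in_LpD(2)[OF in_Lp_add[OF p f g]] integrable_mult_right Bochner_Integration.integrable_add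
        in_LpD(2)[OF f] in_LpD(2)[OF g] add_powr_le2 p)
  also have "\<dots> = 2 powr p * ((LINT x|M. \<bar>f x\<bar> powr p) + (LINT x|M. \<bar>g x\<bar> powr p))"
    using in_LpD(2)[OF f] in_LpD(2)[OF g] by simp
  finally show ?thesis .
qed

lemma integral_diff_powr_le:
  assumes p: "1 < (p::real)" and f: "in_Lp p M f" and g: "in_Lp p M g"
  shows "(LINT x|M. \<bar>f x - g x\<bar> powr p) \<le> 2 powr p * ((LINT x|M. \<bar>f x\<bar> powr p) + (LINT x|M. \<bar>g x\<bar> powr p))"
  using integral_add_powr_le[OF p f in_Lp_uminus[OF g]] by simp

context weighted_problem
begin

text \<open>A diagonal argument over the countable set of pairs (level, label), after the averages
  at each level are divided by their bound so that one common bound 1 holds.\<close>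

lemma convergent_cell_averages:
  assumes u: "\<And>n::nat. u n \<in> W" and bd: "\<And>n. E (u n) \<le> C"
  obtains \<kappa> :: "nat \<Rightarrow> nat" and L where "strict_mono \<kappa>"
    and "\<And>k x. (\<lambda>n. cell_avg k (borel_rep (u (\<kappa> n))) (cell k x)) \<longlonglongrightarrow> L k (cell k x)"
proof -
  have C: "0 \<le> C" using E_nonneg[OF u[of 0]] bd[of 0] by simp
  \<comment> \<open>The p-th root of the bound in \<open>borel_rep_cell_avg\<close>, plus 1 to be
    positive.\<close>
  define b where "b k = (2 ^ (k * DIM('a)) * C) powr (1 / p) + 1" for k :: nat
  have b: "0 < b k" for k by (simp add: b_def add_nonneg_pos)
  have le: "\<bar>cell_avg k (borel_rep (u n)) (cell k x)\<bar> \<le> b k" for k n x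
  proof -
    have "\<bar>cell_avg k (borel_rep (u n)) (cell k x)\<bar> powr p \<le> 2 ^ (k * DIM('a)) * E (u n)"
      by (rule borel_rep_cell_avg(2)[OF u])
    also have "\<dots> \<le> 2 ^ (k * DIM('a)) * C"
      by (intro mult_left_mono bd) simp
    finally have "(\<bar>cell_avg k (borel_rep (u n)) (cell k x)\<bar> powr p) powr (1 / p) \<le> (2 ^ (k * DIM('a)) * C) powr (1 / p)"
      using p by (intro powr_mono2) auto
    then show ?thesis using p by (simp add: powr_powr b_def)
  qed
  define S where "S = (SIGMA k:(UNIV::nat set). range (cell k :: 'a \<Rightarrow> 'a))"
  define F where "F n z = cell_avg (fst z) (borel_rep (u n)) (snd z) / b (fst z)" for n :: nat and z :: "nat \<times> 'a"
  have S: "countable S" unfolding S_def by (intro countable_SIGMA countable_range_cell) auto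
  have F: "norm (F n z) \<le> 1" if "z \<in> S" for n z
    using that le b by (auto simp: S_def F_def abs_of_pos)
  obtain \<kappa> where \<kappa>: "strict_mono (\<kappa> :: nat \<Rightarrow> nat)" and conv: "\<And>z. z \<in> S \<Longrightarrow> \<exists>l. (\<lambda>n. F (\<kappa> n) z) \<longlonglongrightarrow> l"
    by (rule function_convergent_subsequence[where f = F and M = 1, OF S]) (use F in auto)
  define L where "L k m = lim (\<lambda>n. cell_avg k (borel_rep (u (\<kappa> n))) m)" for k m
  have "(\<lambda>n. cell_avg k (borel_rep (u (\<kappa> n))) (cell k x)) \<longlonglongrightarrow> L k (cell k x)" for k and x :: 'a
  proof -
    have "(k, cell k x) \<in> S" by (simp add: S_def)
    from conv[OF this] obtain l where "(\<lambda>n. F (\<kappa> n) (k, cell k x)) \<longlonglongrightarrow> l" by blast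
    then have "(\<lambda>n. F (\<kappa> n) (k, cell k x) * b k) \<longlonglongrightarrow> l * b k" by (intro tendsto_intros)
    then have "(\<lambda>n. cell_avg k (borel_rep (u (\<kappa> n))) (cell k x)) \<longlonglongrightarrow> l * b k"
      using b[of k] by (simp add: F_def)
    then show ?thesis unfolding L_def by (simp add: limI)
  qed
  with \<kappa> show thesis by (rule that)
qed

text \<open>Compare u i and u j through their averages at a fixed level k. The two deviations are at
  most t k, uniformly in the sequence, while for fixed k the averages converge boundedly on a finite
  measure space. So k is fixed before i and j.\<close>

lemma Mw_Cauchy_subseq:
  assumes u: "\<And>n::nat. u n \<in> W" and bd: "\<And>n. E (u n) \<le> C"
  obtains \<kappa> :: "nat \<Rightarrow> nat" where "strict_mono \<kappa>"
    and "\<And>e. 0 < e \<Longrightarrow> \<exists>N. \<forall>i\<ge>N. \<forall>j\<ge>N. (LINT x|Mw. \<bar>borel_rep (u (\<kappa> i)) x - borel_rep (u (\<kappa> j)) x\<bar> powr p) < e"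
proof -
  interpret finite_measure Mw by (rule finite_Mw)
  have C: "0 \<le> C" using E_nonneg[OF u[of 0]] bd[of 0] by simp
  obtain \<kappa> :: "nat \<Rightarrow> nat" and L where \<kappa>: "strict_mono \<kappa>"
    and L: "\<And>k x. (\<lambda>n. cell_avg k (borel_rep (u (\<kappa> n))) (cell k x)) \<longlonglongrightarrow> L k (cell k x)"
    by (rule convergent_cell_averages[where u = u, OF u bd]) (rule that)
  let ?U = "\<lambda>n. borel_rep (u (\<kappa> n))"
  let ?a = "\<lambda>k n x. cell_avg k (?U n) (cell k x)"
  have a_le: "\<bar>?a k n x\<bar> powr p \<le> 2 ^ (k * DIM('a)) * C" for k n x
    by (rule order_trans[OF borel_rep_cell_avg(2)[OF u] mult_left_mono[OF bd]]) simp
  have L_le: "\<bar>L k (cell k x)\<bar> powr p \<le> 2 ^ (k * DIM('a)) * C" for k x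
    by (rule LIMSEQ_le_const2[OF tendsto_abs_powr[OF _ L[of k x]]]) (use p a_le in auto)
  have L_borel [measurable]: "(\<lambda>x. L k (cell k x)) \<in> borel_measurable borel" for k
    by (rule measurable_cell_comp)
  have L_Lp: "in_Lp p Mw (\<lambda>x. L k (cell k x))" for k
    by (rule in_Lp_bound[where F = "\<lambda>_. 2 ^ (k * DIM('a)) * C"]) (use L_le in auto)
  have R: "(\<lambda>n. LINT x|Mw. \<bar>?a k n x - L k (cell k x)\<bar> powr p) \<longlonglongrightarrow> 0" for k
  proof -
    have "(\<lambda>n. LINT x|Mw. \<bar>?a k n x - L k (cell k x)\<bar> powr p) \<longlonglongrightarrow> (LINT x|Mw. 0)"
    proof (rule integral_dominated_convergence[where w = "\<lambda>_. 2 powr p * (2 ^ (k * DIM('a)) * C + 2 ^ (k * DIM('a)) * C)"])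
      show "AE x in Mw. norm (\<bar>?a k n x - L k (cell k x)\<bar> powr p)
          \<le> 2 powr p * (2 ^ (k * DIM('a)) * C + 2 ^ (k * DIM('a)) * C)" for n
      proof (rule AE_I2)
        fix x
        have "\<bar>?a k n x - L k (cell k x)\<bar> powr p \<le> 2 powr p * (\<bar>?a k n x\<bar> powr p + \<bar>L k (cell k x)\<bar> powr p)"
          by (rule diff_powr_le2[OF p(1)])
        also have "\<dots> \<le> 2 powr p * (2 ^ (k * DIM('a)) * C + 2 ^ (k * DIM('a)) * C)"
          by (intro mult_left_mono add_mono a_le L_le) simp
        finally show "norm (\<bar>?a k n x - L k (cell k x)\<bar> powr p)
          \<le> 2 powr p * (2 ^ (k * DIM('a)) * C + 2 ^ (k * DIM('a)) * C)" by simp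
      qed
      show "AE x in Mw. (\<lambda>n. \<bar>?a k n x - L k (cell k x)\<bar> powr p) \<longlonglongrightarrow> 0"
      proof (rule AE_I2)
        fix x
        have "(\<lambda>n. \<bar>?a k n x - L k (cell k x)\<bar> powr p) \<longlonglongrightarrow> \<bar>L k (cell k x) - L k (cell k x)\<bar> powr p"
          using p by (intro tendsto_abs_powr tendsto_diff L tendsto_const) auto
        then show "(\<lambda>n. \<bar>?a k n x - L k (cell k x)\<bar> powr p) \<longlonglongrightarrow> 0" using p by simp
      qed
    qed auto
    then show ?thesis by simp
  qed
  define t where "t k = D.B * 2 powr (- (real k * D.\<delta>)) * (C / K_const TYPE('a) s p)" for k :: nat
  have T: "(LINT x|Mw. \<bar>?U n x - ?a k n x\<bar> powr p) \<le> t k" for n k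
  proof -
    have "(LINT x|Mw. \<bar>?U n x - ?a k n x\<bar> powr p)
        \<le> D.B * 2 powr (- (real k * D.\<delta>)) * (E (u (\<kappa> n)) / K_const TYPE('a) s p)"
      by (rule borel_rep_diff_cell_avg(2)[OF u])
    also have "\<dots> \<le> t k"
      unfolding t_def using K_pos D.B_nonneg bd by (intro mult_left_mono divide_right_mono) auto
    finally show ?thesis .
  qed
  have t_lim: "t \<longlonglongrightarrow> 0"
  proof -
    have "(\<lambda>k. (2 powr (- D.\<delta>)) ^ k) \<longlonglongrightarrow> 0"
      using D.two_powr_less_1[OF D.\<delta>_pos] by (intro LIMSEQ_realpow_zero) auto
    then have "(\<lambda>k. 2 powr (- (real k * D.\<delta>))) \<longlonglongrightarrow> 0"
      by (simp add: powr_realpow[symmetric] powr_powr mult_ac)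
    then show ?thesis unfolding t_def
      by (intro tendsto_mult_left_zero tendsto_mult_right_zero)
  qed
  define c where "c = (2::real) powr p"
  have c: "0 < c" by (simp add: c_def)
  \<comment> \<open>Each of the three splittings costs a factor c = 2^p, since p-th powers are used
    in place of norms.\<close>
  have main: "(LINT x|Mw. \<bar>?U i x - ?U j x\<bar> powr p)
      \<le> c * (t k + c * (c * ((LINT x|Mw. \<bar>?a k i x - L k (cell k x)\<bar> powr p)
         + (LINT x|Mw. \<bar>?a k j x - L k (cell k x)\<bar> powr p)) + t k))" for i j k
  proof -
    have 1: "in_Lp p Mw (\<lambda>x. ?U n x - ?a k n x)" for n by (rule borel_rep_diff_cell_avg(1)[OF u])
    have 2: "in_Lp p Mw (\<lambda>x. ?a k n x - L k (cell k x))" for n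
      by (intro in_Lp_diff p borel_rep_cell_avg(1) u L_Lp)
    have 3: "in_Lp p Mw (\<lambda>x. ?a k i x - ?a k j x)"
      by (intro in_Lp_diff p borel_rep_cell_avg(1) u)
    have 4: "in_Lp p Mw (\<lambda>x. (?a k i x - ?a k j x) - (?U j x - ?a k j x))"
      by (intro in_Lp_diff p 3 1)
    have "(LINT x|Mw. \<bar>?U i x - ?U j x\<bar> powr p)
       = (LINT x|Mw. \<bar>(?U i x - ?a k i x) + ((?a k i x - ?a k j x) - (?U j x - ?a k j x))\<bar> powr p)"
      by simp
    also have "\<dots> \<le> c * ((LINT x|Mw. \<bar>?U i x - ?a k i x\<bar> powr p)
        + (LINT x|Mw. \<bar>(?a k i x - ?a k j x) - (?U j x - ?a k j x)\<bar> powr p))"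
      unfolding c_def by (rule integral_add_powr_le[OF p(1) 1 4])
    also have "(LINT x|Mw. \<bar>(?a k i x - ?a k j x) - (?U j x - ?a k j x)\<bar> powr p)
        \<le> c * ((LINT x|Mw. \<bar>?a k i x - ?a k j x\<bar> powr p) + (LINT x|Mw. \<bar>?U j x - ?a k j x\<bar> powr p))"
      unfolding c_def by (rule integral_diff_powr_le[OF p(1) 3 1])
    also have "(LINT x|Mw. \<bar>?a k i x - ?a k j x\<bar> powr p)
       = (LINT x|Mw. \<bar>(?a k i x - L k (cell k x)) - (?a k j x - L k (cell k x))\<bar> powr p)"
      by simp
    also have "\<dots> \<le> c * ((LINT x|Mw. \<bar>?a k i x - L k (cell k x)\<bar> powr p)
         + (LINT x|Mw. \<bar>?a k j x - L k (cell k x)\<bar> powr p))"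
      unfolding c_def by (rule integral_diff_powr_le[OF p(1) 2 2])
    finally show ?thesis
      using T[of i k] T[of j k] c by (simp add: mult_left_mono add_mono order_trans[OF _ mult_left_mono[OF add_mono]])
  qed
  have "\<exists>N. \<forall>i\<ge>N. \<forall>j\<ge>N. (LINT x|Mw. \<bar>?U i x - ?U j x\<bar> powr p) < e" if e: "0 < e" for e :: real
  proof -
    have "(\<lambda>k. c * (t k + c * (c * (0 + 0) + t k))) \<longlonglongrightarrow> c * (0 + c * (c * (0 + 0) + 0))"
      by (intro tendsto_intros t_lim)
    then have "\<forall>\<^sub>F k in sequentially. c * (t k + c * (c * (0 + 0) + t k)) < e"
      using e by (intro order_tendstoD) auto
    then obtain k where k: "c * (t k + c * (c * (0 + 0) + t k)) < e"
      by (auto simp: eventually_sequentially)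
    let ?R = "\<lambda>n. LINT x|Mw. \<bar>?a k n x - L k (cell k x)\<bar> powr p"
    have "(\<lambda>n. c * (t k + c * (c * (?R n + ?R n) + t k))) \<longlonglongrightarrow> c * (t k + c * (c * (0 + 0) + t k))"
      by (intro tendsto_intros R)
    then have "\<forall>\<^sub>F n in sequentially. c * (t k + c * (c * (?R n + ?R n) + t k)) < e"
      using k by (rule order_tendstoD)
    then obtain N where N: "\<And>n. n \<ge> N \<Longrightarrow> c * (t k + c * (c * (?R n + ?R n) + t k)) < e"
      by (auto simp: eventually_sequentially)
    show ?thesis
    proof (intro exI allI impI)
      fix i j assume ij: "i \<ge> N" "j \<ge> N"
      \<comment> \<open>The bound is increasing in ?R i + ?R j, so the larger of the two may be
        counted twice, which reduces the claim to one index.\<close>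
      have "c * (t k + c * (c * (?R i + ?R j) + t k)) \<le> max (c * (t k + c * (c * (?R i + ?R i) + t k))) (c * (t k + c * (c * (?R j + ?R j) + t k)))"
        using c by (cases "?R i \<le> ?R j") (auto simp: max_def)
      also have "\<dots> < e" using N ij by simp
      finally show "(LINT x|Mw. \<bar>?U i x - ?U j x\<bar> powr p) < e"
        using main[of i j k] by linarith
    qed
  qed
  with \<kappa> show thesis by (rule that)
qed

text \<open>Convergence in \<open>Mw\<close> gives, along a further subsequence, convergence almost
  everywhere on \<Omega>; Fatou places the limit in \<open>W\<close>, and domination of \<nu> by
  \<open>Mw\<close> gives convergence of \<Psi>. The energy itself is only lower semicontinuous
  here.\<close>

lemma compactness:
  assumes u: "\<And>n::nat. u n \<in> W" and bd: "\<And>n. E (u n) \<le> C"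
  obtains \<rho> :: "nat \<Rightarrow> nat" and v where "strict_mono \<rho>" "v \<in> W"
    "AE x in lebesgue. (\<lambda>n. u (\<rho> n) x) \<longlonglongrightarrow> v x" "(\<lambda>n. \<Psi> (u (\<rho> n))) \<longlonglongrightarrow> \<Psi> v"
proof -
  interpret finite_measure Mw by (rule finite_Mw)
  obtain \<kappa> :: "nat \<Rightarrow> nat" where \<kappa>: "strict_mono \<kappa>"
    and Cau: "\<And>e. 0 < e \<Longrightarrow> \<exists>N. \<forall>i\<ge>N. \<forall>j\<ge>N. (LINT x|Mw. \<bar>borel_rep (u (\<kappa> i)) x - borel_rep (u (\<kappa> j)) x\<bar> powr p) < e"
    by (rule Mw_Cauchy_subseq[where u = u, OF u bd]) (rule that)
  have U_Lp: "in_Lp p Mw (borel_rep (u n))" for n by (rule borel_rep_Mw(1)[OF u])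
  have U_L1: "integrable Mw (borel_rep (u n))" for n
    by (rule integral_abs_le_powr(1)[OF p(1) finite_Mw U_Lp zero_less_one])
  obtain \<sigma> :: "nat \<Rightarrow> nat" where \<sigma>: "strict_mono \<sigma>" and CauAE: "AE x in Mw. Cauchy (\<lambda>i. borel_rep (u (\<kappa> (\<sigma> i))) x)"
    by (rule cauchy_L1_AE_cauchy_subseq[where s = "\<lambda>n. borel_rep (u (\<kappa> n))", OF U_L1
        Lp_Cauchy_imp_L1_Cauchy[where f = "\<lambda>n. borel_rep (u (\<kappa> n))", OF p(1) finite_Mw U_Lp Cau]], assumption, assumption, rule that)
  define \<rho> where "\<rho> = \<kappa> \<circ> \<sigma>"
  have \<rho>: "strict_mono \<rho>" unfolding \<rho>_def by (rule strict_mono_o[OF \<kappa> \<sigma>])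
  let ?U = "\<lambda>n. borel_rep (u (\<rho> n))"
  have U_borel [measurable]: "?U n \<in> borel_measurable borel" for n by (rule borel_rep_borel[OF u])
  \<comment> \<open>Taken from the Borel versions so that v is Borel; where the sequence diverges,
    \<open>lim\<close> is arbitrary, but this happens only on a null set.\<close>
  define v where "v x = lim (\<lambda>n. ?U n x)" for x
  have v_borel [measurable]: "v \<in> borel_measurable borel" unfolding v_def by measurable
  have v_leb: "v \<in> borel_measurable lebesgue" by (rule borel_imp_lebesgue_measurable[OF v_borel])
  have ueq: "AE x in lebesgue. \<forall>n. u n x = borel_rep (u n) x \<and> (x \<notin> \<Omega> \<longrightarrow> u n x = 0)"
    using borel_rep_AE[OF u] WD(3)[OF u] by (simp add: AE_all_countable)
  have CauAE': "AE x in lebesgue. x \<in> \<Omega> \<longrightarrow> Cauchy (\<lambda>i. ?U i x)"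
    using CauAE by (intro AE_completion) (simp add: AE_Mw_iff \<rho>_def)
  have limU: "AE x in lebesgue. (\<lambda>n. ?U n x) \<longlonglongrightarrow> v x \<and> (x \<notin> \<Omega> \<longrightarrow> v x = 0)"
    using CauAE' ueq
  proof eventually_elim
    case (elim x)
    show ?case
    proof (cases "x \<in> \<Omega>")
      case True
      then have "convergent (\<lambda>i. ?U i x)" using elim(1) by (simp add: Cauchy_convergent_iff)
      then show ?thesis using True by (simp add: v_def convergent_LIMSEQ_iff)
    next
      case False
      then have "?U i x = 0" for i using elim(2) by metis
      then have "(\<lambda>i. ?U i x) = (\<lambda>i. 0)" by auto
      then show ?thesis by (simp add: v_def)
    qed
  qed
  have lim: "AE x in lebesgue. (\<lambda>n. u (\<rho> n) x) \<longlonglongrightarrow> v x"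
    using limU ueq by eventually_elim simp
  have vW: "v \<in> W"
    unfolding W_iff
  proof (intro conjI)
    show "in_Lp p lebesgue v"
      by (rule Lp_Fatou(1)[OF p(1) WD(1)[OF u] v_leb lim]) (rule order_trans[OF norm_le_E[OF u] bd])
    have "AE z in \<mu>. (\<lambda>n. diff_fun (u (\<rho> n)) z) \<longlonglongrightarrow> diff_fun v z"
      using AE_pair_measureI[OF lim, of s p] unfolding diff_fun_def by eventually_elim (auto intro: tendsto_diff)
    then show "in_Lp p \<mu> (diff_fun v)"
      by (rule Lp_Fatou(1)[OF p(1) WD(2)[OF u] diff_fun_measurable[OF v_leb]])
         (rule order_trans[OF seminorm_le_E[OF u] bd])
    show "AE x in lebesgue. x \<notin> \<Omega> \<longrightarrow> v x = 0"
      using limU by eventually_elim auto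
  qed
  have limMw: "AE x in Mw. (\<lambda>n. ?U n x) \<longlonglongrightarrow> v x"
  proof -
    have "AE x in lborel. (\<lambda>n. ?U n x) \<longlonglongrightarrow> v x"
      using limU unfolding AE_completion_iff by (rule eventually_mono) simp
    then show ?thesis
      unfolding AE_Mw_iff by (rule eventually_mono) simp
  qed
  have v_Mw: "v \<in> borel_measurable Mw" by measurable
  have Cau': "\<exists>N. \<forall>i\<ge>N. \<forall>j\<ge>N. (LINT x|Mw. \<bar>?U i x - ?U j x\<bar> powr p) < e" if e: "0 < e" for e
  proof -
    obtain N where N: "\<And>i j. i \<ge> N \<Longrightarrow> j \<ge> N \<Longrightarrow> (LINT x|Mw. \<bar>borel_rep (u (\<kappa> i)) x - borel_rep (u (\<kappa> j)) x\<bar> powr p) < e"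
      using Cau[OF e] by blast
    have "\<sigma> i \<ge> N" if "i \<ge> N" for i using seq_suble[OF \<sigma>, of i] that by linarith
    then show ?thesis using N by (intro exI[of _ N]) (simp add: \<rho>_def)
  qed
  have v_Lp_Mw: "in_Lp p Mw v"
  proof (rule Lp_Fatou(1)[OF p(1) U_Lp v_Mw limMw])
    fix n
    have "(LINT x|Mw. \<bar>borel_rep (u (\<rho> n)) x\<bar> powr p) \<le> 2 powr p * (D.B / K_const TYPE('a) s p + measure Mw UNIV) * E (u (\<rho> n))"
      by (rule borel_rep_Mw(2)[OF u])
    also have "\<dots> \<le> 2 powr p * (D.B / K_const TYPE('a) s p + measure Mw UNIV) * C"
      using K_pos D.B_nonneg by (intro mult_left_mono bd mult_nonneg_nonneg add_nonneg_nonneg divide_nonneg_nonneg) auto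
    finally show "(LINT x|Mw. \<bar>borel_rep (u (\<rho> n)) x\<bar> powr p) \<le> 2 powr p * (D.B / K_const TYPE('a) s p + measure Mw UNIV) * C" .
  qed
  have convMw: "(\<lambda>n. LINT x|Mw. \<bar>?U n x - v x\<bar> powr p) \<longlonglongrightarrow> 0"
  proof (rule tendstoI)
    fix e :: real assume e: "0 < e"
    then obtain N where N: "\<And>i j. i \<ge> N \<Longrightarrow> j \<ge> N \<Longrightarrow> (LINT x|Mw. \<bar>?U i x - ?U j x\<bar> powr p) < e / 2"
      using Cau'[of "e / 2"] by auto
    have "(LINT x|Mw. \<bar>?U i x - v x\<bar> powr p) < e" if i: "i \<ge> N" for i
    proof -
      \<comment> \<open>Fatou in the second index turns the Cauchy estimate into an estimate against
        the limit.\<close>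
      have "\<forall>\<^sub>F j in sequentially. (LINT x|Mw. \<bar>?U i x - v x\<bar> powr p) - e / 2 < (LINT x|Mw. \<bar>?U i x - ?U (j + N) x\<bar> powr p)"
      proof (rule Lp_Fatou(2)[OF p(1)])
        show "in_Lp p Mw (\<lambda>x. ?U i x - ?U (j + N) x)" for j by (intro in_Lp_diff p U_Lp)
        show "AE x in Mw. (\<lambda>j. ?U i x - ?U (j + N) x) \<longlonglongrightarrow> ?U i x - v x"
          using limMw by eventually_elim (intro tendsto_diff tendsto_const LIMSEQ_ignore_initial_segment)
        show "(LINT x|Mw. \<bar>?U i x - ?U (j + N) x\<bar> powr p) \<le> e / 2" for j
          using N[OF i, of "j + N"] by simp
      qed (use e in auto)
      then obtain j where j: "(LINT x|Mw. \<bar>?U i x - v x\<bar> powr p) - e / 2 < (LINT x|Mw. \<bar>?U i x - ?U (j + N) x\<bar> powr p)"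
        by (auto simp: eventually_sequentially)
      show ?thesis using j N[OF i, of "j + N"] by simp
    qed
    then have "\<forall>\<^sub>F i in sequentially. (LINT x|Mw. \<bar>?U i x - v x\<bar> powr p) < e"
      by (auto simp: eventually_sequentially)
    then show "\<forall>\<^sub>F i in sequentially. dist (LINT x|Mw. \<bar>?U i x - v x\<bar> powr p) 0 < e"
    proof eventually_elim
      case (elim i)
      have "0 \<le> (LINT x|Mw. \<bar>?U i x - v x\<bar> powr p)" by (rule integral_nonneg_AE) auto
      then show ?case using elim by simp
    qed
  qed
  have conv\<nu>: "(\<lambda>n. LINT x|\<nu>. \<bar>u (\<rho> n) x - v x\<bar> powr p) \<longlonglongrightarrow> 0"
  proof (rule tendsto_sandwich[OF _ _ tendsto_const convMw])
    show "\<forall>\<^sub>F n in sequentially. 0 \<le> (LINT x|\<nu>. \<bar>u (\<rho> n) x - v x\<bar> powr p)"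
      by (intro always_eventually allI integral_nonneg_AE) auto
    show "\<forall>\<^sub>F n in sequentially. (LINT x|\<nu>. \<bar>u (\<rho> n) x - v x\<bar> powr p) \<le> (LINT x|Mw. \<bar>?U n x - v x\<bar> powr p)"
    proof (intro always_eventually allI)
      fix n
      have 1: "(\<lambda>x. u (\<rho> n) x - v x) \<in> borel_measurable lebesgue"
        by (intro borel_measurable_diff WD(4)[OF u] v_leb)
      have 2: "AE x in lebesgue. u (\<rho> n) x - v x = ?U n x - v x"
        using borel_rep_AE[OF u] by eventually_elim simp
      have 3: "in_Lp p Mw (\<lambda>x. ?U n x - v x)"
        by (intro in_Lp_diff p U_Lp v_Lp_Mw)
      have 4: "(\<lambda>x. ?U n x - v x) \<in> borel_measurable borel"
        by measurable
      show "(LINT x|\<nu>. \<bar>u (\<rho> n) x - v x\<bar> powr p) \<le> (LINT x|Mw. \<bar>?U n x - v x\<bar> powr p)"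
        by (rule Mw_dominates_\<nu>(2)[OF 1 4 2 3])
    qed
  qed
  have "(\<lambda>n. LINT x|\<nu>. \<bar>u (\<rho> n) x\<bar> powr p) \<longlonglongrightarrow> (LINT x|\<nu>. \<bar>v x\<bar> powr p)"
    by (rule Lp_norm_tendsto_of_tendsto[OF p(1) W_in_Lp_\<nu>(1)[OF u] W_in_Lp_\<nu>(1)[OF vW] AE_\<nu>I[OF lim] conv\<nu>])
  then have "(\<lambda>n. \<Psi> (u (\<rho> n))) \<longlonglongrightarrow> \<Psi> v"
    by (simp add: weighted_pow_eq WD(4)[OF u] WD(4)[OF vW])
  with \<rho> vW lim show thesis by (rule that)
qed

end

subsection \<open>Convergence and the variational problem of one step of inverse iteration\<close>

lemma subsequence_principle:
  fixes X :: "nat \<Rightarrow> 'b::metric_space"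
  assumes "\<And>\<sigma>. strict_mono \<sigma> \<Longrightarrow> \<exists>\<rho>. strict_mono (\<rho> :: nat \<Rightarrow> nat) \<and> (\<lambda>n. X (\<sigma> (\<rho> n))) \<longlonglongrightarrow> l"
  shows "X \<longlonglongrightarrow> l"
proof (rule ccontr)
  assume "\<not> X \<longlonglongrightarrow> l"
  then obtain e where e: "e > 0" and ne: "\<not> (\<forall>\<^sub>F n in sequentially. dist (X n) l < e)"
    by (auto simp: tendsto_iff)
  define A where "A = {n. \<not> dist (X n) l < e}"
  have A: "infinite A"
    using ne unfolding A_def frequently_def[symmetric] not_eventually
    by (simp add: frequently_cofinite[symmetric] cofinite_eq_sequentially)
  define \<sigma> where "\<sigma> = enumerate A"
  have "strict_mono \<sigma>" unfolding \<sigma>_def by (rule strict_mono_enumerate[OF A])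
  from assms[OF this] obtain \<rho> :: "nat \<Rightarrow> nat" where "(\<lambda>n. X (\<sigma> (\<rho> n))) \<longlonglongrightarrow> l" by blast
  then have "\<forall>\<^sub>F n in sequentially. dist (X (\<sigma> (\<rho> n))) l < e"
    using e by (rule tendstoD)
  then obtain n where "dist (X (\<sigma> (\<rho> n))) l < e"
    by (auto simp: eventually_sequentially)
  moreover have "\<sigma> (\<rho> n) \<in> A" unfolding \<sigma>_def by (rule enumerate_in_set[OF A])
  ultimately show False by (simp add: A_def)
qed

text \<open>Lower bounds on both summands leave no room: an excess of a n over x would have to be
  compensated by b n falling below y.\<close>

lemma summands_tendsto:
  fixes a b :: "nat \<Rightarrow> real"
  assumes sum: "(\<lambda>n. a n + b n) \<longlonglongrightarrow> x + y"
    and a: "\<And>e. 0 < e \<Longrightarrow> \<forall>\<^sub>F n in sequentially. x - e < a n"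
    and b: "\<And>e. 0 < e \<Longrightarrow> \<forall>\<^sub>F n in sequentially. y - e < b n"
  shows "a \<longlonglongrightarrow> x"
proof (rule tendstoI)
  fix e :: real assume e: "0 < e"
  have "\<forall>\<^sub>F n in sequentially. dist (a n + b n) (x + y) < e / 2"
    using e by (intro tendstoD[OF sum]) simp
  moreover have "\<forall>\<^sub>F n in sequentially. x - e / 2 < a n" "\<forall>\<^sub>F n in sequentially. y - e / 2 < b n"
    using e by (intro a b; simp)+
  ultimately show "\<forall>\<^sub>F n in sequentially. dist (a n) x < e"
    by eventually_elim (simp add: dist_real_def abs_if split: if_splits)
qed

context weighted_problem
begin

lemma E_cong:
  assumes u: "u \<in> W" and v: "v \<in> W" and eq: "AE x in lebesgue. u x = v x"
  shows "E u = E v"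
proof -
  have "(LINT z|\<mu>. \<bar>diff_fun u z\<bar> powr p) = (LINT z|\<mu>. \<bar>diff_fun v z\<bar> powr p)"
  proof (rule integral_cong_AE)
    show "AE z in \<mu>. \<bar>diff_fun u z\<bar> powr p = \<bar>diff_fun v z\<bar> powr p"
      using AE_pair_measureI[OF eq, of s p] by eventually_elim (simp add: diff_fun_def)
  qed (use in_LpD(2)[OF WD(2)[OF u]] in_LpD(2)[OF WD(2)[OF v]] in auto)
  moreover have "(LINT x|lebesgue. \<bar>u x\<bar> powr p) = (LINT x|lebesgue. \<bar>v x\<bar> powr p)"
  proof (rule integral_cong_AE)
    show "AE x in lebesgue. \<bar>u x\<bar> powr p = \<bar>v x\<bar> powr p"
      using eq by eventually_elim simp
  qed (use in_LpD(2)[OF WD(1)[OF u]] in_LpD(2)[OF WD(1)[OF v]] in auto)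
  ultimately show ?thesis using WD(4)[OF u] WD(4)[OF v] by (simp add: energy_eq)
qed

lemma AE_diff_fun_tendsto:
  assumes "AE x in lebesgue. (\<lambda>n. u n x) \<longlonglongrightarrow> v x"
  shows "AE z in \<mu>. (\<lambda>n. diff_fun (u n) z) \<longlonglongrightarrow> diff_fun v z"
  using AE_pair_measureI[OF assms, of s p] unfolding diff_fun_def
  by eventually_elim (auto intro: tendsto_diff)

lemma E_lsc_parts:
  assumes u: "\<And>n::nat. u n \<in> W" and v: "v \<in> W" and lim: "AE x in lebesgue. (\<lambda>n. u n x) \<longlonglongrightarrow> v x"
    and bd: "\<And>n. E (u n) \<le> C" and e: "0 < e"
  shows "\<forall>\<^sub>F n in sequentially. (LINT z|\<mu>. \<bar>diff_fun v z\<bar> powr p) - e < (LINT z|\<mu>. \<bar>diff_fun (u n) z\<bar> powr p)"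
    and "\<forall>\<^sub>F n in sequentially. (LINT x|lebesgue. \<bar>v x\<bar> powr p) - e < (LINT x|lebesgue. \<bar>u n x\<bar> powr p)"
proof -
  show "\<forall>\<^sub>F n in sequentially. (LINT z|\<mu>. \<bar>diff_fun v z\<bar> powr p) - e < (LINT z|\<mu>. \<bar>diff_fun (u n) z\<bar> powr p)"
    by (rule Lp_Fatou(2)[OF p(1) WD(2)[OF u] _ AE_diff_fun_tendsto[OF lim] order_trans[OF seminorm_le_E[OF u] bd] e])
       (rule in_LpD(1)[OF WD(2)[OF v]])
  show "\<forall>\<^sub>F n in sequentially. (LINT x|lebesgue. \<bar>v x\<bar> powr p) - e < (LINT x|lebesgue. \<bar>u n x\<bar> powr p)"
    by (rule Lp_Fatou(2)[OF p(1) WD(1)[OF u] WD(4)[OF v] lim order_trans[OF norm_le_E[OF u] bd] e])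
qed

lemma E_lsc:
  assumes u: "\<And>n::nat. u n \<in> W" and v: "v \<in> W" and lim: "AE x in lebesgue. (\<lambda>n. u n x) \<longlonglongrightarrow> v x"
    and bd: "\<And>n. E (u n) \<le> C" and e: "0 < e"
  shows "\<forall>\<^sub>F n in sequentially. E v - e < E (u n)"
proof -
  have e2: "0 < e / 2" using e by simp
  show ?thesis
    using E_lsc_parts[OF u v lim bd e2]
    by eventually_elim (simp add: energy_eq WD(4)[OF u] WD(4)[OF v])
qed

lemma E_le_limit:
  assumes u: "\<And>n::nat. u n \<in> W" and v: "v \<in> W" and lim: "AE x in lebesgue. (\<lambda>n. u n x) \<longlonglongrightarrow> v x"
    and le: "\<And>n. E (u n) \<le> a n" and a: "a \<longlonglongrightarrow> l"
  shows "E v \<le> l"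
proof (rule field_le_epsilon)
  fix e :: real assume e: "0 < e"
  have "Bseq a" using a by (rule convergent_imp_Bseq[OF convergentI])
  then obtain C where C: "\<And>n. \<bar>a n\<bar> \<le> C" by (auto simp: Bseq_def)
  have bd: "E (u n) \<le> C" for n using le[of n] C[of n] by linarith
  have e2: "0 < e / 2" using e by simp
  have "\<forall>\<^sub>F n in sequentially. dist (a n) l < e / 2" using a e2 by (rule tendstoD)
  with E_lsc[OF u v lim bd e2] have "\<forall>\<^sub>F n in sequentially. E v \<le> l + e"
  proof eventually_elim
    case (elim n)
    then show ?case using le[of n] by (simp add: dist_real_def abs_if split: if_splits)
  qed
  then show "E v \<le> l + e" by (auto simp: eventually_sequentially)
qed

lemma diff_fun_diff: "diff_fun (\<lambda>x. u x - v x) z = diff_fun u z - diff_fun v z"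
  by (simp add: diff_fun_def)

lemma diff_fun_add: "diff_fun (\<lambda>x. u x + v x) z = diff_fun u z + diff_fun v z"
  by (simp add: diff_fun_def)

lemma E_diff_eq:
  assumes u: "u \<in> W" and v: "v \<in> W"
  shows "E (\<lambda>x. u x - v x) = (LINT z|\<mu>. \<bar>diff_fun u z - diff_fun v z\<bar> powr p) + (LINT x|lebesgue. \<bar>u x - v x\<bar> powr p)"
  using WD(4)[OF W_diff[OF u v]] by (simp add: energy_eq diff_fun_diff)

lemma E_add_le:
  assumes u: "u \<in> W" and v: "v \<in> W"
  shows "E (\<lambda>x. u x + v x) \<le> 2 powr p * (E u + E v)"
proof -
  have "E (\<lambda>x. u x + v x) = (LINT z|\<mu>. \<bar>diff_fun u z + diff_fun v z\<bar> powr p) + (LINT x|lebesgue. \<bar>u x + v x\<bar> powr p)"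
    using WD(4)[OF W_add[OF u v]] by (simp add: energy_eq diff_fun_add)
  also have "\<dots> \<le> 2 powr p * ((LINT z|\<mu>. \<bar>diff_fun u z\<bar> powr p) + (LINT z|\<mu>. \<bar>diff_fun v z\<bar> powr p))
      + 2 powr p * ((LINT x|lebesgue. \<bar>u x\<bar> powr p) + (LINT x|lebesgue. \<bar>v x\<bar> powr p))"
    by (intro add_mono integral_add_powr_le p WD u v)
  also have "\<dots> = 2 powr p * (E u + E v)"
    using WD(4)[OF u] WD(4)[OF v] by (simp add: energy_eq algebra_simps)
  finally show ?thesis .
qed

text \<open>Convergence of the total energy splits into convergence of the seminorm and of the L^p
  part, both being lower semicontinuous; the Radon-Riesz property then applies in each. This
  replaces uniform convexity of the norm.\<close>

lemma E_strong_convergence: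
  assumes u: "\<And>n::nat. u n \<in> W" and v: "v \<in> W" and lim: "AE x in lebesgue. (\<lambda>n. u n x) \<longlonglongrightarrow> v x"
    and Econv: "(\<lambda>n. E (u n)) \<longlonglongrightarrow> E v"
  shows "(\<lambda>n. E (\<lambda>x. u n x - v x)) \<longlonglongrightarrow> 0"
proof -
  have "Bseq (\<lambda>n. E (u n))" using Econv by (rule convergent_imp_Bseq[OF convergentI])
  then obtain C where C: "\<And>n. \<bar>E (u n)\<bar> \<le> C" by (auto simp: Bseq_def)
  have bd: "E (u n) \<le> C" for n using C[of n] by linarith
  let ?A = "\<lambda>u. LINT z|\<mu>. \<bar>diff_fun u z\<bar> powr p" and ?B = "\<lambda>u. LINT x|lebesgue. \<bar>u x\<bar> powr p"
  have sum: "(\<lambda>n. ?A (u n) + ?B (u n)) \<longlonglongrightarrow> ?A v + ?B v"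
    using Econv by (simp add: energy_eq WD(4)[OF u] WD(4)[OF v])
  have A: "(\<lambda>n. ?A (u n)) \<longlonglongrightarrow> ?A v"
    by (rule summands_tendsto[OF sum E_lsc_parts(1)[OF u v lim bd] E_lsc_parts(2)[OF u v lim bd]])
  have sum': "(\<lambda>n. ?B (u n) + ?A (u n)) \<longlonglongrightarrow> ?B v + ?A v"
    using sum by (simp add: add.commute)
  have B: "(\<lambda>n. ?B (u n)) \<longlonglongrightarrow> ?B v"
    by (rule summands_tendsto[OF sum' E_lsc_parts(2)[OF u v lim bd] E_lsc_parts(1)[OF u v lim bd]])
  have "(\<lambda>n. (LINT z|\<mu>. \<bar>diff_fun (u n) z - diff_fun v z\<bar> powr p) + (LINT x|lebesgue. \<bar>u n x - v x\<bar> powr p)) \<longlonglongrightarrow> 0 + 0"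
    by (intro tendsto_add Lp_tendsto_of_norm_tendsto p WD u v AE_diff_fun_tendsto lim A B)
  then show ?thesis by (simp add: E_diff_eq u v)
qed

lemma E_zero_imp:
  assumes u: "u \<in> W" and "E u \<le> 0"
  shows "AE x in lebesgue. u x = 0"
proof -
  have "0 \<le> (LINT x|lebesgue. \<bar>u x\<bar> powr p)" by (rule integral_nonneg_AE) simp
  then have "(LINT x|lebesgue. \<bar>u x\<bar> powr p) = 0"
    using norm_le_E[OF u] assms(2) by linarith
  then have "AE x in lebesgue. \<bar>u x\<bar> powr p = 0"
    using in_LpD(2)[OF WD(1)[OF u]] by (subst (asm) integral_nonneg_eq_0_iff_AE) auto
  then show ?thesis by eventually_elim (use p in auto)
qed

text \<open>Convergence in \<open>W\<close> gives, along a subsequence, convergence almost everywhere; by compactness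
  it also gives convergence in the weighted space, without a separate continuity estimate.\<close>

lemma W_convergence_subseq:
  assumes u: "\<And>n::nat. u n \<in> W" and v: "v \<in> W" and conv: "(\<lambda>n. E (\<lambda>x. u n x - v x)) \<longlonglongrightarrow> 0"
  obtains \<rho> :: "nat \<Rightarrow> nat" where "strict_mono \<rho>" "AE x in lebesgue. (\<lambda>n. u (\<rho> n) x) \<longlonglongrightarrow> v x"
    "(\<lambda>n. \<Psi> (u (\<rho> n))) \<longlonglongrightarrow> \<Psi> v" "(\<lambda>n. E (u (\<rho> n))) \<longlonglongrightarrow> E v"
proof -
  define d where "d n = (\<lambda>x. u n x - v x)" for n
  have d: "d n \<in> W" for n unfolding d_def by (rule W_diff[OF u v])
  have Ed: "(\<lambda>n. E (d n)) \<longlonglongrightarrow> 0" using conv by (simp add: d_def)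
  have "Bseq (\<lambda>n. E (d n))" using Ed by (rule convergent_imp_Bseq[OF convergentI])
  then obtain C where C: "\<And>n. \<bar>E (d n)\<bar> \<le> C" by (auto simp: Bseq_def)
  have bd: "E (d n) \<le> C" for n using C[of n] by linarith
  obtain \<rho> :: "nat \<Rightarrow> nat" and w where \<rho>: "strict_mono \<rho>" and w: "w \<in> W"
    and lim: "AE x in lebesgue. (\<lambda>n. d (\<rho> n) x) \<longlonglongrightarrow> w x" and \<Psi>d: "(\<lambda>n. \<Psi> (d (\<rho> n))) \<longlonglongrightarrow> \<Psi> w"
    by (rule compactness[where u = d, OF d bd]) (rule that)
  have Ed\<rho>: "(\<lambda>n. E (d (\<rho> n))) \<longlonglongrightarrow> 0"
    using LIMSEQ_subseq_LIMSEQ[OF Ed \<rho>] by (simp add: o_def)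
  have "E w \<le> 0" by (rule E_le_limit[OF d w lim order_refl Ed\<rho>])
  then have w0: "AE x in lebesgue. w x = 0" by (rule E_zero_imp[OF w])
  have limu: "AE x in lebesgue. (\<lambda>n. u (\<rho> n) x) \<longlonglongrightarrow> v x"
    using lim w0
  proof eventually_elim
    case (elim x)
    have "(\<lambda>n. d (\<rho> n) x + v x) \<longlonglongrightarrow> w x + v x" by (intro tendsto_intros elim)
    then show ?case using elim by (simp add: d_def)
  qed
  have "\<Psi> w = 0"
  proof -
    have "(LINT x|\<nu>. \<bar>w x\<bar> powr p) = (LINT x|\<nu>. 0)"
    proof (rule integral_cong_AE)
      show "AE x in \<nu>. \<bar>w x\<bar> powr p = 0" using AE_\<nu>I[OF w0] by eventually_elim (use p in simp)
    qed (use in_LpD(2)[OF W_in_Lp_\<nu>(1)[OF w]] in auto)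
    then show ?thesis using WD(4)[OF w] by (simp add: weighted_pow_eq)
  qed
  then have "(\<lambda>n. LINT x|\<nu>. \<bar>u (\<rho> n) x - v x\<bar> powr p) \<longlonglongrightarrow> 0"
    using \<Psi>d by (simp add: weighted_pow_eq WD(4)[OF d]) (simp add: d_def)
  then have "(\<lambda>n. LINT x|\<nu>. \<bar>u (\<rho> n) x\<bar> powr p) \<longlonglongrightarrow> (LINT x|\<nu>. \<bar>v x\<bar> powr p)"
    by (rule Lp_norm_tendsto_of_tendsto[OF p(1) W_in_Lp_\<nu>(1)[OF u] W_in_Lp_\<nu>(1)[OF v] AE_\<nu>I[OF limu]])
  then have 1: "(\<lambda>n. \<Psi> (u (\<rho> n))) \<longlonglongrightarrow> \<Psi> v"
    by (simp add: weighted_pow_eq WD(4)[OF u] WD(4)[OF v])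
  have 2: "(\<lambda>n. LINT z|\<mu>. \<bar>diff_fun (u (\<rho> n)) z\<bar> powr p) \<longlonglongrightarrow> (LINT z|\<mu>. \<bar>diff_fun v z\<bar> powr p)"
  proof (rule Lp_norm_tendsto_of_tendsto[OF p(1) WD(2)[OF u] WD(2)[OF v] AE_diff_fun_tendsto[OF limu]])
    show "(\<lambda>n. LINT z|\<mu>. \<bar>diff_fun (u (\<rho> n)) z - diff_fun v z\<bar> powr p) \<longlonglongrightarrow> 0"
    proof (rule tendsto_sandwich[OF _ _ tendsto_const Ed\<rho>]; intro always_eventually allI)
      show "0 \<le> (LINT z|\<mu>. \<bar>diff_fun (u (\<rho> n)) z - diff_fun v z\<bar> powr p)" for n
        by (rule integral_nonneg_AE) auto
      show "(LINT z|\<mu>. \<bar>diff_fun (u (\<rho> n)) z - diff_fun v z\<bar> powr p) \<le> E (d (\<rho> n))" for n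
        using seminorm_le_E[OF d, of "\<rho> n"] by (simp add: d_def diff_fun_diff)
    qed
  qed
  have 3: "(\<lambda>n. LINT x|lebesgue. \<bar>u (\<rho> n) x\<bar> powr p) \<longlonglongrightarrow> (LINT x|lebesgue. \<bar>v x\<bar> powr p)"
  proof (rule Lp_norm_tendsto_of_tendsto[OF p(1) WD(1)[OF u] WD(1)[OF v] limu])
    show "(\<lambda>n. LINT x|lebesgue. \<bar>u (\<rho> n) x - v x\<bar> powr p) \<longlonglongrightarrow> 0"
    proof (rule tendsto_sandwich[OF _ _ tendsto_const Ed\<rho>]; intro always_eventually allI)
      show "0 \<le> (LINT x|lebesgue. \<bar>u (\<rho> n) x - v x\<bar> powr p)" for n
        by (rule integral_nonneg_AE) auto
      show "(LINT x|lebesgue. \<bar>u (\<rho> n) x - v x\<bar> powr p) \<le> E (d (\<rho> n))" for n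
        using norm_le_E[OF d, of "\<rho> n"] by (simp add: d_def)
    qed
  qed
  have "(\<lambda>n. E (u (\<rho> n))) \<longlonglongrightarrow> E v"
    using tendsto_add[OF 2 3] by (simp add: energy_eq WD(4)[OF u] WD(4)[OF v])
  with \<rho> limu 1 show thesis by (rule that)
qed

lemma W_convergence_tendsto:
  assumes u: "\<And>n::nat. u n \<in> W" and v: "v \<in> W" and conv: "(\<lambda>n. E (\<lambda>x. u n x - v x)) \<longlonglongrightarrow> 0"
  shows "(\<lambda>n. \<Psi> (u n)) \<longlonglongrightarrow> \<Psi> v" and "(\<lambda>n. E (u n)) \<longlonglongrightarrow> E v"
proof -
  have *: "\<exists>\<rho>. strict_mono (\<rho> :: nat \<Rightarrow> nat) \<and> (\<lambda>n. \<Psi> (u (\<sigma> (\<rho> n)))) \<longlonglongrightarrow> \<Psi> v \<and> (\<lambda>n. E (u (\<sigma> (\<rho> n)))) \<longlonglongrightarrow> E v"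
    if \<sigma>: "strict_mono \<sigma>" for \<sigma> :: "nat \<Rightarrow> nat"
  proof -
    have conv': "(\<lambda>n. E (\<lambda>x. u (\<sigma> n) x - v x)) \<longlonglongrightarrow> 0"
      using LIMSEQ_subseq_LIMSEQ[OF conv \<sigma>] by (simp add: o_def)
    show ?thesis
      by (rule W_convergence_subseq[where u = "\<lambda>n. u (\<sigma> n)", OF u v conv']) blast
  qed
  show "(\<lambda>n. \<Psi> (u n)) \<longlonglongrightarrow> \<Psi> v" by (rule subsequence_principle) (use * in blast)
  show "(\<lambda>n. E (u n)) \<longlonglongrightarrow> E v" by (rule subsequence_principle) (use * in blast)
qed

section \<open>Minimization defining one step of inverse iteration\<close>

lemma d\<Psi>_integrable: "u \<in> W \<Longrightarrow> v \<in> W \<Longrightarrow> integrable \<nu> (\<lambda>x. dpowr p (u x) * v x)"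
  by (intro integrable_dpowr_mult p W_in_Lp_\<nu>)

lemma d\<Psi>_add: "u \<in> W \<Longrightarrow> v \<in> W \<Longrightarrow> w \<in> W \<Longrightarrow> d\<Psi> u (\<lambda>x. v x + w x) = d\<Psi> u v + d\<Psi> u w"
  using d\<Psi>_integrable[of u v] d\<Psi>_integrable[of u w] by (simp add: d\<Psi>_def algebra_simps)

lemma d\<Psi>_cmult: "d\<Psi> u (\<lambda>x. c * v x) = c * d\<Psi> u v"
  by (simp add: d\<Psi>_def mult.left_commute)

lemma d\<Psi>_self: "u \<in> W \<Longrightarrow> d\<Psi> u u = \<Psi> u"
  using WD(4)[of u] by (simp add: d\<Psi>_def dpowr_mult_self weighted_pow_eq)

lemma dE_self: "u \<in> W \<Longrightarrow> dE u u = E u"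
  using WD(4)[of u] by (simp add: dE_def dpowr_mult_self energy_eq)

lemma d\<Psi>_Young:
  assumes u: "u \<in> W" and v: "v \<in> W"
  shows "d\<Psi> u v \<le> (1 - 1 / p) * \<Psi> u + \<Psi> v / p"
proof -
  have "d\<Psi> u v \<le> (LINT x|\<nu>. (1 - 1 / p) * \<bar>u x\<bar> powr p + \<bar>v x\<bar> powr p / p)"
    unfolding d\<Psi>_def
    by (intro integral_mono d\<Psi>_integrable u v Bochner_Integration.integrable_add integrable_mult_right
        integrable_divide in_LpD(2)[OF W_in_Lp_\<nu>(1)] Young_dpowr p)
  also have "\<dots> = (1 - 1 / p) * \<Psi> u + \<Psi> v / p"
    using in_LpD(2)[OF W_in_Lp_\<nu>(1)[OF u]] in_LpD(2)[OF W_in_Lp_\<nu>(1)[OF v]] WD(4)[OF u] WD(4)[OF v]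
    by (simp add: weighted_pow_eq)
  finally show ?thesis .
qed

lemma d\<Psi>_scale_left:
  assumes "0 \<le> c" shows "d\<Psi> (\<lambda>x. c * u x) v = c powr (p - 1) * d\<Psi> u v"
  using assms by (simp add: d\<Psi>_def dpowr_scale mult.assoc)

lemma dE_scale_left:
  assumes "0 \<le> c" shows "dE (\<lambda>x. c * u x) v = c powr (p - 1) * dE u v"
  using assms by (simp add: dE_def diff_fun_cmult dpowr_scale mult.assoc distrib_left)

text \<open>Replacing u by u / \<tau> and z by \<tau>^(p-1) z does not change d\<Psi>, which is
  homogeneous of degrees p - 1 and 1. Here \<tau> is chosen so that the share of E z becomes 1 / (2
  p), half of its coefficient in \<open>F\<close>; this is the coercivity of
  \<open>F\<close>.\<close>

lemma d\<Psi>_bound: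
  obtains M0 where "0 \<le> M0" "\<And>u z. u \<in> W \<Longrightarrow> z \<in> W \<Longrightarrow> d\<Psi> u z \<le> M0 * \<Psi> u + E z / (2 * p)"
proof -
  define \<tau> where "\<tau> = (1 / (2 * C_emb)) powr (1 / (p * (p - 1)))"
  have \<tau>: "0 < \<tau>" using C_emb_pos by (simp add: \<tau>_def)
  have "(\<tau> powr (p - 1)) powr p = 1 / (2 * C_emb)"
    using C_emb_pos p by (simp add: \<tau>_def powr_powr)
  then have \<tau>p: "(\<tau> powr (p - 1)) powr p * C_emb = 1 / 2" using C_emb_pos by simp
  define M0 where "M0 = (1 - 1 / p) * (1 / \<tau>) powr p"
  have "d\<Psi> u z \<le> M0 * \<Psi> u + E z / (2 * p)" if u: "u \<in> W" and z: "z \<in> W" for u z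
  proof -
    let ?u = "\<lambda>x. (1 / \<tau>) * u x" and ?z = "\<lambda>x. \<tau> powr (p - 1) * z x"
    have "d\<Psi> ?u ?z = (1 / \<tau>) powr (p - 1) * (\<tau> powr (p - 1) * d\<Psi> u z)"
      using \<tau> by (subst d\<Psi>_cmult, subst d\<Psi>_scale_left) auto
    also have "\<dots> = d\<Psi> u z"
      using \<tau> by (simp add: powr_divide)
    finally have "d\<Psi> u z = d\<Psi> ?u ?z" ..
    also have "\<dots> \<le> (1 - 1 / p) * \<Psi> ?u + \<Psi> ?z / p"
      by (intro d\<Psi>_Young W_cmult u z)
    also have "\<Psi> ?u = (1 / \<tau>) powr p * \<Psi> u"
      using \<tau> by (subst \<Psi>_cmult[OF u]) simp
    also have "\<Psi> ?z = (\<tau> powr (p - 1)) powr p * \<Psi> z"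
      by (subst \<Psi>_cmult[OF z]) simp
    also have "\<dots> \<le> (\<tau> powr (p - 1)) powr p * (C_emb * E z)"
      by (intro mult_left_mono W_in_Lp_\<nu> z) auto
    also have "\<dots> = E z / 2" using \<tau>p by (simp add: mult.assoc[symmetric])
    finally show ?thesis using p by (simp add: M0_def divide_right_mono)
  qed
  moreover have "0 \<le> M0" using p by (simp add: M0_def)
  ultimately show thesis using that by blast
qed

text \<open>A minimizer \<open>w\<close> of \<open>F u\<close> solves \<open>(-\<Delta>\<^sub>p)\<^sup>s w + dpowr p w = V * dpowr p u\<close>.\<close>

definition F :: "('a \<Rightarrow> real) \<Rightarrow> ('a \<Rightarrow> real) \<Rightarrow> real" where
  "F u z = E z / p - d\<Psi> u z"

definition minimizer :: "('a \<Rightarrow> real) \<Rightarrow> ('a \<Rightarrow> real) \<Rightarrow> bool" where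
  "minimizer u w \<longleftrightarrow> w \<in> W \<and> (\<forall>z\<in>W. F u w \<le> F u z)"

lemma d\<Psi>_tendsto:
  assumes u: "\<And>n::nat. u n \<in> W" and u': "u' \<in> W" and v: "\<And>n::nat. v n \<in> W" and v': "v' \<in> W"
    and limu: "AE x in lebesgue. (\<lambda>n. u n x) \<longlonglongrightarrow> u' x" and limv: "AE x in lebesgue. (\<lambda>n. v n x) \<longlonglongrightarrow> v' x"
    and \<Psi>u: "(\<lambda>n. \<Psi> (u n)) \<longlonglongrightarrow> \<Psi> u'" and \<Psi>v: "(\<lambda>n. \<Psi> (v n)) \<longlonglongrightarrow> \<Psi> v'"
  shows "(\<lambda>n. d\<Psi> (u n) (v n)) \<longlonglongrightarrow> d\<Psi> u' v'"
  unfolding d\<Psi>_def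
  using \<Psi>u \<Psi>v
  by (intro dpowr_mult_integral_tendsto p W_in_Lp_\<nu> u u' v v' AE_\<nu>I limu limv)
     (simp_all add: weighted_pow_eq WD(4)[OF u] WD(4)[OF u'] WD(4)[OF v] WD(4)[OF v'])

text \<open>The direct method: a minimizing sequence is bounded by coercivity, the linear term
  converges along the subsequence from \<open>compactness\<close>, and the energy is lower
  semicontinuous.\<close>

lemma minimizer_exists:
  assumes u: "u \<in> W"
  shows "\<exists>w. minimizer u w"
proof -
  obtain M0 where M0: "0 \<le> M0" "\<And>u z. u \<in> W \<Longrightarrow> z \<in> W \<Longrightarrow> d\<Psi> u z \<le> M0 * \<Psi> u + E z / (2 * p)"
    by (rule d\<Psi>_bound) (rule that)
  have lower: "E z / (2 * p) - M0 * \<Psi> u \<le> F u z" if z: "z \<in> W" for z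
  proof -
    have "E z / p = E z / (2 * p) + E z / (2 * p)" by simp
    then show ?thesis using M0(2)[OF u z] unfolding F_def by linarith
  qed
  define m where "m = Inf (F u ` W)"
  have bdd: "bdd_below (F u ` W)"
  proof (rule bdd_belowI2)
    fix z assume z: "z \<in> W"
    have "0 \<le> E z / (2 * p)" using E_nonneg[OF z] p by simp
    then show "- (M0 * \<Psi> u) \<le> F u z" using lower[OF z] by linarith
  qed
  have m_le: "m \<le> F u z" if "z \<in> W" for z
    unfolding m_def by (rule cInf_lower[OF _ bdd]) (use that in auto)
  have "\<exists>z\<in>W. F u z < m + inverse (real (Suc n))" for n
  proof -
    have "Inf (F u ` W) < m + inverse (real (Suc n))" by (simp add: m_def)
    then show ?thesis using u by (subst (asm) cInf_less_iff[OF _ bdd]) auto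
  qed
  then obtain z where z: "\<And>n. z n \<in> W" and Fz: "\<And>n. F u (z n) < m + inverse (real (Suc n))" by metis
  have bd: "E (z n) \<le> 2 * p * (m + 1 + M0 * \<Psi> u)" for n
  proof -
    have "E (z n) / (2 * p) \<le> m + 1 + M0 * \<Psi> u"
      using lower[OF z[of n]] Fz[of n] inverse_le_1_iff[of "real (Suc n)"] by linarith
    then show ?thesis using p by (simp add: field_simps)
  qed
  obtain \<rho> :: "nat \<Rightarrow> nat" and w where \<rho>: "strict_mono \<rho>" and w: "w \<in> W"
    and lim: "AE x in lebesgue. (\<lambda>n. z (\<rho> n) x) \<longlonglongrightarrow> w x" and \<Psi>z: "(\<lambda>n. \<Psi> (z (\<rho> n))) \<longlonglongrightarrow> \<Psi> w"
    by (rule compactness[where u = z, OF z bd]) (rule that)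
  have d: "(\<lambda>n. d\<Psi> u (z (\<rho> n))) \<longlonglongrightarrow> d\<Psi> u w"
    by (rule d\<Psi>_tendsto[OF u u z w _ lim _ \<Psi>z]) auto
  have i: "(\<lambda>n. inverse (real (Suc (\<rho> n)))) \<longlonglongrightarrow> 0"
    using LIMSEQ_subseq_LIMSEQ[OF LIMSEQ_inverse_real_of_nat \<rho>] by (simp add: o_def)
  have le: "E (z (\<rho> n)) \<le> p * (m + inverse (real (Suc (\<rho> n))) + d\<Psi> u (z (\<rho> n)))" for n
    using Fz[of "\<rho> n"] p by (simp add: F_def field_simps)
  have "(\<lambda>n. p * (m + inverse (real (Suc (\<rho> n))) + d\<Psi> u (z (\<rho> n)))) \<longlonglongrightarrow> p * (m + 0 + d\<Psi> u w)"
    by (intro tendsto_intros i d)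
  then have "E w \<le> p * (m + 0 + d\<Psi> u w)"
    by (rule E_le_limit[OF z w lim le])
  then have "F u w \<le> m" using p by (simp add: F_def field_simps)
  then have "minimizer u w" unfolding minimizer_def using w m_le by force
  then show ?thesis by (intro exI[of _ w])
qed

text \<open>At the midpoint of two minimizers plain convexity is enough for the seminorm. The
  strictly convex L^p term must then hold with equality, which forces the two functions to agree
  almost everywhere.\<close>

lemma minimizer_unique:
  assumes u: "u \<in> W" and w1: "minimizer u w1" and w2: "minimizer u w2"
  shows "AE x in lebesgue. w1 x = w2 x"
proof -
  have W12: "w1 \<in> W" "w2 \<in> W" and F12: "F u w1 = F u w2" and min: "\<And>z. z \<in> W \<Longrightarrow> F u w1 \<le> F u z"
    using w1 w2 unfolding minimizer_def by (auto intro: antisym)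
  define m where "m = (\<lambda>x. (1 / 2) * (w1 x + w2 x))"
  have m: "m \<in> W" unfolding m_def by (intro W_cmult W_add W12)
  have dm: "d\<Psi> u m = (d\<Psi> u w1 + d\<Psi> u w2) / 2"
    unfolding m_def by (subst d\<Psi>_cmult, subst d\<Psi>_add[OF u W12]) simp
  have conv: "\<bar>(1 / 2) * (a + b)\<bar> powr p \<le> (1 / 2) * (\<bar>a\<bar> powr p + \<bar>b\<bar> powr p)" for a b :: real
    using convex_abs_powr[OF p(1), of "1/2" a b] by (simp add: field_simps)
  let ?A = "\<lambda>u. LINT z|\<mu>. \<bar>diff_fun u z\<bar> powr p" and ?B = "\<lambda>u. LINT x|lebesgue. \<bar>u x\<bar> powr p"
  have "?A m \<le> (LINT z|\<mu>. (1 / 2) * (\<bar>diff_fun w1 z\<bar> powr p + \<bar>diff_fun w2 z\<bar> powr p))"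
  proof (rule integral_mono)
    show "\<bar>diff_fun m z\<bar> powr p \<le> (1 / 2) * (\<bar>diff_fun w1 z\<bar> powr p + \<bar>diff_fun w2 z\<bar> powr p)" for z
      using conv[of "diff_fun w1 z" "diff_fun w2 z"] by (simp only: m_def diff_fun_cmult diff_fun_add)
  qed (intro integrable_mult_right Bochner_Integration.integrable_add in_LpD(2)[OF WD(2)] W12 m)+
  also have "\<dots> = (1 / 2) * (?A w1 + ?A w2)"
    using in_LpD(2)[OF WD(2)[OF W12(1)]] in_LpD(2)[OF WD(2)[OF W12(2)]] by simp
  finally have A: "?A m \<le> (1 / 2) * (?A w1 + ?A w2)" .
  let ?g = "\<lambda>x. (1 / 2) * (\<bar>w1 x\<bar> powr p + \<bar>w2 x\<bar> powr p) - \<bar>m x\<bar> powr p"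
  have g_int: "integrable lebesgue ?g"
    by (intro integrable_mult_right Bochner_Integration.integrable_add Bochner_Integration.integrable_diff in_LpD(2)[OF WD(1)] W12 m)
  have g_eq: "(LINT x|lebesgue. ?g x) = (1 / 2) * (?B w1 + ?B w2) - ?B m"
    using in_LpD(2)[OF WD(1)[OF W12(1)]] in_LpD(2)[OF WD(1)[OF W12(2)]] in_LpD(2)[OF WD(1)[OF m]] by simp
  have g_nonneg: "0 \<le> ?g x" for x
    using conv[of "w1 x" "w2 x"] by (simp add: m_def)
  have "F u w1 \<le> F u m" by (rule min[OF m])
  then have "((E w1 + E w2) / 2) / p \<le> E m / p"
    using F12 unfolding F_def dm by (simp add: add_divide_distrib)
  then have "(E w1 + E w2) / 2 \<le> E m"
    using p by (metis divide_le_cancel less_trans zero_less_one)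
  then have "(LINT x|lebesgue. ?g x) \<le> 0"
    unfolding g_eq using A WD(4)[OF m] WD(4)[OF W12(1)] WD(4)[OF W12(2)] by (simp add: energy_eq field_simps)
  moreover have "0 \<le> (LINT x|lebesgue. ?g x)" using g_nonneg by (intro integral_nonneg_AE) auto
  ultimately have "(LINT x|lebesgue. ?g x) = 0" by linarith
  then have "AE x in lebesgue. ?g x = 0"
    using g_int g_nonneg by (subst (asm) integral_nonneg_eq_0_iff_AE) auto
  then show ?thesis
  proof eventually_elim
    case (elim x)
    show ?case
    proof (rule ccontr)
      assume "w1 x \<noteq> w2 x"
      from midpoint_strict[OF p(1) this] elim show False by (simp add: m_def)
    qed
  qed
qed

lemma dE_tendsto_perturbation:
  assumes w: "w \<in> W" and v: "v \<in> W" and t: "t \<longlonglongrightarrow> 0"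
  shows "(\<lambda>n. dE (\<lambda>x. w x + t n * v x) v) \<longlonglongrightarrow> dE w v"
proof -
  have main: "(\<lambda>n. LINT x|M. dpowr p (f x + t n * g x) * g x) \<longlonglongrightarrow> (LINT x|M. dpowr p (f x) * g x)"
    if f: "in_Lp p M f" and g: "in_Lp p M g" for M :: "'c measure" and f g
  proof -
    have Lp: "in_Lp p M (\<lambda>x. f x + t n * g x)" for n by (intro in_Lp_add p f in_Lp_cmult g)
    have lim: "AE x in M. (\<lambda>n. f x + t n * g x) \<longlonglongrightarrow> f x"
    proof (rule AE_I2)
      fix x
      have "(\<lambda>n. f x + t n * g x) \<longlonglongrightarrow> f x + 0 * g x" by (intro tendsto_intros t)
      then show "(\<lambda>n. f x + t n * g x) \<longlonglongrightarrow> f x" by simp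
    qed
    have "(\<lambda>n. \<bar>t n\<bar> powr p * (LINT x|M. \<bar>g x\<bar> powr p)) \<longlonglongrightarrow> \<bar>0\<bar> powr p * (LINT x|M. \<bar>g x\<bar> powr p)"
      using p t by (intro tendsto_mult tendsto_abs_powr tendsto_const) auto
    then have "(\<lambda>n. LINT x|M. \<bar>f x + t n * g x - f x\<bar> powr p) \<longlonglongrightarrow> 0"
      using p by (simp add: integral_cmult_powr)
    then have nf: "(\<lambda>n. LINT x|M. \<bar>f x + t n * g x\<bar> powr p) \<longlonglongrightarrow> (LINT x|M. \<bar>f x\<bar> powr p)"
      by (rule Lp_norm_tendsto_of_tendsto[OF p(1) Lp f lim])
    show ?thesis
      by (rule dpowr_mult_integral_tendsto[OF p(1) Lp f g g lim _ nf]) auto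
  qed
  have eq: "diff_fun (\<lambda>x. w x + t n * v x) z = diff_fun w z + t n * diff_fun v z" for n z
    by (simp add: diff_fun_add diff_fun_cmult)
  show ?thesis
    unfolding dE_def eq by (intro tendsto_add main WD w v)
qed

text \<open>The tangent is taken at the perturbed point, hence bounds the increment from above.
  Together with the continuity in \<open>dE_tendsto_perturbation\<close> it replaces differentiation
  under the integral.\<close>

lemma E_tangent:
  assumes u: "u \<in> W" and v: "v \<in> W"
  shows "E (\<lambda>x. u x + t * v x) - E u \<le> p * (t * dE (\<lambda>x. u x + t * v x) v)"
proof -
  have W': "(\<lambda>x. u x + t * v x) \<in> W" by (intro W_add W_cmult u v)
  have main: "(LINT x|M. \<bar>f x + t * g x\<bar> powr p) - (LINT x|M. \<bar>f x\<bar> powr p)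
      \<le> p * (t * (LINT x|M. dpowr p (f x + t * g x) * g x))"
    if f: "in_Lp p M f" and g: "in_Lp p M g" for M :: "'c measure" and f g
  proof -
    have Lp: "in_Lp p M (\<lambda>x. f x + t * g x)" by (intro in_Lp_add p f in_Lp_cmult g)
    note int = in_LpD(2)[OF Lp] in_LpD(2)[OF f] integrable_dpowr_mult[OF p(1) Lp g]
    have "(LINT x|M. \<bar>f x + t * g x\<bar> powr p - \<bar>f x\<bar> powr p) \<le> (LINT x|M. p * (t * (dpowr p (f x + t * g x) * g x)))"
    proof (rule integral_mono)
      show "\<bar>f x + t * g x\<bar> powr p - \<bar>f x\<bar> powr p \<le> p * (t * (dpowr p (f x + t * g x) * g x))" for x
        using tangent_le[OF p(1), of "f x + t * g x" "f x"] by (simp add: algebra_simps)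
    qed (use int in auto)
    then show ?thesis using int by simp
  qed
  show ?thesis
    using main[OF WD(2)[OF u] WD(2)[OF v]] main[OF WD(1)[OF u] WD(1)[OF v]]
    unfolding dE_def energy_eq[OF WD(4)[OF W']] energy_eq[OF WD(4)[OF u]] diff_fun_add diff_fun_cmult
    by (simp add: algebra_simps)
qed

lemma dE_uminus_right: "dE u (\<lambda>x. (-1) * v x) = - dE u v"
  unfolding dE_def diff_fun_cmult by simp

text \<open>Perturbations w + v / (n + 1) give one inequality in the limit; the opposite one is the
  same statement for -v.\<close>

lemma Euler_Lagrange:
  assumes u: "u \<in> W" and w: "minimizer u w" and v: "v \<in> W"
  shows "dE w v = d\<Psi> u v"
proof -
  have wW: "w \<in> W" and min: "\<And>z. z \<in> W \<Longrightarrow> F u w \<le> F u z" using w by (auto simp: minimizer_def)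
  have ge: "d\<Psi> u v \<le> dE w v" if v: "v \<in> W" for v
  proof -
    let ?t = "\<lambda>n. inverse (real (Suc n))"
    have "d\<Psi> u v \<le> dE (\<lambda>x. w x + ?t n * v x) v" for n
    proof -
      have W': "(\<lambda>x. w x + ?t n * v x) \<in> W" by (intro W_add W_cmult wW v)
      have "F u w \<le> F u (\<lambda>x. w x + ?t n * v x)" by (rule min[OF W'])
      moreover have "d\<Psi> u (\<lambda>x. w x + ?t n * v x) = d\<Psi> u w + ?t n * d\<Psi> u v"
        by (simp only: d\<Psi>_add[OF u wW W_cmult[OF v]] d\<Psi>_cmult)
      ultimately have "?t n * d\<Psi> u v \<le> E (\<lambda>x. w x + ?t n * v x) / p - E w / p"
        unfolding F_def by linarith
      then have "p * (?t n * d\<Psi> u v) \<le> p * (E (\<lambda>x. w x + ?t n * v x) / p - E w / p)"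
        using p by (intro mult_left_mono) auto
      also have "\<dots> = E (\<lambda>x. w x + ?t n * v x) - E w"
        using p by (simp only: right_diff_distrib) simp
      also have "\<dots> \<le> p * (?t n * dE (\<lambda>x. w x + ?t n * v x) v)"
        by (rule E_tangent[OF wW v])
      finally have "(p * ?t n) * d\<Psi> u v \<le> (p * ?t n) * dE (\<lambda>x. w x + ?t n * v x) v"
        by (simp only: mult.assoc)
      moreover have "0 < p * ?t n" using p by simp
      ultimately show ?thesis by (rule mult_left_le_imp_le)
    qed
    then show ?thesis
      by (intro LIMSEQ_le_const[OF dE_tendsto_perturbation[OF wW v LIMSEQ_inverse_real_of_nat]]) auto
  qed
  show ?thesis
  proof (rule antisym)
    show "d\<Psi> u v \<le> dE w v" by (rule ge[OF v])
    show "dE w v \<le> d\<Psi> u v"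
      using ge[OF W_cmult[OF v, of "-1"]] by (simp only: dE_uminus_right d\<Psi>_cmult)
  qed
qed

end

subsection \<open>Inverse iteration and the existence of an eigenfunction\<close>

context weighted_problem
begin

text \<open>The minimizer is unique only almost everywhere, so oddness of this choice is likewise an
  almost everywhere statement.\<close>

definition T :: "('a \<Rightarrow> real) \<Rightarrow> 'a \<Rightarrow> real" where
  "T u = (SOME w. minimizer u w)"

lemma T_minimizer: "u \<in> W \<Longrightarrow> minimizer u (T u)"
  unfolding T_def by (rule someI_ex[OF minimizer_exists])

lemma T_W: "u \<in> W \<Longrightarrow> T u \<in> W"
  using T_minimizer[of u] by (simp add: minimizer_def)

lemma T_unique: "u \<in> W \<Longrightarrow> minimizer u w \<Longrightarrow> AE x in lebesgue. w x = T u x"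
  by (rule minimizer_unique[OF _ _ T_minimizer])

lemma minimizer_E: "u \<in> W \<Longrightarrow> minimizer u w \<Longrightarrow> E w = d\<Psi> u w"
  using Euler_Lagrange[of u w w] dE_self[of w] by (simp add: minimizer_def)

text \<open>F u' z = F u (-z), so -T u minimizes the functional of u', and uniqueness
  applies.\<close>

lemma T_odd:
  assumes u: "u \<in> W" and u': "u' \<in> W" and eq: "AE x in lebesgue. u' x = - u x"
  shows "AE x in lebesgue. T u' x = - T u x"
proof -
  have d: "d\<Psi> u' z = d\<Psi> u (\<lambda>x. (-1) * z x)" if "z \<in> W" for z
    unfolding d\<Psi>_def
  proof (rule integral_cong_AE)
    show "AE x in \<nu>. dpowr p (u' x) * z x = dpowr p (u x) * (- 1 * z x)"
      using AE_\<nu>I[OF eq] by eventually_elim simp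
  qed (use d\<Psi>_integrable[OF u' that] d\<Psi>_integrable[OF u W_cmult[OF that, of "-1"]] in auto)
  have FF: "F u' z = F u (\<lambda>x. (-1) * z x)" if "z \<in> W" for z
    using E_cmult[OF that, of "-1"] d[OF that] by (simp add: F_def)
  have "minimizer u' (\<lambda>x. (-1) * T u x)"
    unfolding minimizer_def
  proof (intro conjI ballI)
    show mW: "(\<lambda>x. (-1) * T u x) \<in> W" by (rule W_cmult[OF T_W[OF u]])
    fix z assume z: "z \<in> W"
    have "F u (T u) \<le> F u (\<lambda>x. (-1) * z x)"
      using T_minimizer[OF u] W_cmult[OF z, of "-1"] by (simp add: minimizer_def)
    then show "F u' (\<lambda>x. (-1) * T u x) \<le> F u' z"
      unfolding FF[OF mW] FF[OF z] by simp
  qed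
  from T_unique[OF u' this] show ?thesis by eventually_elim simp
qed

text \<open>The images are bounded in energy. A subsequential limit minimizes the limiting
  functional, hence is T u'. Since E w = d\<Psi> u w for minimizers, the energies converge too,
  which upgrades the convergence to a strong one. The hypotheses do not ask for convergence of u n
  in energy.\<close>

lemma T_continuous_AE:
  assumes u: "\<And>n::nat. u n \<in> W" and u': "u' \<in> W"
    and lim: "AE x in lebesgue. (\<lambda>n. u n x) \<longlonglongrightarrow> u' x" and \<Psi>u: "(\<lambda>n. \<Psi> (u n)) \<longlonglongrightarrow> \<Psi> u'"
  shows "(\<lambda>n. E (\<lambda>x. T (u n) x - T u' x)) \<longlonglongrightarrow> 0"
proof (rule subsequence_principle)
  fix \<sigma> :: "nat \<Rightarrow> nat" assume \<sigma>: "strict_mono \<sigma>"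
  obtain M0 where M0: "0 \<le> M0" "\<And>u z. u \<in> W \<Longrightarrow> z \<in> W \<Longrightarrow> d\<Psi> u z \<le> M0 * \<Psi> u + E z / (2 * p)"
    by (rule d\<Psi>_bound) (rule that)
  define w where "w n = T (u (\<sigma> n))" for n
  have w: "w n \<in> W" for n unfolding w_def by (rule T_W[OF u])
  have Ew: "E (w n) = d\<Psi> (u (\<sigma> n)) (w n)" for n
    unfolding w_def by (rule minimizer_E[OF u T_minimizer[OF u]])
  have "Bseq (\<lambda>n. \<Psi> (u n))" using \<Psi>u by (rule convergent_imp_Bseq[OF convergentI])
  then obtain C where C: "\<And>n. \<bar>\<Psi> (u n)\<bar> \<le> C" by (auto simp: Bseq_def)
  \<comment> \<open>The term E / (2 p) is at most E / 2 and is absorbed on the left.\<close>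
  have bd: "E (w n) \<le> 2 * (M0 * C)" for n
  proof -
    have "E (w n) \<le> M0 * \<Psi> (u (\<sigma> n)) + E (w n) / (2 * p)"
      using M0(2)[OF u[of "\<sigma> n"] w[of n]] Ew[of n] by linarith
    moreover have "E (w n) / (2 * p) \<le> E (w n) / 2"
      using p E_nonneg[OF w[of n]] by (intro divide_left_mono) auto
    moreover have "M0 * \<Psi> (u (\<sigma> n)) \<le> M0 * C"
      using M0(1) C[of "\<sigma> n"] by (intro mult_left_mono) auto
    ultimately show ?thesis by linarith
  qed
  obtain \<rho> :: "nat \<Rightarrow> nat" and w' where \<rho>: "strict_mono \<rho>" and w': "w' \<in> W"
    and limw: "AE x in lebesgue. (\<lambda>n. w (\<rho> n) x) \<longlonglongrightarrow> w' x" and \<Psi>w: "(\<lambda>n. \<Psi> (w (\<rho> n))) \<longlonglongrightarrow> \<Psi> w'"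
    by (rule compactness[where u = w, OF w bd]) (rule that)
  have sub: "strict_mono (\<lambda>n. \<sigma> (\<rho> n))"
    using strict_mono_o[OF \<sigma> \<rho>] by (simp add: o_def)
  have limu: "AE x in lebesgue. (\<lambda>n. u (\<sigma> (\<rho> n)) x) \<longlonglongrightarrow> u' x"
    using lim
  proof eventually_elim
    case (elim x)
    show ?case using LIMSEQ_subseq_LIMSEQ[OF elim sub] by (simp add: o_def)
  qed
  have \<Psi>u': "(\<lambda>n. \<Psi> (u (\<sigma> (\<rho> n)))) \<longlonglongrightarrow> \<Psi> u'"
    using LIMSEQ_subseq_LIMSEQ[OF \<Psi>u sub] by (simp add: o_def)
  have d1: "(\<lambda>n. d\<Psi> (u (\<sigma> (\<rho> n))) (w (\<rho> n))) \<longlonglongrightarrow> d\<Psi> u' w'"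
    by (rule d\<Psi>_tendsto[OF u u' w w' limu limw \<Psi>u' \<Psi>w])
  have min: "minimizer u' w'"
    unfolding minimizer_def
  proof (intro conjI ballI)
    fix z assume z: "z \<in> W"
    have d2: "(\<lambda>n. d\<Psi> (u (\<sigma> (\<rho> n))) z) \<longlonglongrightarrow> d\<Psi> u' z"
      by (rule d\<Psi>_tendsto[OF u u' z z limu _ \<Psi>u']) auto
    have "F (u (\<sigma> (\<rho> n))) (w (\<rho> n)) \<le> F (u (\<sigma> (\<rho> n))) z" for n
      using T_minimizer[OF u] z unfolding minimizer_def w_def by blast
    then have le: "E (w (\<rho> n)) \<le> p * (d\<Psi> (u (\<sigma> (\<rho> n))) (w (\<rho> n)) + (E z / p - d\<Psi> (u (\<sigma> (\<rho> n))) z))" for n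
    proof -
      assume *: "\<And>n. F (u (\<sigma> (\<rho> n))) (w (\<rho> n)) \<le> F (u (\<sigma> (\<rho> n))) z"
      have "E (w (\<rho> n)) / p \<le> d\<Psi> (u (\<sigma> (\<rho> n))) (w (\<rho> n)) + (E z / p - d\<Psi> (u (\<sigma> (\<rho> n))) z)"
        using *[of n] unfolding F_def by linarith
      then show ?thesis using p by (simp add: divide_le_eq mult.commute)
    qed
    have "(\<lambda>n. p * (d\<Psi> (u (\<sigma> (\<rho> n))) (w (\<rho> n)) + (E z / p - d\<Psi> (u (\<sigma> (\<rho> n))) z)))
      \<longlonglongrightarrow> p * (d\<Psi> u' w' + (E z / p - d\<Psi> u' z))"
      by (intro tendsto_intros d1 d2)
    then have "E w' \<le> p * (d\<Psi> u' w' + (E z / p - d\<Psi> u' z))"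
      by (rule E_le_limit[OF w w' limw le])
    then have "E w' / p \<le> d\<Psi> u' w' + (E z / p - d\<Psi> u' z)"
      using p by (simp add: divide_le_eq mult.commute)
    then show "F u' w' \<le> F u' z" unfolding F_def by linarith
  qed (rule w')
  have "(\<lambda>n. E (w (\<rho> n))) \<longlonglongrightarrow> E w'"
    unfolding Ew minimizer_E[OF u' min] by (rule d1)
  then have conv: "(\<lambda>n. E (\<lambda>x. w (\<rho> n) x - w' x)) \<longlonglongrightarrow> 0"
    by (rule E_strong_convergence[OF w w' limw])
  have "E (\<lambda>x. w (\<rho> n) x - T u' x) = E (\<lambda>x. w (\<rho> n) x - w' x)" for n
  proof (rule E_cong[OF W_diff[OF w T_W[OF u']] W_diff[OF w w']])
    show "AE x in lebesgue. w (\<rho> n) x - T u' x = w (\<rho> n) x - w' x"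
      using T_unique[OF u' min] by eventually_elim simp
  qed
  then show "\<exists>\<rho>. strict_mono (\<rho> :: nat \<Rightarrow> nat) \<and> (\<lambda>n. E (\<lambda>x. T (u (\<sigma> (\<rho> n))) x - T u' x)) \<longlonglongrightarrow> 0"
    using conv \<rho> by (intro exI[of _ \<rho>]) (simp add: w_def)
qed

lemma T_continuous:
  assumes u: "\<And>n::nat. u n \<in> W" and u': "u' \<in> W" and conv: "(\<lambda>n. E (\<lambda>x. u n x - u' x)) \<longlonglongrightarrow> 0"
  shows "(\<lambda>n. E (\<lambda>x. T (u n) x - T u' x)) \<longlonglongrightarrow> 0"
proof (rule subsequence_principle)
  fix \<sigma> :: "nat \<Rightarrow> nat" assume \<sigma>: "strict_mono \<sigma>"
  have conv': "(\<lambda>n. E (\<lambda>x. u (\<sigma> n) x - u' x)) \<longlonglongrightarrow> 0"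
    using LIMSEQ_subseq_LIMSEQ[OF conv \<sigma>] by (simp add: o_def)
  obtain \<rho> :: "nat \<Rightarrow> nat" where \<rho>: "strict_mono \<rho>" and lim: "AE x in lebesgue. (\<lambda>n. u (\<sigma> (\<rho> n)) x) \<longlonglongrightarrow> u' x"
    and \<Psi>u: "(\<lambda>n. \<Psi> (u (\<sigma> (\<rho> n)))) \<longlonglongrightarrow> \<Psi> u'"
    by (rule W_convergence_subseq[where u = "\<lambda>n. u (\<sigma> n)", OF u u' conv']) (rule that)
  have "(\<lambda>n. E (\<lambda>x. T (u (\<sigma> (\<rho> n))) x - T u' x)) \<longlonglongrightarrow> 0"
    by (rule T_continuous_AE[OF u u' lim \<Psi>u])
  with \<rho> show "\<exists>\<rho>. strict_mono (\<rho> :: nat \<Rightarrow> nat) \<and> (\<lambda>n. E (\<lambda>x. T (u (\<sigma> (\<rho> n))) x - T u' x)) \<longlonglongrightarrow> 0"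
    by (intro exI[of _ \<rho>]) simp
qed

lemma E_pos: 
  assumes u: "u \<in> W" and "0 < \<Psi> u"
  shows "0 < E u"
proof -
  have "0 < C_emb * E u" using W_in_Lp_\<nu>(2)[OF u] assms(2) by linarith
  then show ?thesis using C_emb_pos by (simp add: zero_less_mult_iff)
qed

text \<open>Let w = T u. Comparing w with the best multiple c u gives c \<le> E w, and Hoelder with
  \<Psi> u = 1 gives E w \<le> (\<Psi> w)^(1/p). Hence E w / \<Psi> w \<le> (E w)^(1-p) \<le>
  c^(1-p) = E u. Equality forces E w = c, so c u is itself a minimizer, and its Euler-Lagrange
  equation is the eigenvalue equation for u.\<close>

lemma T_descent:
  assumes u: "u \<in> W" and \<Psi>u: "\<Psi> u = 1"
  shows "0 < \<Psi> (T u)" and "E (T u) / \<Psi> (T u) \<le> E u"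
    and "E (T u) / \<Psi> (T u) = E u \<Longrightarrow> eigenfunction s p \<Omega> V (E u) u"
proof -
  define w where "w = T u"
  have w: "w \<in> W" and min: "minimizer u w" unfolding w_def using T_W[OF u] T_minimizer[OF u] by auto
  have Eu: "0 < E u" by (rule E_pos[OF u]) (simp add: \<Psi>u)
  have Ew: "E w = d\<Psi> u w" by (rule minimizer_E[OF u min])
  \<comment> \<open>The minimum point of c^p E u / p - c, that is, c^(p-1) = 1 / E u.\<close>
  define c where "c = E u powr (- (1 / (p - 1)))"
  have c: "0 < c" using Eu by (simp add: c_def)
  have "- (1 / (p - 1)) * (p - 1) = - 1" using p by simp
  then have cp: "c powr (p - 1) = 1 / E u"
    using Eu by (simp only: c_def powr_powr) (simp add: powr_minus_divide)
  have cp': "c powr p * E u = c"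
    using c Eu powr_mult_base[of c "p - 1"] cp by (simp add: field_simps)
  have Fcu: "F u (\<lambda>x. c * u x) = c / p - c"
    using c cp' by (simp add: F_def E_cmult[OF u] d\<Psi>_cmult d\<Psi>_self[OF u] \<Psi>u)
  have Fw: "F u w = E w / p - E w" by (simp add: F_def Ew)
  have "F u w \<le> F u (\<lambda>x. c * u x)"
    using min W_cmult[OF u] by (simp add: minimizer_def)
  then have "(1 - 1 / p) * c \<le> (1 - 1 / p) * E w"
    unfolding Fcu Fw by (simp add: algebra_simps)
  then have cE: "c \<le> E w" using p by simp
  then have Ew0: "0 < E w" using c by linarith
  show \<Psi>w: "0 < \<Psi> (T u)"
  proof (rule ccontr)
    assume "\<not> 0 < \<Psi> (T u)"
    then have 0: "\<Psi> w = 0" using \<Psi>_nonneg[OF w] by (simp add: w_def)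
    \<comment> \<open>If \<Psi> w were 0, Young's inequality would bound d\<Psi> u along the whole
      ray of w by 1 - 1 / p; the multiple 2 / E w makes it equal to 2.\<close>
    have "d\<Psi> u (\<lambda>x. (2 / E w) * w x) \<le> (1 - 1 / p) * \<Psi> u + \<Psi> (\<lambda>x. (2 / E w) * w x) / p"
      by (rule d\<Psi>_Young[OF u W_cmult[OF w]])
    then have "2 \<le> 1 - 1 / p"
      using Ew0 unfolding d\<Psi>_cmult Ew[symmetric] \<Psi>_cmult[OF w] 0 \<Psi>u by simp
    moreover have "0 < 1 / p" using p by simp
    ultimately show False by linarith
  qed
  define k where "k = \<Psi> w powr (1 / p)"
  have k: "0 < k" using \<Psi>w by (simp add: k_def w_def)
  have kp: "k powr p = \<Psi> w" using \<Psi>w p by (simp add: k_def w_def powr_powr)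
  \<comment> \<open>After normalization of both arguments Young's inequality becomes
    Hoelder's.\<close>
  have "d\<Psi> u (\<lambda>x. (1 / k) * w x) \<le> (1 - 1 / p) * \<Psi> u + \<Psi> (\<lambda>x. (1 / k) * w x) / p"
    by (rule d\<Psi>_Young[OF u W_cmult[OF w]])
  also have "\<Psi> (\<lambda>x. (1 / k) * w x) = 1"
    unfolding \<Psi>_cmult[OF w] using k \<Psi>w by (simp add: powr_divide kp w_def[symmetric])
  finally have "E w / k \<le> 1"
    unfolding d\<Psi>_cmult Ew[symmetric] \<Psi>u using p by simp
  then have Ek: "E w \<le> k" using k by (simp add: divide_le_eq)
  then have "E w powr p \<le> \<Psi> w" unfolding kp[symmetric] using Ew0 p by (intro powr_mono2) auto
  then have "E w / \<Psi> w \<le> E w / E w powr p"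
    using Ew0 by (intro divide_left_mono) (auto intro!: mult_pos_pos \<Psi>w[folded w_def])
  also have "\<dots> = E w powr (1 - p)" using Ew0 by (simp add: powr_diff)
  finally have J: "E w / \<Psi> w \<le> E w powr (1 - p)" .
  have c1p: "c powr (1 - p) = E u"
  proof -
    have "c powr (1 - p) = 1 / c powr (p - 1)" using powr_minus_divide[of c "p - 1"] by simp
    then show ?thesis by (simp add: cp)
  qed
  have "E w powr (1 - p) \<le> c powr (1 - p)" using c cE p by (intro powr_mono2') auto
  with J show "E (T u) / \<Psi> (T u) \<le> E u" unfolding c1p w_def by linarith
  assume "E (T u) / \<Psi> (T u) = E u"
  then have "c powr (1 - p) \<le> E w powr (1 - p)" using J unfolding c1p w_def by linarith
  have "E w \<le> c"
  proof (rule ccontr)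
    assume "\<not> E w \<le> c"
    then have "E w powr (1 - p) < c powr (1 - p)"
      using c p by (intro powr_less_mono2_neg) auto
    then show False using \<open>c powr (1 - p) \<le> E w powr (1 - p)\<close> by linarith
  qed
  then have "F u w = F u (\<lambda>x. c * u x)" using cE unfolding Fw Fcu by simp
  then have min': "minimizer u (\<lambda>x. c * u x)"
    using min W_cmult[OF u] by (simp add: minimizer_def)
  have "dE u v = E u * d\<Psi> u v" if v: "v \<in> W" for v
  proof -
    have "c powr (p - 1) * dE u v = d\<Psi> u v"
      using Euler_Lagrange[OF u min' v] c by (simp add: dE_scale_left)
    then show ?thesis using Eu by (simp add: cp field_simps)
  qed
  moreover have "\<not> (AE x in lebesgue. u x = 0)"
  proof
    assume "AE x in lebesgue. u x = 0"
    from E_cong[OF u W_cmult[OF u, of 0]] this have "E u = E (\<lambda>x. 0 * u x)" by simp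
    then show False using Eu E_cmult[OF u, of 0] p by simp
  qed
  ultimately show "eigenfunction s p \<Omega> V (E u) u"
    unfolding eigenfunction_iff using u by blast
qed

section \<open>Normalization and admissible circles\<close>

definition normalized :: "('a \<Rightarrow> real) \<Rightarrow> 'a \<Rightarrow> real" where
  "normalized w = (\<lambda>x. (1 / \<Psi> w powr (1 / p)) * w x)"

lemma normalized_W: "w \<in> W \<Longrightarrow> normalized w \<in> W"
  unfolding normalized_def by (rule W_cmult)

lemma normalized:
  assumes w: "w \<in> W" and pos: "0 < \<Psi> w"
  shows "\<Psi> (normalized w) = 1" and "E (normalized w) = E w / \<Psi> w"
proof -
  have "\<bar>1 / \<Psi> w powr (1 / p)\<bar> powr p = 1 / \<Psi> w"
    using pos p by (simp add: powr_divide powr_powr)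
  then show "\<Psi> (normalized w) = 1" "E (normalized w) = E w / \<Psi> w"
    unfolding normalized_def \<Psi>_cmult[OF w] E_cmult[OF w] using pos by simp_all
qed

lemma normalized_S_V: "w \<in> W \<Longrightarrow> 0 < \<Psi> w \<Longrightarrow> normalized w \<in> S_V s p \<Omega> V"
  by (simp add: S_V_def normalized_W normalized)

lemma normalized_continuous:
  assumes u: "\<And>n::nat. u n \<in> W" and v: "v \<in> W" and conv: "(\<lambda>n. E (\<lambda>x. u n x - v x)) \<longlonglongrightarrow> 0"
    and pos: "0 < \<Psi> v"
  shows "(\<lambda>n. E (\<lambda>x. normalized (u n) x - normalized v x)) \<longlonglongrightarrow> 0"
proof -
  let ?c = "\<lambda>u. 1 / \<Psi> u powr (1 / p)"
  have "(\<lambda>n. \<Psi> (u n)) \<longlonglongrightarrow> \<Psi> v" by (rule W_convergence_tendsto(1)[OF u v conv])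
  then have c: "(\<lambda>n. ?c (u n)) \<longlonglongrightarrow> ?c v"
    using pos by (intro tendsto_intros) auto
  have le: "E (\<lambda>x. normalized (u n) x - normalized v x)
      \<le> 2 powr p * (\<bar>?c (u n)\<bar> powr p * E (\<lambda>x. u n x - v x) + \<bar>?c (u n) - ?c v\<bar> powr p * E v)" for n
  proof -
    have "E (\<lambda>x. normalized (u n) x - normalized v x)
        = E (\<lambda>x. ?c (u n) * (u n x - v x) + (?c (u n) - ?c v) * v x)"
      by (rule arg_cong[where f = E], rule ext) (simp add: normalized_def left_diff_distrib diff_divide_distrib)
    also have "\<dots> \<le> 2 powr p * (E (\<lambda>x. ?c (u n) * (u n x - v x)) + E (\<lambda>x. (?c (u n) - ?c v) * v x))"
      by (intro E_add_le W_cmult W_diff u v)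
    finally show ?thesis
      unfolding E_cmult[OF v] E_cmult[OF W_diff[OF u v]] .
  qed
  have "(\<lambda>n. 2 powr p * (\<bar>?c (u n)\<bar> powr p * E (\<lambda>x. u n x - v x) + \<bar>?c (u n) - ?c v\<bar> powr p * E v))
      \<longlonglongrightarrow> 2 powr p * (\<bar>?c v\<bar> powr p * 0 + \<bar>?c v - ?c v\<bar> powr p * E v)"
    using p by (intro tendsto_mult tendsto_add tendsto_const tendsto_abs_powr tendsto_diff c conv) auto
  then have "(\<lambda>n. 2 powr p * (\<bar>?c (u n)\<bar> powr p * E (\<lambda>x. u n x - v x) + \<bar>?c (u n) - ?c v\<bar> powr p * E v))
      \<longlonglongrightarrow> 0"
    using p by simp
  then show ?thesis
    by (rule tendsto_sandwich[OF always_eventually always_eventually tendsto_const, rotated 2])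
       (use le E_nonneg[OF W_diff[OF normalized_W[OF u] normalized_W[OF v]]] in auto)
qed

lemma W0_norm_eq: "W0_norm s p u = E u powr (1 / p)"
  by (simp add: W0_norm_def energy_def add.commute)

text \<open>The norm of the difference vanishes at \<omega> itself, so the limit statement is
  continuity at \<omega> and can be tested on sequences, the form of all convergence results for the
  energy.\<close>

lemma W0_norm_tendsto_iff:
  fixes f :: "complex \<Rightarrow> 'a \<Rightarrow> real"
  assumes f: "\<And>\<omega>. \<omega> \<in> sphere 0 1 \<Longrightarrow> f \<omega> \<in> W" and \<omega>: "\<omega> \<in> sphere 0 1"
  shows "((\<lambda>\<omega>'. W0_norm s p (\<lambda>x. f \<omega>' x - f \<omega> x)) \<longlongrightarrow> 0) (at \<omega> within sphere 0 1) \<longleftrightarrow>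
    (\<forall>X. (\<forall>n. X n \<in> sphere 0 1) \<longrightarrow> X \<longlonglongrightarrow> \<omega> \<longrightarrow> (\<lambda>n. E (\<lambda>x. f (X n) x - f \<omega> x)) \<longlonglongrightarrow> 0)"
proof -
  let ?h = "\<lambda>\<omega>'. W0_norm s p (\<lambda>x. f \<omega>' x - f \<omega> x)"
  have E0: "E (\<lambda>x. f \<omega> x - f \<omega> x) = 0"
    using E_cmult[OF f[OF \<omega>], of 0] p by simp
  then have h0: "?h \<omega> = 0" "W0_norm s p (\<lambda>x::'a. 0) = 0" by (simp_all add: W0_norm_eq)
  have eq: "(\<lambda>n. ?h (X n)) \<longlonglongrightarrow> 0 \<longleftrightarrow> (\<lambda>n. E (\<lambda>x. f (X n) x - f \<omega> x)) \<longlonglongrightarrow> 0"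
    if X: "\<And>n. X n \<in> sphere 0 1" for X :: "nat \<Rightarrow> complex"
  proof
    have nn: "0 \<le> E (\<lambda>x. f (X n) x - f \<omega> x)" for n by (intro E_nonneg W_diff f X \<omega>)
    assume "(\<lambda>n. ?h (X n)) \<longlonglongrightarrow> 0"
    then have "(\<lambda>n. ?h (X n) powr p) \<longlonglongrightarrow> 0 powr p" using p by (intro tendsto_powr2) (auto simp: W0_norm_eq)
    then show "(\<lambda>n. E (\<lambda>x. f (X n) x - f \<omega> x)) \<longlonglongrightarrow> 0"
      using p nn by (simp add: W0_norm_eq powr_powr)
  next
    have nn: "0 \<le> E (\<lambda>x. f (X n) x - f \<omega> x)" for n by (intro E_nonneg W_diff f X \<omega>)
    assume "(\<lambda>n. E (\<lambda>x. f (X n) x - f \<omega> x)) \<longlonglongrightarrow> 0"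
    then have "(\<lambda>n. E (\<lambda>x. f (X n) x - f \<omega> x) powr (1 / p)) \<longlonglongrightarrow> 0 powr (1 / p)"
      using p nn by (intro tendsto_powr2) auto
    then show "(\<lambda>n. ?h (X n)) \<longlonglongrightarrow> 0" by (simp add: W0_norm_eq)
  qed
  have "(?h \<longlongrightarrow> 0) (at \<omega> within sphere 0 1) \<longleftrightarrow> continuous (at \<omega> within sphere 0 1) ?h"
    by (simp add: continuous_within h0)
  also have "\<dots> \<longleftrightarrow> (\<forall>X. (\<forall>n. X n \<in> sphere 0 1) \<and> X \<longlonglongrightarrow> \<omega> \<longrightarrow> (?h \<circ> X) \<longlonglongrightarrow> ?h \<omega>)"
    unfolding continuous_within_sequentially by simp
  also have "\<dots> \<longleftrightarrow> (\<forall>X. (\<forall>n. X n \<in> sphere 0 1) \<longrightarrow> X \<longlonglongrightarrow> \<omega> \<longrightarrow> (\<lambda>n. E (\<lambda>x. f (X n) x - f \<omega> x)) \<longlonglongrightarrow> 0)"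
    unfolding h0(1) o_def using eq by blast
  finally show ?thesis .
qed

abbreviation "paths \<equiv> C1_maps s p \<Omega> V"
abbreviation "lam2 \<equiv> second_eigenvalue s p \<Omega> V"
abbreviation "path_max f \<equiv> (SUP u\<in>f ` sphere 0 1. E u)"

lemma pathD:
  assumes f: "f \<in> paths" and \<omega>: "\<omega> \<in> sphere 0 1"
  shows "f \<omega> \<in> W" "\<Psi> (f \<omega>) = 1" "AE x in lebesgue. f (- \<omega>) x = - f \<omega> x"
  using f \<omega> by (auto simp: C1_maps_def S_V_def)

lemma path_tendsto:
  assumes f: "f \<in> paths" and \<omega>: "\<omega> \<in> sphere 0 1" and X: "\<And>n. X n \<in> sphere 0 1" "X \<longlonglongrightarrow> \<omega>"
  shows "(\<lambda>n. E (\<lambda>x. f (X n) x - f \<omega> x)) \<longlonglongrightarrow> 0"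
proof -
  have "((\<lambda>\<omega>'. W0_norm s p (\<lambda>x. f \<omega>' x - f \<omega> x)) \<longlongrightarrow> 0) (at \<omega> within sphere 0 1)"
    using f \<omega> by (simp add: C1_maps_def)
  moreover have "((\<lambda>\<omega>'. W0_norm s p (\<lambda>x. f \<omega>' x - f \<omega> x)) \<longlongrightarrow> 0) (at \<omega> within sphere 0 1) \<longleftrightarrow>
    (\<forall>X. (\<forall>n. X n \<in> sphere 0 1) \<longrightarrow> X \<longlonglongrightarrow> \<omega> \<longrightarrow> (\<lambda>n. E (\<lambda>x. f (X n) x - f \<omega> x)) \<longlonglongrightarrow> 0)"
    by (rule W0_norm_tendsto_iff[OF _ \<omega>]) (rule pathD(1)[OF f])
  ultimately show ?thesis using X by simp
qed

lemma pathI: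
  assumes f: "\<And>\<omega>. \<omega> \<in> sphere 0 1 \<Longrightarrow> f \<omega> \<in> S_V s p \<Omega> V"
    and odd: "\<And>\<omega>. \<omega> \<in> sphere 0 1 \<Longrightarrow> AE x in lebesgue. f (- \<omega>) x = - f \<omega> x"
    and cont: "\<And>\<omega> X. \<omega> \<in> sphere 0 1 \<Longrightarrow> (\<And>n. X n \<in> sphere 0 1) \<Longrightarrow> X \<longlonglongrightarrow> \<omega>
      \<Longrightarrow> (\<lambda>n. E (\<lambda>x. f (X n) x - f \<omega> x)) \<longlonglongrightarrow> 0"
  shows "f \<in> paths"
proof -
  have fW: "f \<omega> \<in> W" if "\<omega> \<in> sphere 0 1" for \<omega> using f[OF that] by (simp add: S_V_def)
  have "((\<lambda>\<omega>'. W0_norm s p (\<lambda>x. f \<omega>' x - f \<omega> x)) \<longlongrightarrow> 0) (at \<omega> within sphere 0 1)"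
    if \<omega>: "\<omega> \<in> sphere 0 1" for \<omega>
  proof (subst W0_norm_tendsto_iff[OF _ \<omega>])
    show "\<forall>X. (\<forall>n. X n \<in> sphere 0 1) \<longrightarrow> X \<longlonglongrightarrow> \<omega> \<longrightarrow> (\<lambda>n. E (\<lambda>x. f (X n) x - f \<omega> x)) \<longlonglongrightarrow> 0"
      by (intro allI impI cont[OF \<omega>]) auto
  qed (rule fW)
  then show ?thesis
    unfolding C1_maps_def using f odd by blast
qed

lemma path_bdd:
  assumes f: "f \<in> paths"
  shows "bdd_above (E ` f ` sphere 0 1)"
proof -
  have "continuous_on (sphere 0 1) (\<lambda>\<omega>. E (f \<omega>))"
    unfolding continuous_on_sequentially
  proof (intro allI ballI impI)
    fix X :: "nat \<Rightarrow> complex" and \<omega> assume \<omega>: "\<omega> \<in> sphere 0 1" and "(\<forall>n. X n \<in> sphere 0 1) \<and> X \<longlonglongrightarrow> \<omega>"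
    then have X: "\<And>n. X n \<in> sphere 0 1" "X \<longlonglongrightarrow> \<omega>" by auto
    show "((\<lambda>\<omega>. E (f \<omega>)) \<circ> X) \<longlonglongrightarrow> E (f \<omega>)"
      unfolding o_def
      by (rule W_convergence_tendsto(2)[OF pathD(1)[OF f X(1)] pathD(1)[OF f \<omega>] path_tendsto[OF f \<omega> X]])
  qed
  then have "compact ((\<lambda>\<omega>. E (f \<omega>)) ` sphere 0 1)"
    by (rule compact_continuous_image) (rule compact_sphere)
  then show ?thesis
    by (simp add: image_image bounded_imp_bdd_above compact_imp_bounded)
qed

lemma E_le_path_max: "f \<in> paths \<Longrightarrow> \<omega> \<in> sphere 0 1 \<Longrightarrow> E (f \<omega>) \<le> path_max f"
  by (rule cSUP_upper[OF _ path_bdd]) auto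

lemma path_max_nonneg:
  assumes "f \<in> paths" shows "0 \<le> path_max f"
proof -
  have "0 \<le> E (f 1)" by (intro E_nonneg pathD(1)[OF assms]) simp
  also have "\<dots> \<le> path_max f" by (rule E_le_path_max[OF assms]) simp
  finally show ?thesis .
qed

lemma bdd_below_path_max: "bdd_below (path_max ` paths)"
  by (rule bdd_belowI2[of _ 0]) (rule path_max_nonneg)

lemma lam2_le: "f \<in> paths \<Longrightarrow> lam2 \<le> path_max f"
  unfolding second_eigenvalue_def by (rule cINF_lower[OF bdd_below_path_max])

lemma near_optimal_path:
  assumes "paths \<noteq> {}" and "0 < e"
  obtains f where "f \<in> paths" "path_max f < lam2 + e"
proof -
  have "(INF f\<in>paths. path_max f) < lam2 + e"
    using assms(2) by (simp add: second_eigenvalue_def)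
  then show thesis
    using that by (subst (asm) cINF_less_iff[OF assms(1) bdd_below_path_max]) blast
qed

lemma iterated_path:
  assumes f: "f \<in> paths"
  shows "(\<lambda>\<omega>. normalized (T (f \<omega>))) \<in> paths"
proof (rule pathI)
  note fW = pathD(1)[OF f]
  have pos: "0 < \<Psi> (T (f \<omega>))" if "\<omega> \<in> sphere 0 1" for \<omega>
    by (rule T_descent(1)[OF fW pathD(2)[OF f]]) (rule that)+
  fix \<omega> :: complex assume \<omega>: "\<omega> \<in> sphere 0 1"
  then have \<omega>': "- \<omega> \<in> sphere 0 1" by simp
  show "normalized (T (f \<omega>)) \<in> S_V s p \<Omega> V"
    by (rule normalized_S_V[OF T_W[OF fW[OF \<omega>]] pos[OF \<omega>]])
  have eq: "AE x in lebesgue. T (f (- \<omega>)) x = - T (f \<omega>) x"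
    by (rule T_odd[OF fW[OF \<omega>] fW[OF \<omega>'] pathD(3)[OF f \<omega>]])
  have \<Psi>eq: "\<Psi> (T (f (- \<omega>))) = \<Psi> (T (f \<omega>))"
    unfolding weighted_pow_eq[OF WD(4)[OF T_W[OF fW[OF \<omega>]]]] weighted_pow_eq[OF WD(4)[OF T_W[OF fW[OF \<omega>']]]]
  proof (rule integral_cong_AE)
    show "AE x in \<nu>. \<bar>T (f (- \<omega>)) x\<bar> powr p = \<bar>T (f \<omega>) x\<bar> powr p"
      using AE_\<nu>I[OF eq] by eventually_elim simp
  qed (use in_LpD(2)[OF W_in_Lp_\<nu>(1)[OF T_W[OF fW[OF \<omega>]]]] in_LpD(2)[OF W_in_Lp_\<nu>(1)[OF T_W[OF fW[OF \<omega>']]]] in auto)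
  show "AE x in lebesgue. normalized (T (f (- \<omega>))) x = - normalized (T (f \<omega>)) x"
    using eq unfolding normalized_def \<Psi>eq by eventually_elim simp
  fix X :: "nat \<Rightarrow> complex" assume X: "\<And>n. X n \<in> sphere 0 1" "X \<longlonglongrightarrow> \<omega>"
  show "(\<lambda>n. E (\<lambda>x. normalized (T (f (X n))) x - normalized (T (f \<omega>)) x)) \<longlonglongrightarrow> 0"
    by (rule normalized_continuous[OF T_W[OF fW[OF X(1)]] T_W[OF fW[OF \<omega>]]
        T_continuous[OF fW[OF X(1)] fW[OF \<omega>] path_tendsto[OF f \<omega> X]] pos[OF \<omega>]])
qed

text \<open>The path obtained from a nearly optimal one by inverse iteration is again nearly optimal, so
  at its highest point the energy almost does not decrease; in the limit equality holds in
  \<open>T_descent\<close>.\<close>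

theorem lam2_eigenfunction:
  assumes ne: "paths \<noteq> {}"
  shows "\<exists>u. eigenfunction s p \<Omega> V lam2 u"
proof -
  let ?e = "\<lambda>n. inverse (real (Suc n))"
  have "\<exists>u. u \<in> W \<and> \<Psi> u = 1 \<and> E u \<le> lam2 + ?e n \<and> lam2 - ?e n \<le> E (T u) / \<Psi> (T u)" for n
  proof -
    have e: "0 < ?e n" by simp
    obtain f where f: "f \<in> paths" and less: "path_max f < lam2 + ?e n"
      by (rule near_optimal_path[OF ne e]) (rule that)
    let ?g = "\<lambda>\<omega>. normalized (T (f \<omega>))"
    have g: "?g \<in> paths" by (rule iterated_path[OF f])
    have "lam2 - ?e n < path_max ?g" using lam2_le[OF g] e by linarith
    then obtain v where "v \<in> ?g ` sphere 0 1" and v: "lam2 - ?e n < E v"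
      by (subst (asm) less_cSUP_iff[OF _ path_bdd[OF g]]) auto
    then obtain \<omega> where \<omega>: "\<omega> \<in> sphere 0 1" and v_eq: "v = ?g \<omega>" by blast
    have fW: "f \<omega> \<in> W" and \<Psi>f: "\<Psi> (f \<omega>) = 1" using pathD[OF f \<omega>] by auto
    have "E v = E (T (f \<omega>)) / \<Psi> (T (f \<omega>))"
      unfolding v_eq by (rule normalized(2)[OF T_W[OF fW] T_descent(1)[OF fW \<Psi>f]])
    then show ?thesis
      using v less E_le_path_max[OF f \<omega>] fW \<Psi>f by (intro exI[of _ "f \<omega>"]) auto
  qed
  then obtain u where u: "\<And>n. u n \<in> W" and \<Psi>u: "\<And>n. \<Psi> (u n) = 1"
    and Eu: "\<And>n. E (u n) \<le> lam2 + ?e n" and ETu: "\<And>n. lam2 - ?e n \<le> E (T (u n)) / \<Psi> (T (u n))"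
    by metis
  have bd: "E (u n) \<le> lam2 + 1" for n
    using Eu[of n] inverse_le_1_iff[of "real (Suc n)"] by linarith
  obtain \<rho> :: "nat \<Rightarrow> nat" and v where \<rho>: "strict_mono \<rho>" and v: "v \<in> W"
    and lim: "AE x in lebesgue. (\<lambda>n. u (\<rho> n) x) \<longlonglongrightarrow> v x" and \<Psi>lim: "(\<lambda>n. \<Psi> (u (\<rho> n))) \<longlonglongrightarrow> \<Psi> v"
    by (rule compactness[where u = u, OF u bd]) (rule that)
  have e: "(\<lambda>n. ?e (\<rho> n)) \<longlonglongrightarrow> 0"
    using LIMSEQ_subseq_LIMSEQ[OF LIMSEQ_inverse_real_of_nat \<rho>] by (simp add: o_def)
  have \<Psi>v: "\<Psi> v = 1" using \<Psi>lim by (simp add: \<Psi>u LIMSEQ_const_iff)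
  have "(\<lambda>n. lam2 + ?e (\<rho> n)) \<longlonglongrightarrow> lam2 + 0" by (intro tendsto_intros e)
  then have Ev: "E v \<le> lam2 + 0" by (rule E_le_limit[OF u v lim Eu])
  have conv: "(\<lambda>n. E (\<lambda>x. T (u (\<rho> n)) x - T v x)) \<longlonglongrightarrow> 0"
    by (rule T_continuous_AE[OF u v lim \<Psi>lim])
  note T1 = T_descent[OF v \<Psi>v]
  have "(\<lambda>n. E (T (u (\<rho> n))) / \<Psi> (T (u (\<rho> n)))) \<longlonglongrightarrow> E (T v) / \<Psi> (T v)"
    using T1(1) by (intro tendsto_divide W_convergence_tendsto T_W u v conv) auto
  moreover have "(\<lambda>n. lam2 - ?e (\<rho> n)) \<longlonglongrightarrow> lam2 - 0" by (intro tendsto_intros e)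
  ultimately have "lam2 - 0 \<le> E (T v) / \<Psi> (T v)"
    by (intro LIMSEQ_le) (use ETu in auto)
  \<comment> \<open>The chain lam2 \<le> E (T v) / \<Psi> (T v) \<le> E v \<le> lam2 closes
    up.\<close>
  then have "E (T v) / \<Psi> (T v) = E v" "E v = lam2" using T1(2) Ev by linarith+
  with T1(3) show ?thesis by auto
qed

end

subsection \<open>The gap between the two eigenvalues\<close>

lemma AE_ex_borel_set:
  assumes A: "A \<in> sets (lebesgue :: 'a::euclidean_space measure)"
  obtains A' where "A' \<in> sets borel" "AE x in lebesgue. x \<in> A \<longleftrightarrow> x \<in> A'"
proof -
  have "(indicator A :: 'a \<Rightarrow> real) \<in> borel_measurable lebesgue" using A by measurable
  then obtain g where g [measurable]: "g \<in> borel_measurable borel" and eq: "AE x in lborel. indicator A x = (g x :: real)"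
    using completion_ex_borel_measurable_real[of "indicator A" lborel] by auto
  have "{x. g x = 1} \<in> sets borel" by measurable
  moreover have "AE x in lebesgue. x \<in> A \<longleftrightarrow> x \<in> {x. g x = 1}"
    using AE_completion[OF eq] by eventually_elim (auto simp: indicator_def split: if_splits)
  ultimately show thesis by (rule that)
qed

text \<open>A null rectangle has a null side. Borel versions of A and B allow the product measure of
  the rectangle to be computed.\<close>

lemma AE_pair_disjoint:
  fixes A B :: "'a::euclidean_space set"
  assumes A: "A \<in> sets lebesgue" and B: "B \<in> sets lebesgue"
    and null: "AE z in (lebesgue :: ('a \<times> 'a) measure). \<not> (fst z \<in> A \<and> snd z \<in> B)"
  shows "(AE x in lebesgue. x \<notin> A) \<or> (AE x in lebesgue. x \<notin> B)"
proof -
  obtain A' where A' [measurable]: "A' \<in> sets borel" and AA': "AE x in lebesgue. x \<in> A \<longleftrightarrow> x \<in> A'"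
    by (rule AE_ex_borel_set[OF A]) (rule that)
  obtain B' where B' [measurable]: "B' \<in> sets borel" and BB': "AE x in lebesgue. x \<in> B \<longleftrightarrow> x \<in> B'"
    by (rule AE_ex_borel_set[OF B]) (rule that)
  have "AE z in (lebesgue :: ('a \<times> 'a) measure). \<not> (fst z \<in> A' \<and> snd z \<in> B')"
    using null AE_lebesgue_fst_snd[OF AA'] AE_lebesgue_fst_snd[OF BB'] by eventually_elim auto
  then have "AE z in (lborel :: ('a \<times> 'a) measure). z \<notin> A' \<times> B'"
    by (simp add: AE_completion_iff mem_Times_iff)
  moreover have meas: "A' \<times> B' \<in> sets (lborel \<Otimes>\<^sub>M lborel)"
    by (intro pair_measureI) auto
  moreover from meas have "A' \<times> B' \<in> sets (lborel :: ('a \<times> 'a) measure)" by (simp only: lborel_prod)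
  ultimately have "emeasure (lborel \<Otimes>\<^sub>M lborel) (A' \<times> B') = 0"
    by (subst (asm) AE_iff_measurable[where N = "A' \<times> B'"]) (auto simp: lborel_prod)
  then have "emeasure lborel A' * emeasure lborel B' = 0"
    by (subst (asm) lborel.emeasure_pair_measure_Times) auto
  then consider "emeasure lborel A' = 0" | "emeasure lborel B' = 0" by auto
  then show ?thesis
  proof cases
    case 1
    then have "AE x in lborel. x \<notin> A'" by (intro AE_not_in) (auto simp: null_sets_def)
    from AE_completion[OF this] AA' have "AE x in lebesgue. x \<notin> A" by eventually_elim auto
    then show ?thesis ..
  next
    case 2
    then have "AE x in lborel. x \<notin> B'" by (intro AE_not_in) (auto simp: null_sets_def)
    from AE_completion[OF this] BB' have "AE x in lebesgue. x \<notin> B" by eventually_elim auto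
    then show ?thesis ..
  qed
qed

context weighted_problem
begin

text \<open>Membership in \<open>W\<close> from pointwise bounds on values and differences; it
  covers Lipschitz compositions as well as the quotients used with Picone's inequality.\<close>

lemma W_dominated:
  assumes u: "u \<in> W" and v: "v \<in> W" and w: "w \<in> borel_measurable lebesgue"
    and le: "\<And>x. \<bar>w x\<bar> \<le> C * (\<bar>u x\<bar> + \<bar>v x\<bar>)"
    and Dle: "\<And>x y. \<bar>w x - w y\<bar> \<le> C * (\<bar>u x - u y\<bar> + \<bar>v x - v y\<bar>)"
  shows "w \<in> W"
proof -
  have bound: "\<bar>c\<bar> powr p \<le> \<bar>C\<bar> powr p * (2 powr p * (\<bar>a\<bar> powr p + \<bar>b\<bar> powr p))"
    if "\<bar>c\<bar> \<le> C * (\<bar>a\<bar> + \<bar>b\<bar>)" for a b c :: real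
  proof -
    have "\<bar>c\<bar> powr p \<le> (\<bar>C\<bar> * (\<bar>a\<bar> + \<bar>b\<bar>)) powr p"
      using that p by (intro powr_mono2 order_trans[OF that] mult_right_mono) auto
    also have "\<dots> = \<bar>C\<bar> powr p * \<bar>\<bar>a\<bar> + \<bar>b\<bar>\<bar> powr p" by (simp add: powr_mult)
    also have "\<dots> \<le> \<bar>C\<bar> powr p * (2 powr p * (\<bar>a\<bar> powr p + \<bar>b\<bar> powr p))"
      using add_powr_le2[OF p(1), of "\<bar>a\<bar>" "\<bar>b\<bar>"] by (intro mult_left_mono) auto
    finally show ?thesis .
  qed
  show ?thesis
    unfolding W_iff
  proof (intro conjI)
    show "in_Lp p lebesgue w"
    proof (rule in_Lp_bound)
      show "integrable lebesgue (\<lambda>x. \<bar>C\<bar> powr p * (2 powr p * (\<bar>u x\<bar> powr p + \<bar>v x\<bar> powr p)))"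
        by (intro integrable_mult_right Bochner_Integration.integrable_add in_LpD(2)[OF WD(1)] u v)
      show "AE x in lebesgue. \<bar>w x\<bar> powr p \<le> \<bar>C\<bar> powr p * (2 powr p * (\<bar>u x\<bar> powr p + \<bar>v x\<bar> powr p))"
        by (intro AE_I2 bound le)
    qed (rule w)
    show "in_Lp p \<mu> (diff_fun w)"
    proof (rule in_Lp_bound)
      show "integrable \<mu> (\<lambda>z. \<bar>C\<bar> powr p * (2 powr p * (\<bar>diff_fun u z\<bar> powr p + \<bar>diff_fun v z\<bar> powr p)))"
        by (intro integrable_mult_right Bochner_Integration.integrable_add in_LpD(2)[OF WD(2)] u v)
      show "AE z in \<mu>. \<bar>diff_fun w z\<bar> powr p \<le> \<bar>C\<bar> powr p * (2 powr p * (\<bar>diff_fun u z\<bar> powr p + \<bar>diff_fun v z\<bar> powr p))"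
        unfolding diff_fun_def by (intro AE_I2 bound Dle)
    qed (rule diff_fun_measurable[OF w])
    show "AE x in lebesgue. x \<notin> \<Omega> \<longrightarrow> w x = 0"
      using WD(3)[OF u] WD(3)[OF v]
    proof eventually_elim
      case (elim x)
      then show ?case using le[of x] by auto
    qed
  qed
qed

lemma W_lipschitz_comp:
  assumes u: "u \<in> W" and g: "g \<in> borel_measurable borel" and lip: "\<And>a b. \<bar>g a - g b\<bar> \<le> \<bar>a - b\<bar>" and g0: "g 0 = (0::real)"
  shows "(\<lambda>x. g (u x)) \<in> W"
proof (rule W_dominated[OF u u, where C = 1])
  show "(\<lambda>x. g (u x)) \<in> borel_measurable lebesgue" by (rule measurable_compose[OF WD(4)[OF u] g])
  show "\<bar>g (u x)\<bar> \<le> 1 * (\<bar>u x\<bar> + \<bar>u x\<bar>)" for x using lip[of "u x" 0] g0 by simp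
  show "\<bar>g (u x) - g (u y)\<bar> \<le> 1 * (\<bar>u x - u y\<bar> + \<bar>u x - u y\<bar>)" for x y
    by (rule order_trans[OF lip]) simp
qed

lemma E_lipschitz_comp_le:
  assumes u: "u \<in> W" and g: "g \<in> borel_measurable borel" and lip: "\<And>a b. \<bar>g a - g b\<bar> \<le> \<bar>a - b\<bar>" and g0: "g 0 = (0::real)"
  shows "E (\<lambda>x. g (u x)) \<le> E u"
proof -
  have gu: "(\<lambda>x. g (u x)) \<in> W" by (rule W_lipschitz_comp[OF u g lip g0])
  have "(LINT z|\<mu>. \<bar>diff_fun (\<lambda>x. g (u x)) z\<bar> powr p) \<le> (LINT z|\<mu>. \<bar>diff_fun u z\<bar> powr p)"
    using p lip by (intro integral_mono in_LpD(2)[OF WD(2)] gu u powr_mono2) (auto simp: diff_fun_def)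
  moreover have "(LINT x|lebesgue. \<bar>g (u x)\<bar> powr p) \<le> (LINT x|lebesgue. \<bar>u x\<bar> powr p)"
    using p lip[of _ 0] g0 by (intro integral_mono in_LpD(2)[OF WD(1)] gu u powr_mono2) auto
  ultimately show ?thesis using WD(4)[OF u] WD(4)[OF gu] by (simp add: energy_eq)
qed

section \<open>Splitting into positive and negative parts\<close>

abbreviation "lam1 \<equiv> first_eigenvalue s p \<Omega> V"

lemma lam1_le:
  assumes v: "v \<in> W"
  shows "lam1 * \<Psi> v \<le> E v"
proof (cases "\<Psi> v > 0")
  case True
  have "\<not> (AE x in lebesgue. v x = 0)"
  proof
    assume "AE x in lebesgue. v x = 0"
    then have "E v = E (\<lambda>x. 0 * v x)" by (intro E_cong v W_cmult) auto
    then show False using E_pos[OF v True] E_cmult[OF v, of 0] p by simp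
  qed
  then have "lam1 \<le> E v / \<Psi> v"
    unfolding first_eigenvalue_def
  proof (intro cInf_lower)
    show "bdd_below {E u / \<Psi> u |u. u \<in> W \<and> \<not> (AE x in lebesgue. u x = 0) \<and> 0 < \<Psi> u}"
      by (rule bdd_belowI[of _ 0]) (auto intro!: divide_nonneg_nonneg E_nonneg)
  qed (use True v in auto)
  then show ?thesis using True by (simp add: pos_le_divide_eq)
next
  case False
  then have "\<Psi> v = 0" using \<Psi>_nonneg[OF v] by simp
  then show ?thesis using E_nonneg[OF v] by simp
qed

text \<open>The element w makes the set of quotients nonempty, so that its infimum is
  meaningful.\<close>

lemma le_lam1:
  assumes ex: "w \<in> W" "0 < \<Psi> w" and le: "\<And>v. v \<in> W \<Longrightarrow> c * \<Psi> v \<le> E v"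
  shows "c \<le> lam1"
  unfolding first_eigenvalue_def
proof (rule cInf_greatest)
  have "\<not> (AE x in lebesgue. w x = 0)"
  proof
    assume "AE x in lebesgue. w x = 0"
    then have "E w = E (\<lambda>x. 0 * w x)" by (intro E_cong ex W_cmult) auto
    then show False using E_pos[OF ex] E_cmult[OF ex(1), of 0] p by simp
  qed
  then show "{E u / \<Psi> u |u. u \<in> W \<and> \<not> (AE x in lebesgue. u x = 0) \<and> 0 < \<Psi> u} \<noteq> {}"
    using ex by blast
  show "c \<le> a" if "a \<in> {E u / \<Psi> u |u. u \<in> W \<and> \<not> (AE x in lebesgue. u x = 0) \<and> 0 < \<Psi> u}" for a
    using that le by (auto simp: pos_le_divide_eq)
qed

text \<open>The kernel is positive off the diagonal, and \<open>ne\<close> keeps the rectangle of A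
  and B away from the diagonal, so nullity passes from \<mu> to Lebesgue measure.\<close>

lemma pair_AE_zero_imp:
  assumes u: "u \<in> borel_measurable lebesgue" and A: "A \<in> sets lebesgue" and B: "B \<in> sets lebesgue"
    and ne: "\<And>x y. x \<in> A \<Longrightarrow> y \<in> B \<Longrightarrow> u x \<noteq> u y"
    and ae: "AE z in \<mu>. \<not> (fst z \<in> A \<and> snd z \<in> B)"
  shows "(AE x in lebesgue. x \<notin> A) \<or> (AE x in lebesgue. x \<notin> B)"
proof (rule AE_pair_disjoint[OF A B])
  have "AE z in (lebesgue :: ('a \<times> 'a) measure). 0 < ennreal (kernel s p z) \<longrightarrow> \<not> (fst z \<in> A \<and> snd z \<in> B)"
    using ae unfolding pair_measure_def by (subst (asm) AE_density) auto
  then show "AE z in (lebesgue :: ('a \<times> 'a) measure). \<not> (fst z \<in> A \<and> snd z \<in> B)"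
  proof eventually_elim
    case (elim z)
    show ?case
    proof
      assume *: "fst z \<in> A \<and> snd z \<in> B"
      then have "fst z \<noteq> snd z" using ne by metis
      then have "0 < kernel s p z" using K_pos by (simp add: kernel_def)
      then show False using elim * by simp
    qed
  qed
qed

text \<open>\<open>H u = \<Psi> u\<^sup>+ - \<Psi> u\<^sup>-\<close>, an odd functional.\<close>

definition H :: "('a \<Rightarrow> real) \<Rightarrow> real" where
  "H u = (LINT x|\<nu>. dpowr p (u x) * \<bar>u x\<bar>)"

lemma in_Lp_abs: "in_Lp p M f \<Longrightarrow> in_Lp p M (\<lambda>x. \<bar>f x\<bar>)"
  by (auto simp: in_Lp_def)

lemma H_tendsto:
  assumes u: "\<And>n::nat. u n \<in> W" and v: "v \<in> W" and lim: "AE x in lebesgue. (\<lambda>n. u n x) \<longlonglongrightarrow> v x"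
    and \<Psi>u: "(\<lambda>n. \<Psi> (u n)) \<longlonglongrightarrow> \<Psi> v"
  shows "(\<lambda>n. H (u n)) \<longlonglongrightarrow> H v"
proof -
  have n: "(\<lambda>n. LINT x|\<nu>. \<bar>u n x\<bar> powr p) \<longlonglongrightarrow> (LINT x|\<nu>. \<bar>v x\<bar> powr p)"
    using \<Psi>u by (simp add: weighted_pow_eq WD(4)[OF u] WD(4)[OF v])
  have l: "AE x in \<nu>. (\<lambda>n. \<bar>u n x\<bar>) \<longlonglongrightarrow> \<bar>v x\<bar>"
    using AE_\<nu>I[OF lim] by eventually_elim (rule tendsto_rabs)
  show ?thesis
    unfolding H_def
    by (rule dpowr_mult_integral_tendsto[OF p(1) W_in_Lp_\<nu>(1)[OF u] W_in_Lp_\<nu>(1)[OF v]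
        in_Lp_abs[OF W_in_Lp_\<nu>(1)[OF u]] in_Lp_abs[OF W_in_Lp_\<nu>(1)[OF v]] AE_\<nu>I[OF lim] l n])
       (simp add: n)
qed

text \<open>Intermediate value theorem on the half circle from 1 to -1, along which the odd
  functional \<open>H\<close> changes to its negative.\<close>

lemma path_H_zero:
  assumes f: "f \<in> paths"
  shows "\<exists>\<omega>\<in>sphere 0 1. H (f \<omega>) = 0"
proof -
  let ?h = "\<lambda>t. H (f (cis t))"
  have cis: "cis t \<in> sphere 0 1" for t by simp
  have "continuous_on {0..pi} ?h"
    unfolding continuous_on_sequentially
  proof (intro allI ballI impI)
    fix X :: "nat \<Rightarrow> real" and t assume "t \<in> {0..pi}" and "(\<forall>n. X n \<in> {0..pi}) \<and> X \<longlonglongrightarrow> t"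
    then have X: "X \<longlonglongrightarrow> t" by auto
    have cisX: "(\<lambda>n. cis (X n)) \<longlonglongrightarrow> cis t" by (intro tendsto_intros X)
    show "(?h \<circ> X) \<longlonglongrightarrow> ?h t"
      unfolding o_def
    \<comment> \<open>Convergence in energy gives almost everywhere convergence only along
      subsequences, which is enough here.\<close>
    proof (rule subsequence_principle)
      fix \<sigma> :: "nat \<Rightarrow> nat" assume \<sigma>: "strict_mono \<sigma>"
      have "(\<lambda>n. E (\<lambda>x. f (cis (X n)) x - f (cis t) x)) \<longlonglongrightarrow> 0"
        by (rule path_tendsto[OF f cis cis cisX])
      from LIMSEQ_subseq_LIMSEQ[OF this \<sigma>]
      have conv: "(\<lambda>n. E (\<lambda>x. f (cis (X (\<sigma> n))) x - f (cis t) x)) \<longlonglongrightarrow> 0" by (simp add: o_def)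
      have W1: "f (cis (X (\<sigma> n))) \<in> W" for n by (rule pathD(1)[OF f cis])
      have W2: "f (cis t) \<in> W" by (rule pathD(1)[OF f cis])
      obtain \<rho> :: "nat \<Rightarrow> nat" where \<rho>: "strict_mono \<rho>"
        and lim: "AE x in lebesgue. (\<lambda>n. f (cis (X (\<sigma> (\<rho> n)))) x) \<longlonglongrightarrow> f (cis t) x"
        and \<Psi>l: "(\<lambda>n. \<Psi> (f (cis (X (\<sigma> (\<rho> n)))))) \<longlonglongrightarrow> \<Psi> (f (cis t))"
        by (rule W_convergence_subseq[where u = "\<lambda>n. f (cis (X (\<sigma> n)))", OF W1 W2 conv]) (rule that)
      have "(\<lambda>n. H (f (cis (X (\<sigma> (\<rho> n)))))) \<longlonglongrightarrow> H (f (cis t))"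
        by (rule H_tendsto[OF W1 W2 lim \<Psi>l])
      with \<rho> show "\<exists>\<rho>. strict_mono (\<rho> :: nat \<Rightarrow> nat) \<and> (\<lambda>n. H (f (cis (X (\<sigma> (\<rho> n)))))) \<longlonglongrightarrow> H (f (cis t))"
        by (intro exI[of _ \<rho>]) simp
    qed
  qed
  moreover have odd: "?h pi = - ?h 0"
  proof -
    have 1: "(1 :: complex) \<in> sphere 0 1" and m1: "(- 1 :: complex) \<in> sphere 0 1" by simp_all
    have "H (f (- 1)) = (LINT x|\<nu>. - (dpowr p (f 1 x) * \<bar>f 1 x\<bar>))"
      unfolding H_def
    proof (rule integral_cong_AE)
      show "AE x in \<nu>. dpowr p (f (- 1) x) * \<bar>f (- 1) x\<bar> = - (dpowr p (f 1 x) * \<bar>f 1 x\<bar>)"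
        using AE_\<nu>I[OF pathD(3)[OF f 1]] by eventually_elim simp
    qed (use integrable_dpowr_mult[OF p(1) W_in_Lp_\<nu>(1)[OF pathD(1)[OF f m1]] in_Lp_abs[OF W_in_Lp_\<nu>(1)[OF pathD(1)[OF f m1]]]]
          integrable_dpowr_mult[OF p(1) W_in_Lp_\<nu>(1)[OF pathD(1)[OF f 1]] in_Lp_abs[OF W_in_Lp_\<nu>(1)[OF pathD(1)[OF f 1]]]] in auto)
    then show ?thesis by (simp add: H_def cis_pi)
  qed
  ultimately have "\<exists>t. ?h t = 0"
  proof (cases "?h 0 \<le> 0")
    case True
    then have "\<exists>t\<ge>0. t \<le> pi \<and> ?h t = 0"
      using \<open>continuous_on {0..pi} ?h\<close> odd by (intro IVT') auto
    then show ?thesis by blast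
  next
    case False
    then have "\<exists>t\<ge>0. t \<le> pi \<and> ?h t = 0"
      using \<open>continuous_on {0..pi} ?h\<close> odd by (intro IVT2') auto
    then show ?thesis by blast
  qed
  then show ?thesis using cis by blast
qed

text \<open>The loss is the interaction of the two parts over pairs with v x > 0 > v y, a set of
  positive measure; the L^p term is additive. Connectedness of \<Omega> does not enter because the
  interaction is nonlocal.\<close>

lemma pos_neg_parts_energy:
  assumes v: "v \<in> W" and pos: "\<not> (AE x in lebesgue. \<not> 0 < v x)" and neg: "\<not> (AE x in lebesgue. \<not> v x < 0)"
  shows "E (\<lambda>x. max (v x) 0) + E (\<lambda>x. max (- v x) 0) < E v"
proof -
  let ?P = "\<lambda>x. max (v x) 0" and ?N = "\<lambda>x. max (- v x) 0"
  have P: "?P \<in> W" by (rule W_lipschitz_comp[OF v, of "\<lambda>a. max a 0"]) auto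
  have N: "?N \<in> W" by (rule W_lipschitz_comp[OF v, of "\<lambda>a. max (- a) 0"]) auto
  note vm [measurable] = WD(4)[OF v]
  let ?g = "\<lambda>z. \<bar>diff_fun v z\<bar> powr p - (\<bar>diff_fun ?P z\<bar> powr p + \<bar>diff_fun ?N z\<bar> powr p)"
  have g0: "0 \<le> ?g z" for z
    using pos_neg_parts_powr(1)[OF p(1), of "v (fst z)" "v (snd z)"] by (simp add: diff_fun_def)
  have gi: "integrable \<mu> ?g"
    by (intro Bochner_Integration.integrable_diff Bochner_Integration.integrable_add in_LpD(2)[OF WD(2)] v P N)
  have "(LINT z|\<mu>. ?g z) \<noteq> 0"
  proof
    assume "(LINT z|\<mu>. ?g z) = 0"
    then have "AE z in \<mu>. ?g z = 0"
      using gi g0 by (subst (asm) integral_nonneg_eq_0_iff_AE) auto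
    then have ae: "AE z in \<mu>. \<not> (fst z \<in> {x. 0 < v x} \<and> snd z \<in> {x. v x < 0})"
    proof eventually_elim
      case (elim z)
      then show ?case
        using pos_neg_parts_powr(2)[OF p(1), of "v (fst z)" "v (snd z)"] by (auto simp: diff_fun_def)
    qed
    have m: "{x. 0 < v x} \<in> sets lebesgue" "{x. v x < 0} \<in> sets lebesgue"
      using vm by (auto intro!: borel_measurable_less[where M = lebesgue, simplified])
    from pair_AE_zero_imp[OF vm m _ ae] show False using pos neg by auto
  qed
  moreover have "0 \<le> (LINT z|\<mu>. ?g z)" using g0 by (intro integral_nonneg_AE) auto
  ultimately have "0 < (LINT z|\<mu>. ?g z)" by linarith
  also have "(LINT z|\<mu>. ?g z) = (LINT z|\<mu>. \<bar>diff_fun v z\<bar> powr p)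
      - ((LINT z|\<mu>. \<bar>diff_fun ?P z\<bar> powr p) + (LINT z|\<mu>. \<bar>diff_fun ?N z\<bar> powr p))"
    using in_LpD(2)[OF WD(2)[OF v]] in_LpD(2)[OF WD(2)[OF P]] in_LpD(2)[OF WD(2)[OF N]] by simp
  finally have A: "(LINT z|\<mu>. \<bar>diff_fun ?P z\<bar> powr p) + (LINT z|\<mu>. \<bar>diff_fun ?N z\<bar> powr p)
      < (LINT z|\<mu>. \<bar>diff_fun v z\<bar> powr p)" by simp
  have "(LINT x|lebesgue. \<bar>?P x\<bar> powr p) + (LINT x|lebesgue. \<bar>?N x\<bar> powr p)
      = (LINT x|lebesgue. \<bar>?P x\<bar> powr p + \<bar>?N x\<bar> powr p)"
    using in_LpD(2)[OF WD(1)[OF P]] in_LpD(2)[OF WD(1)[OF N]] by simp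
  also have "\<dots> = (LINT x|lebesgue. \<bar>v x\<bar> powr p)"
    using p by (intro Bochner_Integration.integral_cong) (auto simp: max_def)
  finally show ?thesis
    using A WD(4)[OF v] WD(4)[OF P] WD(4)[OF N] by (simp add: energy_eq)
qed

text \<open>For each single circle the strict inequality carries no uniform gap. The passage to a
  limit function, which still has equal weighted masses, turns it into a gap between the two
  levels.\<close>

lemma lam1_less_lam2:
  assumes ne: "paths \<noteq> {}"
  shows "lam1 < lam2"
proof (rule ccontr)
  assume "\<not> lam1 < lam2"
  then have le: "lam2 \<le> lam1" by simp
  let ?e = "\<lambda>n. inverse (real (Suc n))"
  have "\<exists>u. u \<in> W \<and> \<Psi> u = 1 \<and> H u = 0 \<and> E u \<le> lam2 + ?e n" for n
  proof -
    have e: "0 < ?e n" by simp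
    obtain f where f: "f \<in> paths" and less: "path_max f < lam2 + ?e n"
      by (rule near_optimal_path[OF ne e]) (rule that)
    obtain \<omega> where \<omega>: "\<omega> \<in> sphere 0 1" and H0: "H (f \<omega>) = 0"
      using path_H_zero[OF f] by blast
    show ?thesis
      using pathD[OF f \<omega>] H0 less E_le_path_max[OF f \<omega>] by (intro exI[of _ "f \<omega>"]) auto
  qed
  then obtain u where u: "\<And>n. u n \<in> W" and \<Psi>u: "\<And>n. \<Psi> (u n) = 1" and Hu: "\<And>n. H (u n) = 0"
    and Eu: "\<And>n. E (u n) \<le> lam2 + ?e n"
    by metis
  have bd: "E (u n) \<le> lam2 + 1" for n
    using Eu[of n] inverse_le_1_iff[of "real (Suc n)"] by linarith
  obtain \<rho> :: "nat \<Rightarrow> nat" and v where \<rho>: "strict_mono \<rho>" and v: "v \<in> W"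
    and lim: "AE x in lebesgue. (\<lambda>n. u (\<rho> n) x) \<longlonglongrightarrow> v x" and \<Psi>lim: "(\<lambda>n. \<Psi> (u (\<rho> n))) \<longlonglongrightarrow> \<Psi> v"
    by (rule compactness[where u = u, OF u bd]) (rule that)
  have e: "(\<lambda>n. ?e (\<rho> n)) \<longlonglongrightarrow> 0"
    using LIMSEQ_subseq_LIMSEQ[OF LIMSEQ_inverse_real_of_nat \<rho>] by (simp add: o_def)
  have \<Psi>v: "\<Psi> v = 1" using \<Psi>lim by (simp add: \<Psi>u LIMSEQ_const_iff)
  have Hv: "H v = 0" using H_tendsto[OF u v lim \<Psi>lim] by (simp add: Hu LIMSEQ_const_iff)
  have "(\<lambda>n. lam2 + ?e (\<rho> n)) \<longlonglongrightarrow> lam2 + 0" by (intro tendsto_intros e)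
  then have Ev: "E v \<le> lam2 + 0" by (rule E_le_limit[OF u v lim Eu])
  let ?P = "\<lambda>x. max (v x) 0" and ?N = "\<lambda>x. max (- v x) 0"
  have P: "?P \<in> W" by (rule W_lipschitz_comp[OF v, of "\<lambda>a. max a 0"]) auto
  have N: "?N \<in> W" by (rule W_lipschitz_comp[OF v, of "\<lambda>a. max (- a) 0"]) auto
  note int = in_LpD(2)[OF W_in_Lp_\<nu>(1)[OF P]] in_LpD(2)[OF W_in_Lp_\<nu>(1)[OF N]]
  have "\<Psi> v = (LINT x|\<nu>. \<bar>?P x\<bar> powr p + \<bar>?N x\<bar> powr p)"
    unfolding weighted_pow_eq[OF WD(4)[OF v]]
    using p by (intro Bochner_Integration.integral_cong) (auto simp: max_def)
  then have sum: "\<Psi> ?P + \<Psi> ?N = 1"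
    using int by (simp add: \<Psi>v weighted_pow_eq[OF WD(4)[OF P]] weighted_pow_eq[OF WD(4)[OF N]])
  have pw: "dpowr p a * \<bar>a\<bar> = \<bar>max a 0\<bar> powr p - \<bar>max (- a) 0\<bar> powr p" for a
    using dpowr_mult_self[of p a] p by (cases "0 \<le> a") (auto simp: max_def)
  have "H v = (LINT x|\<nu>. \<bar>?P x\<bar> powr p - \<bar>?N x\<bar> powr p)"
    unfolding H_def pw ..
  then have diff: "\<Psi> ?P - \<Psi> ?N = 0"
    using int by (simp add: Hv weighted_pow_eq[OF WD(4)[OF P]] weighted_pow_eq[OF WD(4)[OF N]])
  have half: "\<Psi> ?P = 1 / 2" "\<Psi> ?N = 1 / 2" using sum diff by linarith+
  have zero: "\<Psi> w = 0" if "AE x in lebesgue. w x = 0" and w: "w \<in> W" for w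
  proof -
    have "\<Psi> w = (LINT x|\<nu>. 0)"
      unfolding weighted_pow_eq[OF WD(4)[OF w]]
    proof (rule integral_cong_AE)
      show "AE x in \<nu>. \<bar>w x\<bar> powr p = 0" using AE_\<nu>I[OF that(1)] by eventually_elim (use p in simp)
    qed (use in_LpD(2)[OF W_in_Lp_\<nu>(1)[OF w]] in auto)
    then show ?thesis by simp
  qed
  have pos: "\<not> (AE x in lebesgue. \<not> 0 < v x)"
  proof
    assume "AE x in lebesgue. \<not> 0 < v x"
    then have "AE x in lebesgue. ?P x = 0" by eventually_elim auto
    from zero[OF this P] half show False by simp
  qed
  have neg: "\<not> (AE x in lebesgue. \<not> v x < 0)"
  proof
    assume "AE x in lebesgue. \<not> v x < 0"
    then have "AE x in lebesgue. ?N x = 0" by eventually_elim auto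
    from zero[OF this N] half show False by simp
  qed
  \<comment> \<open>Each part has weighted mass 1 / 2, so the left-hand side is lam1.\<close>
  have "lam1 * \<Psi> ?P + lam1 * \<Psi> ?N \<le> E ?P + E ?N"
    by (intro add_mono lam1_le P N)
  also have "\<dots> < E v" by (rule pos_neg_parts_energy[OF v pos neg])
  finally have "lam1 < E v" by (simp add: half)
  then show False using Ev le by linarith
qed

end

subsection \<open>Eigenfunctions of constant sign\<close>

lemma powr_at_top:
  assumes q: "0 < (q::real)"
  shows "filterlim (\<lambda>x. x powr q) at_top at_top"
proof -
  have "filterlim (\<lambda>x::real. exp (q * ln x)) at_top at_top"
    by (intro filterlim_compose[OF exp_at_top] filterlim_tendsto_pos_mult_at_top[OF tendsto_const q ln_at_top])
  moreover have "\<forall>\<^sub>F x in at_top. exp (q * ln x) = x powr q"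
    using eventually_gt_at_top[of "0::real"] by eventually_elim (simp add: powr_def)
  ultimately show ?thesis
    by (simp cong: filterlim_cong)
qed

text \<open>A mean value estimate obtained from the tangent inequality, used in both
  directions.\<close>

lemma powr_diff_le:
  fixes a b M p :: real
  assumes p: "1 < p" and ab: "0 \<le> a" "a \<le> M" "0 \<le> b" "b \<le> M"
  shows "\<bar>a powr p - b powr p\<bar> \<le> p * M powr (p - 1) * \<bar>a - b\<bar>"
proof -
  have main: "a powr p - b powr p \<le> p * M powr (p - 1) * \<bar>a - b\<bar>"
    if ab: "0 \<le> a" "a \<le> M" "0 \<le> b" for a b
  proof -
    have "a powr p - b powr p \<le> p * (a powr (p - 1) * (a - b))"
      using tangent_le[OF p, of a b] ab by (simp add: dpowr_eq_powr algebra_simps)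
    also have "\<dots> \<le> p * (M powr (p - 1) * \<bar>a - b\<bar>)"
      using p ab by (intro mult_left_mono order_trans[OF mult_left_mono mult_right_mono] powr_mono2) auto
    finally show ?thesis by (simp only: mult.assoc)
  qed
  show ?thesis
    using main[OF ab(1-3)] main[OF ab(3,4,1)] by (simp add: abs_le_iff abs_minus_commute)
qed

text \<open>With t = y / x \<le> 1 the tangent at 1 gives 1 + p (t - 1) \<le> t^p \<le> t^(p-1). The
  resulting constant p is slightly larger than the p - 1 of the derivative.\<close>

lemma inverse_powr_diff_le:
  fixes x y e p :: real
  assumes p: "1 < p" and e: "0 < e" and xy: "e \<le> x" "e \<le> y"
  shows "\<bar>1 / x powr (p - 1) - 1 / y powr (p - 1)\<bar> \<le> p / e powr p * \<bar>x - y\<bar>"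
proof -
  have main: "1 / y powr (p - 1) - 1 / x powr (p - 1) \<le> p / e powr p * (x - y)"
    and mono: "1 / x powr (p - 1) \<le> 1 / y powr (p - 1)"
    if "e \<le> y" "y \<le> x" for x y
  proof -
    have pos: "0 < y" "0 < x" using that e by auto
    define t where "t = y / x"
    have t: "0 < t" "t \<le> 1" using that pos by (auto simp: t_def)
    have "t powr p \<le> t powr (p - 1)" using t by (intro powr_mono') auto
    moreover have "1 + p * (t - 1) \<le> t powr p"
      using tangent_le[OF p, of 1 t] t by (simp add: dpowr_def)
    ultimately have "1 - t powr (p - 1) \<le> p * (1 - t)" by (simp add: algebra_simps)
    also have "\<dots> = p * (x - y) / x" using pos by (simp add: t_def field_simps)
    also have "\<dots> \<le> p * (x - y) / e"
      using that pos e p by (intro divide_left_mono) auto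
    finally have le: "1 - t powr (p - 1) \<le> p * (x - y) / e" .
    have "1 / y powr (p - 1) - 1 / x powr (p - 1) = 1 / y powr (p - 1) * (1 - t powr (p - 1))"
      using pos by (simp add: t_def powr_divide field_simps)
    also have "\<dots> \<le> 1 / e powr (p - 1) * (p * (x - y) / e)"
      using le that e p pos t by (intro mult_mono divide_left_mono powr_mono2) (auto intro: powr_le1)
    also have "\<dots> = p / (e powr (p - 1) * e) * (x - y)" by simp
    also have "e powr (p - 1) * e = e powr p" using e powr_mult_base[of e "p - 1"] by (simp add: mult.commute)
    finally show "1 / y powr (p - 1) - 1 / x powr (p - 1) \<le> p / e powr p * (x - y)" .
    show "1 / x powr (p - 1) \<le> 1 / y powr (p - 1)"
      using that pos p by (intro divide_left_mono powr_mono2) auto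
  qed
  show ?thesis
  proof (cases "y \<le> x")
    case True
    then show ?thesis using main[OF xy(2) True] mono[OF xy(2) True] by (simp add: abs_if)
  next
    case False
    then have "x \<le> y" by simp
    then show ?thesis using main[OF xy(1) \<open>x \<le> y\<close>] mono[OF xy(1) \<open>x \<le> y\<close>] by (simp add: abs_if)
  qed
qed

context weighted_problem
begin

lemma dE_cong:
  assumes u: "u \<in> W" and u': "u' \<in> W" and eq: "AE x in lebesgue. u x = u' x" and v: "v \<in> W"
  shows "dE u v = dE u' v"
proof -
  have "(LINT z|\<mu>. dpowr p (diff_fun u z) * diff_fun v z) = (LINT z|\<mu>. dpowr p (diff_fun u' z) * diff_fun v z)"
  proof (rule integral_cong_AE)
    show "AE z in \<mu>. dpowr p (diff_fun u z) * diff_fun v z = dpowr p (diff_fun u' z) * diff_fun v z"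
      using AE_pair_measureI[OF eq, of s p] by eventually_elim (simp add: diff_fun_def)
  qed (use integrable_dpowr_mult[OF p(1) WD(2)[OF u] WD(2)[OF v]] integrable_dpowr_mult[OF p(1) WD(2)[OF u'] WD(2)[OF v]] in auto)
  moreover have "(LINT x|lebesgue. dpowr p (u x) * v x) = (LINT x|lebesgue. dpowr p (u' x) * v x)"
  proof (rule integral_cong_AE)
    show "AE x in lebesgue. dpowr p (u x) * v x = dpowr p (u' x) * v x"
      using eq by eventually_elim simp
  qed (use integrable_dpowr_mult[OF p(1) WD(1)[OF u] WD(1)[OF v]] integrable_dpowr_mult[OF p(1) WD(1)[OF u'] WD(1)[OF v]] in auto)
  ultimately show ?thesis by (simp add: dE_def)
qed

lemma d\<Psi>_cong:
  assumes u: "u \<in> W" and u': "u' \<in> W" and eq: "AE x in lebesgue. u x = u' x" and v: "v \<in> W"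
  shows "d\<Psi> u v = d\<Psi> u' v"
  unfolding d\<Psi>_def
proof (rule integral_cong_AE)
  show "AE x in \<nu>. dpowr p (u x) * v x = dpowr p (u' x) * v x"
    using AE_\<nu>I[OF eq] by eventually_elim simp
qed (use d\<Psi>_integrable[OF u v] d\<Psi>_integrable[OF u' v] in auto)

lemma eigenfunction_cong:
  assumes u: "eigenfunction s p \<Omega> V c u" and u': "u' \<in> W" and eq: "AE x in lebesgue. u x = u' x"
  shows "eigenfunction s p \<Omega> V c u'"
proof -
  have uW: "u \<in> W" using u by (simp add: eigenfunction_iff)
  have "\<not> (AE x in lebesgue. u' x = 0)"
  proof
    assume "AE x in lebesgue. u' x = 0"
    with eq have "AE x in lebesgue. u x = 0" by eventually_elim simp
    then show False using u by (simp add: eigenfunction_iff)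
  qed
  then show ?thesis
    using u u' dE_cong[OF uW u' eq] d\<Psi>_cong[OF uW u' eq] by (simp add: eigenfunction_iff)
qed

lemma eigenfunction_uminus:
  assumes u: "eigenfunction s p \<Omega> V c u"
  shows "eigenfunction s p \<Omega> V c (\<lambda>x. - u x)"
proof -
  have uW: "u \<in> W" using u by (simp add: eigenfunction_iff)
  have "(\<lambda>x. - u x) \<in> W" using W_cmult[OF uW, of "-1"] by simp
  moreover have "dE (\<lambda>x. - u x) v = - dE u v" for v
  proof -
    have "diff_fun (\<lambda>x. - u x) z = - diff_fun u z" for z by (simp add: diff_fun_def)
    then show ?thesis by (simp add: dE_def)
  qed
  moreover have "d\<Psi> (\<lambda>x. - u x) v = - d\<Psi> u v" for v by (simp add: d\<Psi>_def)
  ultimately show ?thesis using u by (simp add: eigenfunction_iff)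
qed

text \<open>The test function v^p / u^(p-1) of Picone's identity, with u shifted by e so that the
  denominator stays away from 0.\<close>

definition Picone_test :: "real \<Rightarrow> ('a \<Rightarrow> real) \<Rightarrow> ('a \<Rightarrow> real) \<Rightarrow> 'a \<Rightarrow> real" where
  "Picone_test e u v x = v x powr p / (u x + e) powr (p - 1)"

text \<open>The quotient is Lipschitz in the pair (u, v) as long as v stays in a bounded range and u
  + e \<ge> e.\<close>

lemma Picone_test_W:
  assumes u: "u \<in> W" "\<And>x. 0 \<le> u x" and v: "v \<in> W" "\<And>x. 0 \<le> v x" "\<And>x. v x \<le> M" and e: "0 < e"
  shows "Picone_test e u v \<in> W"
proof -
  \<comment> \<open>The sum of the Lipschitz constants in v and in u.\<close>
  define C where "C = p * M powr (p - 1) / e powr (p - 1) + M powr p * (p / e powr p)"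
  have M: "0 \<le> M" using v(2,3) by (rule order_trans)
  have C1: "p * M powr (p - 1) / e powr (p - 1) \<le> C" and C2: "M powr p * (p / e powr p) \<le> C"
    using p by (auto simp: C_def)
  have inv_le: "1 / (u x + e) powr (p - 1) \<le> 1 / e powr (p - 1)" for x
    using u(2)[of x] e p by (intro divide_left_mono powr_mono2) auto
  note [measurable] = WD(4)[OF u(1)] WD(4)[OF v(1)]
  show ?thesis
  proof (rule W_dominated[OF u(1) v(1), where C = C])
    show "Picone_test e u v \<in> borel_measurable lebesgue" unfolding Picone_test_def by measurable
    show "\<bar>Picone_test e u v x\<bar> \<le> C * (\<bar>u x\<bar> + \<bar>v x\<bar>)" for x
    proof -
      have "v x powr p \<le> p * M powr (p - 1) * v x"
        using powr_diff_le[OF p(1) v(2) v(3) order_refl M, of x] v(2)[of x] p by simp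
      then have "v x powr p * (1 / (u x + e) powr (p - 1)) \<le> (p * M powr (p - 1) * v x) * (1 / e powr (p - 1))"
        using v(2)[of x] p by (intro mult_mono inv_le) auto
      also have "\<dots> = (p * M powr (p - 1) / e powr (p - 1)) * v x" by simp
      also have "\<dots> \<le> C * (u x + v x)"
        using u(2)[of x] v(2)[of x] C1 p by (intro mult_mono) (auto intro: order_trans[OF _ C1])
      finally show ?thesis using u(2)[of x] v(2)[of x] by (simp add: Picone_test_def)
    qed
    show "\<bar>Picone_test e u v x - Picone_test e u v y\<bar> \<le> C * (\<bar>u x - u y\<bar> + \<bar>v x - v y\<bar>)" for x y
    proof -
      let ?i = "\<lambda>x. 1 / (u x + e) powr (p - 1)"
      \<comment> \<open>The discrete product rule separates the increment of v^p from that of the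
        denominator.\<close>
      have eq: "Picone_test e u v x - Picone_test e u v y
          = (v x powr p - v y powr p) * ?i x + v y powr p * (?i x - ?i y)"
        by (simp add: Picone_test_def algebra_simps diff_divide_distrib)
      have 1: "\<bar>(v x powr p - v y powr p) * ?i x\<bar> \<le> C * \<bar>v x - v y\<bar>"
      proof -
        have "\<bar>v x powr p - v y powr p\<bar> * ?i x \<le> (p * M powr (p - 1) * \<bar>v x - v y\<bar>) * (1 / e powr (p - 1))"
          using p by (intro mult_mono powr_diff_le v inv_le) auto
        also have "\<dots> = (p * M powr (p - 1) / e powr (p - 1)) * \<bar>v x - v y\<bar>" by simp
        also have "\<dots> \<le> C * \<bar>v x - v y\<bar>" by (intro mult_right_mono C1) auto
        finally show ?thesis by (simp add: abs_mult)
      qed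
      have 2: "\<bar>v y powr p * (?i x - ?i y)\<bar> \<le> C * \<bar>u x - u y\<bar>"
      proof -
        have "v y powr p * \<bar>?i x - ?i y\<bar> \<le> M powr p * (p / e powr p * \<bar>(u x + e) - (u y + e)\<bar>)"
          using p e u(2) v(2,3) M by (intro mult_mono inverse_powr_diff_le powr_mono2) auto
        also have "\<dots> = (M powr p * (p / e powr p)) * \<bar>u x - u y\<bar>" by simp
        also have "\<dots> \<le> C * \<bar>u x - u y\<bar>" by (intro mult_right_mono C2) auto
        finally show ?thesis by (simp add: abs_mult)
      qed
      show ?thesis unfolding eq using abs_triangle_ineq[of "(v x powr p - v y powr p) * ?i x" "v y powr p * (?i x - ?i y)"] 1 2
        by (simp only: distrib_left)
    qed
  qed
qed

text \<open>The gap in Picone's inequality at a pair of points. The shift by e drops out of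
  differences of u, so the gap for u + e can be written with u.\<close>

definition Picone_deficit :: "real \<Rightarrow> ('a \<Rightarrow> real) \<Rightarrow> ('a \<Rightarrow> real) \<Rightarrow> 'a \<times> 'a \<Rightarrow> real" where
  "Picone_deficit e u v z = \<bar>diff_fun v z\<bar> powr p - dpowr p (diff_fun u z) * diff_fun (Picone_test e u v) z"

lemma Picone_deficit_nonneg:
  assumes u: "\<And>x. 0 \<le> u x" and v: "\<And>x. 0 \<le> v x" and e: "0 < e"
  shows "0 \<le> Picone_deficit e u v z"
proof -
  have "dpowr p ((u (fst z) + e) - (u (snd z) + e))
      * (v (fst z) powr p / (u (fst z) + e) powr (p - 1) - v (snd z) powr p / (u (snd z) + e) powr (p - 1))
      \<le> \<bar>v (fst z) - v (snd z)\<bar> powr p"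
    by (rule Picone[OF p(1)]) (use u v e in \<open>auto intro: add_nonneg_pos\<close>)
  then show ?thesis by (simp add: Picone_deficit_def Picone_test_def diff_fun_def)
qed

text \<open>The equation is tested with \<open>Picone_test\<close>. In the zeroth order term u^(p-1)
  / (u + e)^(p-1) \<le> 1. The integral of the deficit is retained because its boundedness in e
  drives the strong maximum principle.\<close>

lemma Picone_inequality:
  assumes eig: "eigenfunction s p \<Omega> V c u" and u: "\<And>x. 0 \<le> u x"
    and v: "v \<in> W" "\<And>x. 0 \<le> v x" "\<And>x. v x \<le> M" and e: "0 < e"
  shows "integrable \<mu> (Picone_deficit e u v)"
    and "(LINT z|\<mu>. Picone_deficit e u v z) + c * d\<Psi> u (Picone_test e u v) \<le> E v"
proof -
  have uW: "u \<in> W" and EL: "\<And>v. v \<in> W \<Longrightarrow> dE u v = c * d\<Psi> u v"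
    using eig by (auto simp: eigenfunction_iff)
  let ?w = "Picone_test e u v"
  have w: "?w \<in> W" by (rule Picone_test_W[OF uW u v e])
  have i1: "integrable \<mu> (\<lambda>z. dpowr p (diff_fun u z) * diff_fun ?w z)"
    by (intro integrable_dpowr_mult p WD uW w)
  have i2: "integrable lebesgue (\<lambda>x. dpowr p (u x) * ?w x)"
    by (intro integrable_dpowr_mult p WD uW w)
  show "integrable \<mu> (Picone_deficit e u v)"
    unfolding Picone_deficit_def using i1 in_LpD(2)[OF WD(2)[OF v(1)]] by (intro Bochner_Integration.integrable_diff)
  have "(LINT z|\<mu>. Picone_deficit e u v z)
      = (LINT z|\<mu>. \<bar>diff_fun v z\<bar> powr p) - (LINT z|\<mu>. dpowr p (diff_fun u z) * diff_fun ?w z)"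
    unfolding Picone_deficit_def using i1 in_LpD(2)[OF WD(2)[OF v(1)]] by (rule Bochner_Integration.integral_diff[rotated])
  moreover have "(LINT x|lebesgue. dpowr p (u x) * ?w x) \<le> (LINT x|lebesgue. \<bar>v x\<bar> powr p)"
  proof (rule integral_mono[OF i2 in_LpD(2)[OF WD(1)[OF v(1)]]])
    fix x
    have "dpowr p (u x) * ?w x = v x powr p * (u x powr (p - 1) / (u x + e) powr (p - 1))"
      using u by (simp add: dpowr_eq_powr Picone_test_def)
    also have "\<dots> \<le> v x powr p * 1"
      using u[of x] e p by (intro mult_left_mono) (auto simp: divide_le_eq_1 intro!: powr_mono2)
    finally show "dpowr p (u x) * ?w x \<le> \<bar>v x\<bar> powr p" using v(2)[of x] by simp
  qed
  moreover have "dE u ?w = c * d\<Psi> u ?w" by (rule EL[OF w])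
  ultimately show "(LINT z|\<mu>. Picone_deficit e u v z) + c * d\<Psi> u ?w \<le> E v"
    using WD(4)[OF v(1)] unfolding dE_def by (simp add: energy_eq)
qed

lemma d\<Psi>_Picone_test_nonneg:
  assumes u: "\<And>x. 0 \<le> u x" and v: "\<And>x. 0 \<le> v x"
  shows "0 \<le> d\<Psi> u (Picone_test e u v)"
  unfolding d\<Psi>_def using u v by (intro integral_nonneg_AE) (auto simp: dpowr_nonneg Picone_test_def)

text \<open>If \<open>u\<close> vanished on a set of positive measure, the Picone deficit would blow up as \<open>e \<rightarrow> 0\<close> on
  the pairs \<open>(x, y)\<close> with \<open>u x > 0 = u y\<close>.\<close>

lemma strong_maximum_principle:
  assumes eig: "eigenfunction s p \<Omega> V c u" and c: "0 \<le> c" and u: "\<And>x. 0 \<le> u x"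
    and v: "v \<in> W" "\<And>x. 0 \<le> v x" "\<And>x. v x \<le> M" and vpos: "\<And>x. x \<in> \<Omega> \<Longrightarrow> 0 < v x"
  shows "AE x in lebesgue. x \<in> \<Omega> \<longrightarrow> 0 < u x"
proof -
  have uW: "u \<in> W" and u0: "\<not> (AE x in lebesgue. u x = 0)"
    using eig by (auto simp: eigenfunction_iff)
  note [measurable] = WD(4)[OF uW] WD(4)[OF v(1)]
  let ?e = "\<lambda>n. inverse (real (Suc n))"
  let ?D = "\<lambda>n z. Picone_deficit (?e n) u v z"
  have D: "integrable \<mu> (?D n)" "(LINT z|\<mu>. ?D n z) \<le> E v" for n
  proof -
    show "integrable \<mu> (?D n)" by (rule Picone_inequality(1)[OF eig u v]) simp
    have "(LINT z|\<mu>. ?D n z) + c * d\<Psi> u (Picone_test (?e n) u v) \<le> E v"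
      by (rule Picone_inequality(2)[OF eig u v]) simp
    moreover have "0 \<le> c * d\<Psi> u (Picone_test (?e n) u v)"
      by (intro mult_nonneg_nonneg c d\<Psi>_Picone_test_nonneg u v)
    ultimately show "(LINT z|\<mu>. ?D n z) \<le> E v" by linarith
  qed
  have [measurable]: "?D n \<in> borel_measurable \<mu>" for n using D(1) by auto
  have D0: "0 \<le> ?D n z" for n z by (rule Picone_deficit_nonneg[OF u v(2)]) simp
  \<comment> \<open>The deficits are bounded in L1 uniformly in e, so by Fatou their liminf is
    finite almost everywhere.\<close>
  have "(\<integral>\<^sup>+z. liminf (\<lambda>n. ennreal (?D n z)) \<partial>\<mu>) \<le> liminf (\<lambda>n. \<integral>\<^sup>+z. ennreal (?D n z) \<partial>\<mu>)"
    by (rule nn_integral_liminf) measurable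
  also have "\<dots> \<le> ennreal (E v)"
    using D D0 by (intro Liminf_le always_eventually allI) (auto simp: nn_integral_eq_integral intro!: ennreal_leI)
  finally have "(\<integral>\<^sup>+z. liminf (\<lambda>n. ennreal (?D n z)) \<partial>\<mu>) \<noteq> \<infinity>"
    by (auto simp: top_unique)
  then have fin: "AE z in \<mu>. liminf (\<lambda>n. ennreal (?D n z)) \<noteq> \<infinity>"
    by (intro nn_integral_PInf_AE) measurable
  have blowup: "liminf (\<lambda>n. ennreal (?D n (x, y))) = \<infinity>" if xy: "0 < u x" "u y = 0" "0 < v y" for x y
  proof -
    define k where "k = u x powr (p - 1) * v y powr p"
    have k: "0 < k" using xy by (simp add: k_def)
    have le: "k * real (Suc n) powr (p - 1) - v x powr p \<le> ?D n (x, y)" for n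
    proof -
      have "?D n (x, y) = \<bar>v x - v y\<bar> powr p - u x powr (p - 1) * (v x powr p / (u x + ?e n) powr (p - 1) - v y powr p / ?e n powr (p - 1))"
        using xy by (simp add: Picone_deficit_def diff_fun_def Picone_test_def dpowr_eq_powr)
      moreover have "v y powr p / ?e n powr (p - 1) = v y powr p * real (Suc n) powr (p - 1)"
        by (simp add: inverse_eq_divide powr_divide)
      moreover have "u x powr (p - 1) * (v x powr p / (u x + ?e n) powr (p - 1)) \<le> v x powr p"
      proof -
        have "u x powr (p - 1) \<le> (u x + ?e n) powr (p - 1)" using xy p by (intro powr_mono2) auto
        then have "u x powr (p - 1) / (u x + ?e n) powr (p - 1) \<le> 1" using xy by (simp add: divide_le_eq_1)
        then have "v x powr p * (u x powr (p - 1) / (u x + ?e n) powr (p - 1)) \<le> v x powr p * 1"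
          by (intro mult_left_mono) auto
        then show ?thesis by (simp add: mult.commute)
      qed
      ultimately show ?thesis
        using powr_ge_zero[of "\<bar>v x - v y\<bar>" p] by (simp only: k_def right_diff_distrib mult.assoc)
    qed
    have "filterlim (\<lambda>n. k * real (Suc n) powr (p - 1) - v x powr p) at_top sequentially"
    proof -
      have "filterlim (\<lambda>n. real (Suc n) powr (p - 1)) at_top sequentially"
        using p by (intro filterlim_compose[OF powr_at_top] filterlim_compose[OF filterlim_real_sequentially filterlim_Suc]) auto
      then have "filterlim (\<lambda>n. k * real (Suc n) powr (p - 1)) at_top sequentially"
        by (intro filterlim_tendsto_pos_mult_at_top[OF tendsto_const k])
      then have "filterlim (\<lambda>n. - (v x powr p) + k * real (Suc n) powr (p - 1)) at_top sequentially"
        by (intro filterlim_tendsto_add_at_top[OF tendsto_const])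
      then show ?thesis by simp
    qed
    then have lim: "filterlim (\<lambda>n. ?D n (x, y)) at_top sequentially"
      by (rule filterlim_at_top_mono) (use le in auto)
    have "(\<lambda>n. ennreal (?D n (x, y))) \<longlonglongrightarrow> \<infinity>"
      using lim by (simp add: ennreal_tendsto_top_eq_at_top)
    then show ?thesis by (simp add: lim_imp_Liminf)
  qed
  \<comment> \<open>Since v is positive on \<Omega>, the set ?B contains all zeros of u in
    \<Omega>.\<close>
  let ?A = "{x. 0 < u x}" and ?B = "{x. u x = 0 \<and> 0 < v x}"
  have "AE z in \<mu>. \<not> (fst z \<in> ?A \<and> snd z \<in> ?B)"
    using fin
  proof eventually_elim
    case (elim z)
    then show ?case using blowup[of "fst z" "snd z"] by auto
  qed
  moreover have "?A \<in> sets lebesgue" "?B \<in> sets lebesgue"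
  proof -
    have "{x \<in> space lebesgue. 0 < u x} \<in> sets lebesgue" "{x \<in> space lebesgue. u x = 0 \<and> 0 < v x} \<in> sets lebesgue"
      by measurable
    then show "?A \<in> sets lebesgue" "?B \<in> sets lebesgue" by simp_all
  qed
  ultimately have "(AE x in lebesgue. x \<notin> ?A) \<or> (AE x in lebesgue. x \<notin> ?B)"
    by (intro pair_AE_zero_imp[OF WD(4)[OF uW]]) auto
  moreover have "\<not> (AE x in lebesgue. x \<notin> ?A)"
  proof
    assume "AE x in lebesgue. x \<notin> ?A"
    then have "AE x in lebesgue. u x = 0" by eventually_elim (use u in \<open>auto simp: not_less intro: antisym\<close>)
    then show False using u0 by simp
  qed
  ultimately have "AE x in lebesgue. x \<notin> ?B" by blast
  then show ?thesis
  proof eventually_elim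
    case (elim x)
    then show ?case using u[of x] vpos[of x] by (auto simp: less_le)
  qed
qed

text \<open>As e tends to 0 the integrand v^p u^(p-1) / (u + e)^(p-1) tends to v^p wherever u > 0,
  with v^p as majorant; positivity of u in \<Omega> is what makes the limit equal to \<Psi>
  v.\<close>

lemma positive_eigenvalue_le_bounded:
  assumes eig: "eigenfunction s p \<Omega> V c u" and c: "0 \<le> c" and u: "\<And>x. 0 \<le> u x"
    and upos: "AE x in lebesgue. x \<in> \<Omega> \<longrightarrow> 0 < u x"
    and v: "v \<in> W" "\<And>x. 0 \<le> v x" "\<And>x. v x \<le> M"
  shows "c * \<Psi> v \<le> E v"
proof -
  have uW: "u \<in> W" using eig by (auto simp: eigenfunction_iff)
  let ?e = "\<lambda>n. inverse (real (Suc n))"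
  let ?w = "\<lambda>n. Picone_test (?e n) u v"
  have w: "?w n \<in> W" for n by (rule Picone_test_W[OF uW u v]) simp
  have "(\<lambda>n. d\<Psi> u (?w n)) \<longlonglongrightarrow> (LINT x|\<nu>. \<bar>v x\<bar> powr p)"
    unfolding d\<Psi>_def
  proof (rule integral_dominated_convergence[where w = "\<lambda>x. \<bar>v x\<bar> powr p"])
    show "integrable \<nu> (\<lambda>x. \<bar>v x\<bar> powr p)" by (rule in_LpD(2)[OF W_in_Lp_\<nu>(1)[OF v(1)]])
    then show "(\<lambda>x. \<bar>v x\<bar> powr p) \<in> borel_measurable \<nu>" by (rule borel_measurable_integrable)
    show "(\<lambda>x. dpowr p (u x) * ?w n x) \<in> borel_measurable \<nu>" for n
      using d\<Psi>_integrable[OF uW w] by (rule borel_measurable_integrable)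
    have eq: "dpowr p (u x) * ?w n x = v x powr p * (u x powr (p - 1) / (u x + ?e n) powr (p - 1))" for n x
      using u by (simp add: dpowr_eq_powr Picone_test_def)
    show "AE x in \<nu>. norm (dpowr p (u x) * ?w n x) \<le> \<bar>v x\<bar> powr p" for n
    proof (rule AE_I2)
      fix x
      have "v x powr p * (u x powr (p - 1) / (u x + ?e n) powr (p - 1)) \<le> v x powr p * 1"
        using u[of x] p by (intro mult_left_mono) (auto simp: divide_le_eq_1 intro!: powr_mono2)
      then show "norm (dpowr p (u x) * ?w n x) \<le> \<bar>v x\<bar> powr p"
        unfolding eq using v(2)[of x] by (simp add: abs_mult)
    qed
    show "AE x in \<nu>. (\<lambda>n. dpowr p (u x) * ?w n x) \<longlonglongrightarrow> \<bar>v x\<bar> powr p"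
      unfolding AE_\<nu>_iff using upos
    proof eventually_elim
      case (elim x)
      show ?case
      proof
        assume "x \<in> \<Omega>"
        then have ux: "0 < u x" using elim by simp
        have "(\<lambda>n. v x powr p * (u x powr (p - 1) / (u x + ?e n) powr (p - 1)))
          \<longlonglongrightarrow> v x powr p * (u x powr (p - 1) / (u x + 0) powr (p - 1))"
          using ux by (intro tendsto_intros LIMSEQ_inverse_real_of_nat) auto
        then show "(\<lambda>n. dpowr p (u x) * ?w n x) \<longlonglongrightarrow> \<bar>v x\<bar> powr p"
          unfolding eq using ux v(2)[of x] by simp
      qed
    qed
  qed
  then have "(\<lambda>n. c * d\<Psi> u (?w n)) \<longlonglongrightarrow> c * \<Psi> v"
    unfolding weighted_pow_eq[OF WD(4)[OF v(1)]] by (intro tendsto_mult tendsto_const)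
  moreover have "c * d\<Psi> u (?w n) \<le> E v" for n
  proof -
    have "(LINT z|\<mu>. Picone_deficit (?e n) u v z) + c * d\<Psi> u (?w n) \<le> E v"
      by (rule Picone_inequality(2)[OF eig u v]) simp
    moreover have "0 \<le> (LINT z|\<mu>. Picone_deficit (?e n) u v z)"
      by (intro integral_nonneg_AE AE_I2 Picone_deficit_nonneg u v) simp
    ultimately show ?thesis by linarith
  qed
  ultimately show ?thesis by (intro LIMSEQ_le_const2) auto
qed

text \<open>Truncation of |v| at height n does not increase the energy, while \<Psi> converges to
  its full value.\<close>

lemma positive_eigenvalue_le:
  assumes eig: "eigenfunction s p \<Omega> V c u" and c: "0 \<le> c" and u: "\<And>x. 0 \<le> u x"
    and upos: "AE x in lebesgue. x \<in> \<Omega> \<longrightarrow> 0 < u x" and v: "v \<in> W"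
  shows "c * \<Psi> v \<le> E v"
proof -
  let ?g = "\<lambda>(n::nat) a::real. min \<bar>a\<bar> (real n)"
  have lip: "\<bar>?g n a - ?g n b\<bar> \<le> \<bar>a - b\<bar>" for n a b by (simp add: min_def abs_if)
  have g: "?g n \<in> borel_measurable borel" "?g n 0 = 0" for n by auto
  have gW: "(\<lambda>x. ?g n (v x)) \<in> W" for n by (rule W_lipschitz_comp[OF v g(1) lip g(2)])
  have "c * \<Psi> (\<lambda>x. ?g n (v x)) \<le> E (\<lambda>x. ?g n (v x))" for n
    by (rule positive_eigenvalue_le_bounded[OF eig c u upos gW, where M = "real n"]) auto
  then have le: "c * \<Psi> (\<lambda>x. ?g n (v x)) \<le> E v" for n
    by (rule order_trans) (rule E_lipschitz_comp_le[OF v g(1) lip g(2)])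
  have "(\<lambda>n. LINT x|\<nu>. \<bar>?g n (v x)\<bar> powr p) \<longlonglongrightarrow> (LINT x|\<nu>. \<bar>v x\<bar> powr p)"
  proof (rule integral_dominated_convergence[where w = "\<lambda>x. \<bar>v x\<bar> powr p"])
    show "integrable \<nu> (\<lambda>x. \<bar>v x\<bar> powr p)" by (rule in_LpD(2)[OF W_in_Lp_\<nu>(1)[OF v]])
    then show "(\<lambda>x. \<bar>v x\<bar> powr p) \<in> borel_measurable \<nu>" by (rule borel_measurable_integrable)
    show "(\<lambda>x. \<bar>?g n (v x)\<bar> powr p) \<in> borel_measurable \<nu>" for n
      using in_LpD(2)[OF W_in_Lp_\<nu>(1)[OF gW]] by (rule borel_measurable_integrable)
    show "AE x in \<nu>. norm (\<bar>?g n (v x)\<bar> powr p) \<le> \<bar>v x\<bar> powr p" for n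
      using p by (intro AE_I2) (auto intro!: powr_mono2)
    show "AE x in \<nu>. (\<lambda>n. \<bar>?g n (v x)\<bar> powr p) \<longlonglongrightarrow> \<bar>v x\<bar> powr p"
    proof (rule AE_I2)
      fix x
      obtain N :: nat where N: "\<bar>v x\<bar> \<le> real N" using real_arch_simple by blast
      have "\<forall>\<^sub>F n in sequentially. \<bar>?g n (v x)\<bar> powr p = \<bar>v x\<bar> powr p"
        using eventually_ge_at_top[of N] by eventually_elim (use N in auto)
      then show "(\<lambda>n. \<bar>?g n (v x)\<bar> powr p) \<longlonglongrightarrow> \<bar>v x\<bar> powr p"
        by (rule tendsto_eventually)
    qed
  qed
  then have "(\<lambda>n. c * \<Psi> (\<lambda>x. ?g n (v x))) \<longlonglongrightarrow> c * \<Psi> v"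
    unfolding weighted_pow_eq[OF WD(4)[OF v]] weighted_pow_eq[OF WD(4)[OF gW]] by (intro tendsto_mult tendsto_const)
  then show ?thesis by (rule LIMSEQ_le_const2) (use le in auto)
qed

text \<open>Here v is a positive bounded function that triggers the strong maximum principle, and w
  shows that the infimum defining lam1 runs over a nonempty set.\<close>

lemma nonneg_eigenvalue_le_lam1:
  assumes eig: "eigenfunction s p \<Omega> V c u" and c: "0 \<le> c" and u: "AE x in lebesgue. 0 \<le> u x"
    and v: "v \<in> W" "\<And>x. 0 \<le> v x" "\<And>x. v x \<le> M" and vpos: "\<And>x. x \<in> \<Omega> \<Longrightarrow> 0 < v x"
    and ex: "w \<in> W" "0 < \<Psi> w"
  shows "c \<le> lam1"
proof (rule le_lam1[OF ex])
  fix z assume z: "z \<in> W"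
  have uW: "u \<in> W" using eig by (auto simp: eigenfunction_iff)
  \<comment> \<open>A representative that is nonnegative everywhere, so that powers and Picone's
    inequality apply pointwise.\<close>
  let ?u = "\<lambda>x. \<bar>u x\<bar>"
  have eig': "eigenfunction s p \<Omega> V c ?u"
  proof (rule eigenfunction_cong[OF eig])
    show "?u \<in> W" by (rule W_lipschitz_comp[OF uW, of abs]) auto
    show "AE x in lebesgue. u x = ?u x" using u by eventually_elim simp
  qed
  have nn: "0 \<le> ?u x" for x by simp
  show "c * \<Psi> z \<le> E z"
    by (rule positive_eigenvalue_le[OF eig' c nn strong_maximum_principle[OF eig' c nn v vpos] z])
qed

end

subsection \<open>Lipschitz functions and an admissible path\<close>

lemma dyadic_annulus:
  fixes t :: real
  assumes "0 < t"
  shows "t < 1 \<Longrightarrow> \<exists>j::nat. 2 powr (- real j - 1) \<le> t \<and> t < 2 powr (- real j)"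
    and "1 \<le> t \<Longrightarrow> \<exists>j::nat. 2 powr (real j) \<le> t \<and> t < 2 powr (real j + 1)"
proof -
  define k where "k = \<lfloor>log 2 t\<rfloor>"
  have k: "2 powr (real_of_int k) \<le> t \<and> t < 2 powr (real_of_int k + 1)"
    using assms floor_log_eq_powr_iff[of t 2 k] by (simp add: k_def)
  show "\<exists>j::nat. 2 powr (- real j - 1) \<le> t \<and> t < 2 powr (- real j)" if "t < 1"
  proof -
    have "log 2 t < 0" using assms that by simp
    then have "k < 0" by (simp add: k_def floor_less_iff)
    then have "0 \<le> - k - 1" by simp
    then obtain j where "- k - 1 = int j" by (rule nonneg_int_cases)
    then have j: "k = - int j - 1" by simp
    show ?thesis using k by (intro exI[of _ j]) (simp add: j)
  qed
  show "\<exists>j::nat. 2 powr (real j) \<le> t \<and> t < 2 powr (real j + 1)" if "1 \<le> t"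
  proof -
    have "0 \<le> log 2 t" using assms that by simp
    then have "0 \<le> k" by (simp add: k_def)
    then obtain j where j: "k = int j" by (rule nonneg_int_cases)
    show ?thesis using k by (intro exI[of _ j]) (simp add: j)
  qed
qed

text \<open>Radial integrals without polar coordinates: a function is majorized by multiples of
  indicators of balls whose integrals form a geometric series.\<close>

lemma nn_integral_ball_series:
  fixes a R :: "nat \<Rightarrow> real"
  assumes nonneg: "\<And>j. 0 \<le> a j" "\<And>j. 0 \<le> R j" and q: "0 \<le> q" "q < 1"
    and eq: "\<And>j. a j * R j ^ DIM('a) = C * q ^ j"
  shows "(\<integral>\<^sup>+h. (\<Sum>j. ennreal (a j) * indicator (ball (0::'a::euclidean_space) (R j)) h) \<partial>lborel) < \<infinity>"
proof -
  have "(\<integral>\<^sup>+h. (\<Sum>j. ennreal (a j) * indicator (ball (0::'a) (R j)) h) \<partial>lborel)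
      = (\<Sum>j. \<integral>\<^sup>+h. ennreal (a j) * indicator (ball (0::'a) (R j)) h \<partial>lborel)"
    by (intro nn_integral_suminf borel_measurable_times_ennreal borel_measurable_const borel_measurable_indicator) auto
  also have "\<dots> = (\<Sum>j. ennreal (C * unit_ball_vol (real DIM('a)) * q ^ j))"
  proof (rule suminf_cong)
    fix j
    have "(\<integral>\<^sup>+h. ennreal (a j) * indicator (ball (0::'a) (R j)) h \<partial>lborel) = ennreal (a j) * emeasure lborel (ball (0::'a) (R j))"
      by (rule nn_integral_cmult_indicator) simp
    also have "\<dots> = ennreal (a j * (unit_ball_vol (real DIM('a)) * R j ^ DIM('a)))"
      using nonneg by (simp add: emeasure_ball ennreal_mult)
    also have "a j * (unit_ball_vol (real DIM('a)) * R j ^ DIM('a)) = C * unit_ball_vol (real DIM('a)) * q ^ j"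
      using eq[of j] by (simp add: mult_ac)
    finally show "(\<integral>\<^sup>+h. ennreal (a j) * indicator (ball (0::'a) (R j)) h \<partial>lborel)
      = ennreal (C * unit_ball_vol (real DIM('a)) * q ^ j)" .
  qed
  also have "\<dots> = ennreal (\<Sum>j. C * unit_ball_vol (real DIM('a)) * q ^ j)"
  proof (rule suminf_ennreal2)
    have "0 \<le> a 0 * R 0 ^ DIM('a)" by (intro mult_nonneg_nonneg zero_le_power nonneg)
    then have "0 \<le> C" using eq[of 0] by simp
    then show "0 \<le> C * unit_ball_vol (real DIM('a)) * q ^ j" for j using q by simp
    show "summable (\<lambda>j. C * unit_ball_vol (real DIM('a)) * q ^ j)"
      using q by (intro summable_mult summable_geometric) auto
  qed
  also have "\<dots> < \<infinity>" by simp
  finally show ?thesis .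
qed

context weighted_problem
begin

text \<open>Up to a constant, the bound for the Gagliardo density of a bounded Lipschitz function at
  two points with difference h.\<close>

definition trunc_kernel :: "'a \<Rightarrow> real" where
  "trunc_kernel h = min (norm h powr p) 1 / norm h powr (real DIM('a) + s * p)"

lemma trunc_kernel_measurable [measurable]: "trunc_kernel \<in> borel_measurable borel"
  unfolding trunc_kernel_def by measurable

text \<open>Near 0 the dyadic series has ratio 2^(-(p - sp)), less than 1 because s < 1; at infinity
  the ratio is 2^(-sp).\<close>

lemma nn_integral_trunc_kernel: "(\<integral>\<^sup>+h. ennreal (trunc_kernel h) \<partial>lborel) < \<infinity>"
proof -
  let ?n = "real DIM('a)"
  \<comment> \<open>On the annulus 2^(-j-1) \<le> |h| < 2^(-j): numerator at the outer radius,
    denominator at the inner one. Likewise b j serves for 2^j \<le> |h| < 2^(j+1), with numerator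
    1.\<close>
  define a where "a j = (2 powr (- real j)) powr p / (2 powr (- real j - 1)) powr (?n + s * p)" for j :: nat
  define b where "b j = 1 / (2 powr real j) powr (?n + s * p)" for j :: nat
  let ?A = "\<lambda>h. \<Sum>j. ennreal (a j) * indicator (ball (0::'a) (2 powr (- real j))) h"
  let ?B = "\<lambda>h. \<Sum>j. ennreal (b j) * indicator (ball (0::'a) (2 powr (real j + 1))) h"
  have A: "(\<integral>\<^sup>+h. ?A h \<partial>lborel) < \<infinity>"
  proof (rule nn_integral_ball_series)
    show "0 \<le> a j" "0 \<le> (2::real) powr (- real j)" for j by (auto simp: a_def)
    show "0 \<le> (2::real) powr (- (p - s * p))" by simp
    have "s * p < 1 * p" using s p by (intro mult_strict_right_mono) auto
    then show "(2::real) powr (- (p - s * p)) < 1" by (intro powr_less_one) auto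
    show "a j * (2 powr (- real j)) ^ DIM('a) = 2 powr (?n + s * p) * (2 powr (- (p - s * p))) ^ j" for j
    proof -
      have "a j * (2 powr (- real j)) ^ DIM('a) = 2 powr (- real j * p - (- real j - 1) * (?n + s * p) + - real j * ?n)"
      proof -
        have "(2 powr (- real j)) ^ DIM('a) = (2::real) powr (- real j * ?n)"
          by (subst powr_realpow[symmetric]) (simp_all add: powr_powr)
        moreover have "(2 powr (- real j - 1)) powr (?n + s * p) = (2::real) powr ((- real j - 1) * (?n + s * p))"
          "(2 powr (- real j)) powr p = (2::real) powr (- real j * p)"
          by (simp_all only: powr_powr)
        moreover have "(2::real) powr (x - y + z) = 2 powr x / 2 powr y * 2 powr z" for x y z
          by (simp only: powr_add powr_diff)
        ultimately show ?thesis by (simp only: a_def)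
      qed
      also have "- real j * p - (- real j - 1) * (?n + s * p) + - real j * ?n = (?n + s * p) + - (p - s * p) * real j"
        by (simp add: algebra_simps)
      also have "2 powr \<dots> = 2 powr (?n + s * p) * (2 powr (- (p - s * p))) ^ j"
        unfolding powr_add by (simp add: powr_powr powr_realpow[symmetric])
      finally show ?thesis .
    qed
  qed
  have B: "(\<integral>\<^sup>+h. ?B h \<partial>lborel) < \<infinity>"
  proof (rule nn_integral_ball_series)
    show "0 \<le> b j" "0 \<le> (2::real) powr (real j + 1)" for j by (auto simp: b_def)
    show "0 \<le> (2::real) powr (- (s * p))" by simp
    show "(2::real) powr (- (s * p)) < 1" using sp_pos by (intro powr_less_one) auto
    show "b j * (2 powr (real j + 1)) ^ DIM('a) = 2 powr ?n * (2 powr (- (s * p))) ^ j" for j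
    proof -
      have "b j * (2 powr (real j + 1)) ^ DIM('a) = 2 powr ((real j + 1) * ?n - real j * (?n + s * p))"
      proof -
        have "(2 powr (real j + 1)) ^ DIM('a) = (2::real) powr ((real j + 1) * ?n)"
          by (subst powr_realpow[symmetric]) (simp_all only: powr_powr, simp)
        then show ?thesis by (simp only: b_def powr_powr powr_diff) simp
      qed
      also have "(real j + 1) * ?n - real j * (?n + s * p) = ?n + - (s * p) * real j"
        by (simp add: algebra_simps)
      also have "2 powr \<dots> = 2 powr ?n * (2 powr (- (s * p))) ^ j"
        unfolding powr_add by (simp add: powr_powr powr_realpow[symmetric])
      finally show ?thesis .
    qed
  qed
  have single: "f j \<le> (\<Sum>j. f j)" for f :: "nat \<Rightarrow> ennreal" and j
    using sum_le_suminf[of f "{j}"] by simp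
  have "ennreal (trunc_kernel h) \<le> ?A h + ?B h" for h
  proof (cases "h = 0")
    case False
    then have h: "0 < norm h" by simp
    show ?thesis
    proof (cases "norm h < 1")
      case True
      then obtain j :: nat where j: "2 powr (- real j - 1) \<le> norm h" "norm h < 2 powr (- real j)"
        using dyadic_annulus(1)[OF h] by blast
      have "trunc_kernel h \<le> norm h powr p / norm h powr (?n + s * p)"
        unfolding trunc_kernel_def by (intro divide_right_mono) auto
      also have "\<dots> \<le> a j"
        unfolding a_def using j h p sp_pos by (intro frac_le powr_mono2) auto
      finally have "ennreal (trunc_kernel h) \<le> ennreal (a j) * indicator (ball (0::'a) (2 powr (- real j))) h"
        using j by (simp add: ennreal_leI)
      also have "\<dots> \<le> ?A h" by (rule single)
      also have "\<dots> \<le> ?A h + ?B h" by simp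
      finally show ?thesis .
    next
      case False
      then obtain j :: nat where j: "2 powr real j \<le> norm h" "norm h < 2 powr (real j + 1)"
        using dyadic_annulus(2)[OF h] by auto
      have "trunc_kernel h \<le> 1 / norm h powr (?n + s * p)"
        unfolding trunc_kernel_def by (intro divide_right_mono) auto
      also have "\<dots> \<le> b j"
        unfolding b_def using j h sp_pos by (intro frac_le powr_mono2) auto
      finally have "ennreal (trunc_kernel h) \<le> ennreal (b j) * indicator (ball (0::'a) (2 powr (real j + 1))) h"
        using j by (simp add: ennreal_leI)
      also have "\<dots> \<le> ?B h" by (rule single)
      also have "\<dots> \<le> ?A h + ?B h" by simp
      finally show ?thesis .
    qed
  qed (simp add: trunc_kernel_def)
  then have "(\<integral>\<^sup>+h. ennreal (trunc_kernel h) \<partial>lborel) \<le> (\<integral>\<^sup>+h. ?A h + ?B h \<partial>lborel)"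
    by (intro nn_integral_mono)
  also have "\<dots> = (\<integral>\<^sup>+h. ?A h \<partial>lborel) + (\<integral>\<^sup>+h. ?B h \<partial>lborel)"
    by (intro nn_integral_add borel_measurable_suminf_order borel_measurable_times_ennreal borel_measurable_const
        borel_measurable_indicator) auto
  also have "\<dots> < \<infinity>" using A B by (simp add: less_top)
  finally show ?thesis .
qed

lemma nn_integral_trunc_kernel_translate:
  "(\<integral>\<^sup>+x. ennreal (trunc_kernel (x - y)) \<partial>lborel) = (\<integral>\<^sup>+h. ennreal (trunc_kernel h) \<partial>lborel)"
proof -
  have "(\<integral>\<^sup>+h. ennreal (trunc_kernel h) \<partial>lborel)
      = (\<integral>\<^sup>+h. ennreal (trunc_kernel h) \<partial>(distr lborel borel ((+) (- y))))"
    by (simp add: lborel_distr_plus)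
  also have "\<dots> = (\<integral>\<^sup>+x. ennreal (trunc_kernel (- y + x)) \<partial>lborel)"
    by (rule nn_integral_distr) measurable
  finally show ?thesis by simp
qed

text \<open>Near pairs are handled by the Lipschitz bound, distant ones by boundedness. Pairs with
  both points outside \<Omega> contribute nothing, so the double integral is at most a constant
  times |\<Omega>| times the integral of \<open>trunc_kernel\<close>.\<close>

lemma Lipschitz_in_W:
  assumes lip: "\<And>x y. \<bar>u x - u y\<bar> \<le> L * norm (x - y)" and bd: "\<And>x. \<bar>u x\<bar> \<le> M"
    and out: "\<And>x. x \<notin> \<Omega> \<Longrightarrow> u x = 0"
  shows "u \<in> W"
proof -
  \<comment> \<open>A vector of norm 1, used to read off L \<ge> 0 from the Lipschitz
    condition.\<close>
  obtain b0 :: 'a where b0: "b0 \<in> Basis" using nonempty_Basis by blast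
  have L: "0 \<le> L"
    using lip[of b0 0] b0 abs_ge_zero[of "u b0 - u 0"] by simp
  have M: "0 \<le> M" using bd[of 0] by linarith
  have "L-lipschitz_on UNIV u"
    using lip L by (intro lipschitz_onI) (simp_all add: dist_norm)
  then have u [measurable]: "u \<in> borel_measurable borel"
    by (intro borel_measurable_continuous_onI lipschitz_on_continuous_on)
  define C where "C = L powr p + (2 * M) powr p"
  define \<kappa> where "\<kappa> = (\<integral>\<^sup>+h. ennreal (trunc_kernel h) \<partial>lborel)"
  have \<kappa>: "\<kappa> < \<infinity>" unfolding \<kappa>_def by (rule nn_integral_trunc_kernel)
  have tk: "0 \<le> trunc_kernel h" for h by (simp add: trunc_kernel_def)
  have le: "gagliardo_density s p u (x, y) \<le> C * trunc_kernel (x - y) * (indicator \<Omega> x + indicator \<Omega> y)" for x y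
  proof (cases "x \<in> \<Omega> \<or> y \<in> \<Omega>")
    case True
    have 1: "\<bar>u x - u y\<bar> powr p \<le> L powr p * norm (x - y) powr p"
      using lip[of x y] L p by (subst powr_mult[symmetric]) (auto intro!: powr_mono2)
    have "\<bar>u x - u y\<bar> \<le> 2 * M" using bd[of x] bd[of y] by linarith
    then have 2: "\<bar>u x - u y\<bar> powr p \<le> (2 * M) powr p" using p by (intro powr_mono2) auto
    have "\<bar>u x - u y\<bar> powr p \<le> C * min (norm (x - y) powr p) 1"
    proof (cases "norm (x - y) powr p \<le> 1")
      case True
      have "L powr p * norm (x - y) powr p \<le> C * norm (x - y) powr p"
        by (intro mult_right_mono) (auto simp: C_def)
      then show ?thesis using 1 True by (simp add: min_def)
    next
      case False
      have "(2 * M) powr p \<le> C" by (simp add: C_def)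
      then show ?thesis using 2 False by (simp add: min_def)
    qed
    then have "gagliardo_density s p u (x, y) \<le> C * trunc_kernel (x - y)"
      unfolding gagliardo_density_def trunc_kernel_def by (simp add: divide_right_mono)
    also have "\<dots> \<le> C * trunc_kernel (x - y) * (indicator \<Omega> x + indicator \<Omega> y)"
    proof -
      have "0 \<le> C * trunc_kernel (x - y)" using tk by (simp add: C_def)
      moreover have "(1::real) \<le> indicator \<Omega> x + indicator \<Omega> y" using True by (auto simp: indicator_def)
      ultimately show ?thesis by (metis mult.right_neutral mult_left_mono)
    qed
    finally show ?thesis .
  next
    case False
    then show ?thesis using out p by (simp add: gagliardo_density_def)
  qed
  have C: "0 \<le> C" by (simp add: C_def)
  have I1: "(\<integral>\<^sup>+x. \<integral>\<^sup>+y. ennreal (trunc_kernel (x - y)) * indicator \<Omega> x \<partial>lborel \<partial>lborel) = \<kappa> * emeasure lborel \<Omega>"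
  proof -
    have "(\<integral>\<^sup>+y. ennreal (trunc_kernel (x - y)) * indicator \<Omega> x \<partial>lborel) = \<kappa> * indicator \<Omega> x" for x
    proof -
      have "(\<integral>\<^sup>+y. ennreal (trunc_kernel (x - y)) * indicator \<Omega> x \<partial>lborel)
          = (\<integral>\<^sup>+y. ennreal (trunc_kernel (y - x)) \<partial>lborel) * indicator \<Omega> x"
        by (subst nn_integral_multc[symmetric]) (auto simp: trunc_kernel_def norm_minus_commute)
      then show ?thesis by (simp add: nn_integral_trunc_kernel_translate \<kappa>_def)
    qed
    then show ?thesis by (simp add: nn_integral_cmult_indicator)
  qed
  have I2: "(\<integral>\<^sup>+x. \<integral>\<^sup>+y. ennreal (trunc_kernel (x - y)) * indicator \<Omega> y \<partial>lborel \<partial>lborel) = \<kappa> * emeasure lborel \<Omega>"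
  proof -
    have "(\<integral>\<^sup>+x. \<integral>\<^sup>+y. ennreal (trunc_kernel (x - y)) * indicator \<Omega> y \<partial>lborel \<partial>lborel)
        = (\<integral>\<^sup>+y. \<integral>\<^sup>+x. ennreal (trunc_kernel (x - y)) * indicator \<Omega> y \<partial>lborel \<partial>lborel)"
      by (rule lborel_pair.Fubini') measurable
    also have "\<dots> = (\<integral>\<^sup>+y. \<kappa> * indicator \<Omega> y \<partial>lborel)"
      by (intro nn_integral_cong) (simp add: nn_integral_multc nn_integral_trunc_kernel_translate \<kappa>_def)
    finally show ?thesis by (simp add: nn_integral_cmult_indicator)
  qed
  have "(\<integral>\<^sup>+z. ennreal (gagliardo_density s p u z) \<partial>lborel) = (\<integral>\<^sup>+x. \<integral>\<^sup>+y. ennreal (gagliardo_density s p u (x, y)) \<partial>lborel \<partial>lborel)"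
    using nn_integral_local_density[OF u, of s p] by (simp add: local_density_def)
  also have "\<dots> \<le> (\<integral>\<^sup>+x. \<integral>\<^sup>+y. ennreal C * (ennreal (trunc_kernel (x - y)) * indicator \<Omega> x
      + ennreal (trunc_kernel (x - y)) * indicator \<Omega> y) \<partial>lborel \<partial>lborel)"
  proof (intro nn_integral_mono)
    fix x y :: 'a
    have "ennreal (gagliardo_density s p u (x, y)) \<le> ennreal (C * trunc_kernel (x - y) * (indicator \<Omega> x + indicator \<Omega> y))"
      by (rule ennreal_leI[OF le])
    also have "\<dots> = ennreal C * (ennreal (trunc_kernel (x - y)) * indicator \<Omega> x
      + ennreal (trunc_kernel (x - y)) * indicator \<Omega> y)"
    proof -
      have "C * trunc_kernel (x - y) * (indicator \<Omega> x + indicator \<Omega> y)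
          = C * (trunc_kernel (x - y) * indicator \<Omega> x + trunc_kernel (x - y) * indicator \<Omega> y)"
        by (simp add: algebra_simps)
      then show ?thesis
        using C tk[of "x - y"] by (simp add: ennreal_mult ennreal_indicator distrib_left mult.assoc)
    qed
    finally show "ennreal (gagliardo_density s p u (x, y)) \<le> \<dots>" .
  qed
  also have "\<dots> = ennreal C * (\<kappa> * emeasure lborel \<Omega> + \<kappa> * emeasure lborel \<Omega>)"
    unfolding I1[symmetric] I2[symmetric] by (simp add: nn_integral_cmult nn_integral_add I1 I2)
  also have "\<dots> < \<infinity>"
    using \<kappa> finite_emeasure_\<Omega> by (simp add: ennreal_mult_less_top)
  finally have fin: "(\<integral>\<^sup>+z. ennreal (gagliardo_density s p u z) \<partial>lborel) < \<infinity>" .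
  have gm: "gagliardo_density s p u \<in> borel_measurable (borel :: ('a \<times> 'a) measure)"
    unfolding borel_prod[symmetric] by measurable
  have "integrable lborel (gagliardo_density s p u)"
    using fin gm by (intro integrableI_nonneg) auto
  then have 1: "integrable lebesgue (gagliardo_density s p u)"
    using gm by (subst integrable_completion) auto
  have "in_Lp p lebesgue u"
  proof (rule in_Lp_bound)
    have "integrable lborel (\<lambda>x. M powr p * indicator \<Omega> x :: real)"
      using finite_emeasure_\<Omega> by (intro integrable_mult_right integrable_real_indicator) auto
    then show "integrable lebesgue (\<lambda>x. M powr p * indicator \<Omega> x :: real)"
      by (subst integrable_completion) auto
    show "AE x in lebesgue. \<bar>u x\<bar> powr p \<le> M powr p * indicator \<Omega> x"
      using bd out p by (intro AE_I2) (auto simp: indicator_def intro!: powr_mono2)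
  qed (rule borel_imp_lebesgue_measurable[OF u])
  then show ?thesis using 1 out by (simp add: W0_def)
qed

section \<open>Explicit functions and a concrete admissible circle\<close>

definition bump :: "'a \<Rightarrow> real" where
  "bump x = min 1 (infdist x (- \<Omega>))"

text \<open>\<open>infdist\<close> to the empty set is 0 by convention, so positivity of
  \<open>bump\<close> on \<Omega> depends on this.\<close>

lemma complement_nonempty: "- \<Omega> \<noteq> {}"
proof
  assume "- \<Omega> = {}"
  then have "\<Omega> = UNIV" by auto
  then show False using \<Omega>(2) not_bounded_UNIV by simp
qed

lemma bump_Lipschitz: "\<bar>bump x - bump y\<bar> \<le> norm (x - y)"
proof -
  have "\<bar>bump x - bump y\<bar> \<le> \<bar>infdist x (- \<Omega>) - infdist y (- \<Omega>)\<bar>" by (simp add: bump_def min_def abs_if)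
  also have "\<dots> \<le> norm (x - y)" using infdist_triangle_abs[of x "- \<Omega>" y] by (simp add: dist_norm)
  finally show ?thesis .
qed

lemma bump: 
  shows bump_nonneg: "0 \<le> bump x" and bump_le_1: "bump x \<le> 1" and bump_outside: "x \<notin> \<Omega> \<Longrightarrow> bump x = 0"
    and bump_pos: "x \<in> \<Omega> \<Longrightarrow> 0 < bump x"
proof -
  show "0 \<le> bump x" by (simp add: bump_def infdist_nonneg)
  show "bump x \<le> 1" by (simp add: bump_def)
  show "bump x = 0" if "x \<notin> \<Omega>" using that by (simp add: bump_def)
  have "closed (- \<Omega>)" using \<Omega>(1) by (simp add: closed_Compl)
  then show "0 < bump x" if "x \<in> \<Omega>"
    using that infdist_pos_not_in_closed[of "- \<Omega>" x] complement_nonempty by (simp add: bump_def)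
qed

text \<open>The function serves twice: as comparison function in the strong maximum principle and as
  building block of the admissible circle.\<close>

lemma bump_W: "bump \<in> W"
  by (rule Lipschitz_in_W[where L = 1 and M = 1]) (auto simp: bump_Lipschitz bump_outside bump_nonneg bump_le_1)

definition unit_dir :: 'a where "unit_dir = (SOME b. b \<in> Basis)"

lemma unit_dir: "unit_dir \<in> Basis" unfolding unit_dir_def by (rule SOME_Basis)

definition tilted_bump :: "'a \<Rightarrow> real" where
  "tilted_bump x = bump x * (x \<bullet> unit_dir)"

text \<open>The product rule multiplies the increment of \<open>bump\<close> by the coordinate of y,
  which is bounded only on \<Omega>. For y outside \<Omega> this term is harmless if x is outside
  too; otherwise the roles of x and y are exchanged.\<close>

lemma tilted_bump_W: "tilted_bump \<in> W"
proof -
  obtain R where R: "\<And>x. x \<in> \<Omega> \<Longrightarrow> norm x \<le> R" using \<Omega>(2) by (auto simp: bounded_iff)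
  obtain x0 where "x0 \<in> \<Omega>" using \<Omega>(3) by blast
  then have R0: "0 \<le> R" using R[of x0] norm_ge_zero[of x0] by linarith
  have ip: "\<bar>x \<bullet> unit_dir\<bar> \<le> norm x" for x using Basis_le_norm[OF unit_dir] .
  have key: "\<bar>tilted_bump x - tilted_bump y\<bar> \<le> (1 + R) * norm (x - y)" if y: "y \<in> \<Omega> \<or> x \<notin> \<Omega>" for x y
  proof -
    have "tilted_bump x - tilted_bump y = bump x * ((x - y) \<bullet> unit_dir) + (y \<bullet> unit_dir) * (bump x - bump y)"
      by (simp add: tilted_bump_def algebra_simps)
    also have "\<bar>\<dots>\<bar> \<le> 1 * norm (x - y) + R * norm (x - y)"
    proof (rule order_trans[OF abs_triangle_ineq add_mono])
      show "\<bar>bump x * ((x - y) \<bullet> unit_dir)\<bar> \<le> 1 * norm (x - y)"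
        unfolding abs_mult using bump_nonneg bump_le_1 ip by (intro mult_mono) auto
      show "\<bar>(y \<bullet> unit_dir) * (bump x - bump y)\<bar> \<le> R * norm (x - y)"
      proof (cases "y \<in> \<Omega>")
        case True
        then show ?thesis
          unfolding abs_mult using R0 by (intro mult_mono bump_Lipschitz order_trans[OF ip R]) auto
      next
        case False
        then show ?thesis using y R0 by (simp add: bump_outside)
      qed
    qed
    finally show ?thesis by (simp add: algebra_simps)
  qed
  show ?thesis
  proof (rule Lipschitz_in_W[where L = "1 + R" and M = R])
    show "\<bar>tilted_bump x - tilted_bump y\<bar> \<le> (1 + R) * norm (x - y)" for x y
    proof (cases "y \<in> \<Omega>")
      case True
      then show ?thesis by (intro key) simp
    next
      case False
      then show ?thesis using key[of x y] by (metis abs_minus_commute key norm_minus_commute)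
    qed
    show "\<bar>tilted_bump x\<bar> \<le> R" for x
    proof (cases "x \<in> \<Omega>")
      case True
      have "\<bar>tilted_bump x\<bar> \<le> 1 * R"
        unfolding tilted_bump_def abs_mult
        using bump_nonneg bump_le_1 order_trans[OF ip R[OF True]] by (intro mult_mono) auto
      then show ?thesis by simp
    qed (simp add: tilted_bump_def bump_outside R0)
    show "tilted_bump x = 0" if "x \<notin> \<Omega>" for x using that by (simp add: tilted_bump_def bump_outside)
  qed
qed

text \<open>\<open>circle_fun \<omega>\<close> is \<open>bump\<close> times a nonzero affine function, so it vanishes at most on a hyperplane
  within \<open>\<Omega>\<close> and can be normalized.\<close>

definition circle_fun :: "complex \<Rightarrow> 'a \<Rightarrow> real" where
  "circle_fun \<omega> x = Re \<omega> * bump x + Im \<omega> * tilted_bump x"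

lemma circle_fun_W: "circle_fun \<omega> \<in> W"
  unfolding circle_fun_def[abs_def] by (intro W_add W_cmult bump_W tilted_bump_W)

lemma \<Psi>_circle_fun_pos:
  assumes \<omega>: "\<omega> \<in> sphere 0 1"
  shows "0 < \<Psi> (circle_fun \<omega>)"
proof (rule ccontr)
  assume "\<not> 0 < \<Psi> (circle_fun \<omega>)"
  then have "\<Psi> (circle_fun \<omega>) = 0" using \<Psi>_nonneg[OF circle_fun_W, of \<omega>] by linarith
  then have "(LINT x|\<nu>. \<bar>circle_fun \<omega> x\<bar> powr p) = 0"
    by (simp add: weighted_pow_eq WD(4)[OF circle_fun_W])
  then have "AE x in \<nu>. \<bar>circle_fun \<omega> x\<bar> powr p = 0"
    using in_LpD(2)[OF W_in_Lp_\<nu>(1)[OF circle_fun_W[of \<omega>]]] by (subst (asm) integral_nonneg_eq_0_iff_AE) auto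
  then have "AE x in lebesgue. x \<in> \<Omega> \<longrightarrow> \<bar>circle_fun \<omega> x\<bar> powr p = 0"
    by (simp only: AE_\<nu>_iff)
  then have ae: "AE x\<in>\<Omega> in lebesgue. x \<in> {x. Re \<omega> + Im \<omega> * (x \<bullet> unit_dir) = 0}"
  proof eventually_elim
    case (elim x)
    show ?case
    proof
      assume x: "x \<in> \<Omega>"
      then have "circle_fun \<omega> x = 0" using elim by simp
      moreover have "circle_fun \<omega> x = bump x * (Re \<omega> + Im \<omega> * (x \<bullet> unit_dir))"
        by (simp add: circle_fun_def tilted_bump_def algebra_simps)
      ultimately show "x \<in> {x. Re \<omega> + Im \<omega> * (x \<bullet> unit_dir) = 0}" using bump_pos[OF x] by simp
    qed
  qed
  have cl: "closed {x. Re \<omega> + Im \<omega> * (x \<bullet> unit_dir) = 0}"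
    by (intro closed_Collect_eq continuous_intros)
  \<comment> \<open>A closed set containing almost every point of an open set contains all of
    it.\<close>
  have all: "Re \<omega> + Im \<omega> * (x \<bullet> unit_dir) = 0" if "x \<in> \<Omega>" for x
    using mem_closed_if_AE_lebesgue_open[OF \<Omega>(1) cl ae that] by simp
  obtain x0 where x0: "x0 \<in> \<Omega>" using \<Omega>(3) by blast
  then obtain e where e: "0 < e" "ball x0 e \<subseteq> \<Omega>" using \<Omega>(1) open_contains_ball by blast
  have "norm unit_dir = 1" using unit_dir by simp
  \<comment> \<open>A second point of \<Omega> with another coordinate: an affine function vanishing
    at both has slope Im \<omega> = 0, and then Re \<omega> = 0.\<close>
  then have "dist x0 (x0 + (e / 2) *\<^sub>R unit_dir) < e" using e by (simp add: dist_norm)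
  then have x1: "x0 + (e / 2) *\<^sub>R unit_dir \<in> \<Omega>" using e(2) by auto
  have "unit_dir \<bullet> unit_dir = 1" using unit_dir by simp
  then have "Re \<omega> + (Im \<omega> * (x0 \<bullet> unit_dir) + Im \<omega> * (e / 2)) = 0"
    using all[OF x1] by (simp add: inner_add_left distrib_left)
  then have "Im \<omega> * (e / 2) = 0" using all[OF x0] by linarith
  then have "Im \<omega> = 0" using e by simp
  moreover then have "Re \<omega> = 0" using all[OF x0] by simp
  ultimately have "\<omega> = 0" by (simp add: complex_eq_iff)
  then show False using \<omega> by simp
qed

text \<open>Without an admissible circle the infimum defining lam2 would be an unspecified real
  number.\<close>

lemma paths_nonempty: "paths \<noteq> {}"
proof -
  have "(\<lambda>\<omega>. normalized (circle_fun \<omega>)) \<in> paths"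
  proof (rule pathI)
    fix \<omega> :: complex assume \<omega>: "\<omega> \<in> sphere 0 1"
    show "normalized (circle_fun \<omega>) \<in> S_V s p \<Omega> V"
      by (rule normalized_S_V[OF circle_fun_W \<Psi>_circle_fun_pos[OF \<omega>]])
    have eq: "circle_fun (- \<omega>) = (\<lambda>x. (-1) * circle_fun \<omega> x)" by (rule ext) (simp add: circle_fun_def)
    have "\<Psi> (circle_fun (- \<omega>)) = \<Psi> (circle_fun \<omega>)"
      unfolding eq \<Psi>_cmult[OF circle_fun_W] by simp
    then show "AE x in lebesgue. normalized (circle_fun (- \<omega>)) x = - normalized (circle_fun \<omega>) x"
      by (intro AE_I2) (simp add: normalized_def, simp add: eq)
    fix X :: "nat \<Rightarrow> complex" assume X: "\<And>n. X n \<in> sphere 0 1" "X \<longlonglongrightarrow> \<omega>"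
    let ?r = "\<lambda>n. 2 powr p * (\<bar>Re (X n) - Re \<omega>\<bar> powr p * E bump + \<bar>Im (X n) - Im \<omega>\<bar> powr p * E tilted_bump)"
    have le: "E (\<lambda>x. circle_fun (X n) x - circle_fun \<omega> x) \<le> ?r n" for n
    proof -
      have "(\<lambda>x. circle_fun (X n) x - circle_fun \<omega> x)
          = (\<lambda>x. (Re (X n) - Re \<omega>) * bump x + (Im (X n) - Im \<omega>) * tilted_bump x)"
        by (rule ext) (simp add: circle_fun_def algebra_simps)
      then show ?thesis
        using E_add_le[OF W_cmult[OF bump_W] W_cmult[OF tilted_bump_W], of "Re (X n) - Re \<omega>" "Im (X n) - Im \<omega>"]
        by (simp only: E_cmult[OF bump_W] E_cmult[OF tilted_bump_W])
    qed
    have "?r \<longlonglongrightarrow> 2 powr p * (\<bar>Re \<omega> - Re \<omega>\<bar> powr p * E bump + \<bar>Im \<omega> - Im \<omega>\<bar> powr p * E tilted_bump)"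
      using p by (intro tendsto_mult tendsto_add tendsto_const tendsto_abs_powr tendsto_diff tendsto_Re tendsto_Im X(2)) auto
    then have r: "?r \<longlonglongrightarrow> 0" using p by simp
    have "(\<lambda>n. E (\<lambda>x. circle_fun (X n) x - circle_fun \<omega> x)) \<longlonglongrightarrow> 0"
      by (rule tendsto_sandwich[OF always_eventually always_eventually tendsto_const r])
         (auto intro: le E_nonneg W_diff circle_fun_W)
    then show "(\<lambda>n. E (\<lambda>x. normalized (circle_fun (X n)) x - normalized (circle_fun \<omega>) x)) \<longlonglongrightarrow> 0"
      by (rule normalized_continuous[OF circle_fun_W circle_fun_W _ \<Psi>_circle_fun_pos[OF \<omega>]])
  qed
  then show ?thesis by blast
qed

lemma lam2_nonneg: "0 \<le> lam2"
  unfolding second_eigenvalue_def by (rule cINF_greatest[OF paths_nonempty path_max_nonneg])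

lemma nonneg_eigenfunction_false:
  assumes "eigenfunction s p \<Omega> V lam2 u" and "AE x in lebesgue. 0 \<le> u x"
  shows False
proof -
  have "(1 :: complex) \<in> sphere 0 1" by simp
  then have "lam2 \<le> lam1"
    by (intro nonneg_eigenvalue_le_lam1[OF assms(1) lam2_nonneg assms(2) bump_W bump_nonneg bump_le_1 bump_pos
        circle_fun_W \<Psi>_circle_fun_pos])
  then show False using lam1_less_lam2[OF paths_nonempty] by linarith
qed

text \<open>If one of the two sets is null, then u or -u is a nonnegative eigenfunction, which
  Picone's inequality and the strict gap exclude.\<close>

lemma lam2_eigenfunction_changes_sign:
  assumes eig: "eigenfunction s p \<Omega> V lam2 u"
  shows "changes_sign \<Omega> u"
proof -
  have uW: "u \<in> W" using eig by (simp add: eigenfunction_iff)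
  note [measurable] = WD(4)[OF uW]
  have sets: "{x \<in> space lebesgue. x \<in> \<Omega> \<and> 0 < u x} \<in> sets lebesgue" "{x \<in> space lebesgue. x \<in> \<Omega> \<and> u x < 0} \<in> sets lebesgue"
    by measurable
  have "emeasure lebesgue {x \<in> \<Omega>. 0 < u x} \<noteq> 0"
  proof
    assume "emeasure lebesgue {x \<in> \<Omega>. 0 < u x} = 0"
    then have "{x \<in> \<Omega>. 0 < u x} \<in> null_sets lebesgue" using sets(1) by (auto simp: null_sets_def)
    then have "AE x in lebesgue. x \<notin> {x \<in> \<Omega>. 0 < u x}" by (rule AE_not_in)
    with WD(3)[OF uW] have "AE x in lebesgue. 0 \<le> - u x" by eventually_elim auto
    with eigenfunction_uminus[OF eig] show False by (rule nonneg_eigenfunction_false)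
  qed
  moreover have "emeasure lebesgue {x \<in> \<Omega>. u x < 0} \<noteq> 0"
  proof
    assume "emeasure lebesgue {x \<in> \<Omega>. u x < 0} = 0"
    then have "{x \<in> \<Omega>. u x < 0} \<in> null_sets lebesgue" using sets(2) by (auto simp: null_sets_def)
    then have "AE x in lebesgue. x \<notin> {x \<in> \<Omega>. u x < 0}" by (rule AE_not_in)
    with WD(3)[OF uW] have "AE x in lebesgue. 0 \<le> u x" by eventually_elim auto
    with eig show False by (rule nonneg_eigenfunction_false)
  qed
  ultimately show ?thesis by (simp add: changes_sign_def zero_less_iff_neq_zero)
qed

end

theorem theorem3p1:
  fixes \<Omega> :: "'a::euclidean_space set" and V :: "'a \<Rightarrow> real" and s p r :: real
  assumes "open \<Omega>" and "bounded \<Omega>" and "\<Omega> \<noteq> {}"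
    and "0 < s" and "s < 1"
    and "1 < p" and "p < real DIM('a) / s"
    and "r > real DIM('a) / (s * p)"
    and "in_Lp r (lebesgue_on \<Omega>) V"
    and "AE x in lebesgue_on \<Omega>. V x > 0"
  shows "eigenvalue s p \<Omega> V (second_eigenvalue s p \<Omega> V)
    \<and> first_eigenvalue s p \<Omega> V < second_eigenvalue s p \<Omega> V
    \<and> (\<forall>u \<in> S_V s p \<Omega> V.
          eigenfunction s p \<Omega> V (second_eigenvalue s p \<Omega> V) u \<longrightarrow> changes_sign \<Omega> u)"
proof -
  interpret weighted_problem \<Omega> V s p r
    by unfold_locales (use assms in auto)
  show ?thesis
    unfolding eigenvalue_def
    using lam2_eigenfunction[OF paths_nonempty] lam1_less_lam2[OF paths_nonempty] lam2_eigenfunction_changes_sign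
    by blast
qed

end
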